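(* Let $X$ be a Banach space, let $\mathcal{T}=\{T(t,s)\}_{t\ge s\ge 0}$ be an evolution family on $X$, let $\rho\colon[0,\infty)\to[0,\infty)$ be a strictly increasing $C^1$ function with $\rho(0)=0$ and $\lim_{t\to\infty}\rho(t)=\infty$, and let $\{\|\cdot\|_t\}_{t\ge 0}$ be a family of norms on $X$ such that $t\mapsto\|x\|_t$ is continuous for each $x\in X$ and there exist $C>0$, $\varepsilon\ge 0$ with $\|x\|\le\|x\|_t\le Ce^{\varepsilon\rho(t)}\|x\|$ for all $x\in X$, $t\ge 0$. Assume that there exists a closed subspace $Z\subset X$ such that: (i) for each $y\in Y_1$ there exists a unique $x\in Y_\infty^Z$ satisfying $$x(t)=T(t,s)x(s)+\int_s^t T(t,\tau)y(\tau)\,d\tau\quad\text{for all } t\ge s\ge 0;$$ (ii) for each $y\in Y_\infty'$ there exists a unique $x\in Y_\infty^Z$ satisfying $$x(t)=T(t,s)x(s)+\int_s^t \rho'(\tau)T(t,\tau)y(\tau)\,d\tau\quad\text{for all } t\ge s\ge 0.$$ Then the evolution family $\mathcal{T}$ admits a $\rho$-dichotomy with respect to the family of norms $\|\cdot\|_t$, $t\ge 0$.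
   Context: $\mathcal{B}(X)$ is the algebra of bounded linear operators on the Banach space $(X,\|\cdot\|)$. A family $\{T(t,s)\}_{t\ge s\ge 0}\subset\mathcal{B}(X)$ is an evolution family if $T(t,t)=\mathrm{Id}$ for $t\ge 0$; $T(t,s)T(s,\tau)=T(t,\tau)$ for $t\ge s\ge\tau\ge 0$; and for all $s\ge 0$, $x\in X$ the map $t\mapsto T(t,s)x$ is continuous on $[s,\infty)$ and the map $t\mapsto T(s,t)x$ is continuous on $[0,s]$. Function spaces: $Y_1$ is the Banach space of all Bochner measurable $x\colon[0,\infty)\to X$ (identified up to a.e. equality) with $\|x\|_1:=\int_0^\infty\|x(t)\|_t\,dt<\infty$. $Y_\infty$ is the Banach space of all continuous $x\colon[0,\infty)\to X$ with $\|x\|_\infty:=\sup_{t\ge 0}\|x(t)\|_t<\infty$. For a closed subspace $Z\subset X$, $Y_\infty^Z=\{x\in Y_\infty: x(0)\in Z\}$. $Y_\infty'$ is the Banach space of all Bochner measurable $x\colon[0,\infty)\to X$ (up to a.e. equality) with $\|x\|_\infty':=\operatorname{ess\,sup}_{t\ge 0}\|x(t)\|_t<\infty$ (Lebesgue measure). $\rho$-dichotomy: $\mathcal{T}$ admits a $\rho$-dichotomy with respect to the norms $\|\cdot\|_t$ if there is a family $\{P(t)\}_{t\ge 0}$ of projections on $X$ with $T(t,s)P(s)=P(t)T(t,s)$ for $t\ge s\ge 0$, such that $T(t,s)|_{\operatorname{Ker}P(s)}\colon\operatorname{Ker}P(s)\to\operatorname{Ker}P(t)$ is invertible for all $t\ge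 s\ge 0$, and there are constants $\lambda,D>0$ such that for all $x\in X$: $\|T(t,s)P(s)x\|_t\le De^{-\lambda(\rho(t)-\rho(s))}\|x\|_s$ for $t\ge s\ge 0$, and $\|T(t,s)(\mathrm{Id}-P(s))x\|_t\le De^{-\lambda(\rho(s)-\rho(t))}\|x\|_s$ for $0\le t\le s$, where for $0\le t\le s$ one sets $T(t,s):=(T(s,t)|_{\operatorname{Ker}P(t)})^{-1}\colon\operatorname{Ker}P(s)\to\operatorname{Ker}P(t)$. *)

theory Defs
  imports "HOL-Analysis.Analysis" "HOL-Probability.Essential_Supremum"
begin

section \<open>Bochner integration in arbitrary Banach spaces\<close>

text \<open>
  The library integral \<^term>\<open>integral\<^sup>L\<close> requires a second countable, i.e. separable, target space.
  The definitions below are the same as those of \<^const>\<open>has_bochner_integral\<close> and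
  \<^const>\<open>lebesgue_integral\<close>, except that Borel measurability is replaced by almost everywhere
  approximability by simple functions (Borel measurability alone is too weak if the target space
  is not separable).
\<close>

definition bochner_measurable :: "'a measure \<Rightarrow> ('a \<Rightarrow> 'b::real_normed_vector) \<Rightarrow> bool" where
  "bochner_measurable M f \<longleftrightarrow>
    (\<exists>s. (\<forall>i::nat. simple_function M (s i)) \<and> (AE t in M. (\<lambda>i. s i t) \<longlonglongrightarrow> f t))"

definition has_strong_integral :: "'a measure \<Rightarrow> ('a \<Rightarrow> 'b::real_normed_vector) \<Rightarrow> 'b \<Rightarrow> bool" where
  "has_strong_integral M f I \<longleftrightarrow> bochner_measurable M f \<and>
    (\<exists>s. (\<forall>i::nat. Bochner_Integration.simple_bochner_integrable M (s i)) \<and>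
      (\<lambda>i. \<integral>\<^sup>+t. norm (f t - s i t) \<partial>M) \<longlonglongrightarrow> 0 \<and>
      (\<lambda>i. Bochner_Integration.simple_bochner_integral M (s i)) \<longlonglongrightarrow> I)"

definition strong_integral :: "'a measure \<Rightarrow> ('a \<Rightarrow> 'b::banach) \<Rightarrow> 'b" where
  "strong_integral M f =
    (if \<exists>I. has_strong_integral M f I then THE I. has_strong_integral M f I else 0)"

lemma bochner_measurable_norm_diff:
  assumes "bochner_measurable M f" and s: "simple_function M s"
  obtains p where "p \<in> borel_measurable M" "AE t in M. ennreal (norm (f t - s t)) = p t"
proof -
  from assms obtain u where u: "\<And>i::nat. simple_function M (u i)"
    and lim: "AE t in M. (\<lambda>i. u i t) \<longlonglongrightarrow> f t"
    unfolding bochner_measurable_def by blast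
  have "simple_function M (\<lambda>t. ennreal (norm (u i t - s t)))" for i
    using simple_function_compose2[OF u[of i] s, of "\<lambda>a b. ennreal (norm (a - b))"] by simp
  then have [measurable]: "(\<lambda>t. ennreal (norm (u i t - s t))) \<in> borel_measurable M" for i
    by (rule borel_measurable_simple_function)
  show thesis
  proof
    show "(\<lambda>t. liminf (\<lambda>i. ennreal (norm (u i t - s t)))) \<in> borel_measurable M"
      by measurable
    show "AE t in M. ennreal (norm (f t - s t)) = liminf (\<lambda>i. ennreal (norm (u i t - s t)))"
      using lim
    proof eventually_elim
      case (elim t)
      then have "(\<lambda>i. ennreal (norm (u i t - s t))) \<longlonglongrightarrow> ennreal (norm (f t - s t))"
        by (intro tendsto_ennrealI tendsto_norm tendsto_diff tendsto_const)
      then show ?case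
        by (rule lim_imp_Liminf[OF sequentially_bot, symmetric])
    qed
  qed
qed

lemma has_strong_integral_unique:
  assumes "has_strong_integral M f I" "has_strong_integral M f J"
  shows "I = J"
proof -
  have f: "bochner_measurable M f"
    using assms(1) by (simp add: has_strong_integral_def)
  obtain s where s: "\<And>i::nat. Bochner_Integration.simple_bochner_integrable M (s i)"
      "(\<lambda>i. \<integral>\<^sup>+t. norm (f t - s i t) \<partial>M) \<longlonglongrightarrow> 0"
      "(\<lambda>i. Bochner_Integration.simple_bochner_integral M (s i)) \<longlonglongrightarrow> I"
    using assms(1) unfolding has_strong_integral_def by blast
  obtain r where r: "\<And>i::nat. Bochner_Integration.simple_bochner_integrable M (r i)"
      "(\<lambda>i. \<integral>\<^sup>+t. norm (f t - r i t) \<partial>M) \<longlonglongrightarrow> 0"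
      "(\<lambda>i. Bochner_Integration.simple_bochner_integral M (r i)) \<longlonglongrightarrow> J"
    using assms(2) unfolding has_strong_integral_def by blast
  let ?d = "\<lambda>i. Bochner_Integration.simple_bochner_integral M (s i)
                - Bochner_Integration.simple_bochner_integral M (r i)"
  have bound: "ennreal (norm (?d i)) \<le>
      (\<integral>\<^sup>+t. norm (f t - s i t) \<partial>M) + (\<integral>\<^sup>+t. norm (f t - r i t) \<partial>M)" for i
  proof -
    have sf: "simple_function M (s i)" "simple_function M (r i)"
      using s(1)[of i] r(1)[of i] by (auto elim: simple_bochner_integrable.cases)
    obtain p where p [measurable]: "p \<in> borel_measurable M"
      and p_eq: "AE t in M. ennreal (norm (f t - s i t)) = p t"
      by (rule bochner_measurable_norm_diff[OF f sf(1)])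
    obtain q where q [measurable]: "q \<in> borel_measurable M"
      and q_eq: "AE t in M. ennreal (norm (f t - r i t)) = q t"
      by (rule bochner_measurable_norm_diff[OF f sf(2)])
    have "ennreal (norm (?d i))
        = norm (Bochner_Integration.simple_bochner_integral M (\<lambda>t. s i t - r i t))"
      using s(1) r(1) by (simp add: simple_bochner_integral_diff)
    also have "\<dots> \<le> Bochner_Integration.simple_bochner_integral M (\<lambda>t. norm (s i t - r i t))"
      using simple_bochner_integrable_compose2[of "(-)" M "s i" "r i"] s(1) r(1)
      by (auto intro!: simple_bochner_integral_norm_bound)
    also have "\<dots> = (\<integral>\<^sup>+t. norm (s i t - r i t) \<partial>M)"
      using simple_bochner_integrable_compose2[of "\<lambda>x y. norm (x - y)" M "s i" "r i"] s(1) r(1)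
      by (auto intro!: simple_bochner_integral_eq_nn_integral)
    also have "\<dots> \<le> (\<integral>\<^sup>+t. p t + q t \<partial>M)"
    proof (rule nn_integral_mono_AE)
      show "AE t in M. ennreal (norm (s i t - r i t)) \<le> p t + q t"
        using p_eq q_eq
      proof eventually_elim
        case (elim t)
        have "norm (s i t - r i t) \<le> norm (f t - s i t) + norm (f t - r i t)"
          by (metis dual_order.refl norm_diff_triangle_le norm_minus_commute)
        then have "ennreal (norm (s i t - r i t)) \<le> ennreal (norm (f t - s i t) + norm (f t - r i t))"
          by (rule ennreal_leI)
        with elim show ?case
          by simp
      qed
    qed
    also have "\<dots> = (\<integral>\<^sup>+t. p t \<partial>M) + (\<integral>\<^sup>+t. q t \<partial>M)"
      by (rule nn_integral_add) auto
    also have "(\<integral>\<^sup>+t. p t \<partial>M) = (\<integral>\<^sup>+t. norm (f t - s i t) \<partial>M)"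
      using p_eq by (intro nn_integral_cong_AE) auto
    also have "(\<integral>\<^sup>+t. q t \<partial>M) = (\<integral>\<^sup>+t. norm (f t - r i t) \<partial>M)"
      using q_eq by (intro nn_integral_cong_AE) auto
    finally show ?thesis .
  qed
  have "(\<lambda>i. (\<integral>\<^sup>+t. norm (f t - s i t) \<partial>M) + (\<integral>\<^sup>+t. norm (f t - r i t) \<partial>M)) \<longlonglongrightarrow> 0 + 0"
    using s(2) r(2) by (rule tendsto_add)
  then have "(\<lambda>i. ennreal (norm (?d i))) \<longlonglongrightarrow> 0"
    unfolding add_0_right
    by (rule tendsto_sandwich[OF always_eventually always_eventually tendsto_const,
          rotated 2]) (intro allI zero_le bound)+
  moreover have "(\<lambda>i. ennreal (norm (?d i))) \<longlonglongrightarrow> ennreal (norm (I - J))"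
    using s(3) r(3) by (intro tendsto_ennrealI tendsto_norm tendsto_diff)
  ultimately have "ennreal (norm (I - J)) = 0"
    using LIMSEQ_unique by blast
  then show ?thesis
    by simp
qed

lemma strong_integral_eq: "has_strong_integral M f I \<Longrightarrow> strong_integral M f = I"
  unfolding strong_integral_def by (metis has_strong_integral_unique the_equality)

lemma bochner_measurable_iff_borel_measurable:
  fixes f :: "'a::euclidean_space \<Rightarrow> 'b::{real_normed_vector, second_countable_topology}"
  assumes S: "S \<in> sets lebesgue"
  shows "bochner_measurable (lebesgue_on S) f \<longleftrightarrow> f \<in> borel_measurable (lebesgue_on S)"
proof
  assume "bochner_measurable (lebesgue_on S) f"
  then obtain s where s: "\<And>i::nat. simple_function (lebesgue_on S) (s i)"
    and ae: "AE t in lebesgue_on S. (\<lambda>i. s i t) \<longlonglongrightarrow> f t"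
    unfolding bochner_measurable_def by blast
  interpret complete_measure "lebesgue_on S"
  proof
    fix A B assume AB: "B \<subseteq> A" "A \<in> null_sets (lebesgue_on S)"
    then have "A \<in> null_sets lebesgue" "A \<subseteq> S"
      using S by (auto simp: null_sets_restrict_space)
    then have "B \<in> null_sets lebesgue" "B \<subseteq> S"
      using AB(1) by (auto intro: completion.complete2[of B A lborel])
    then show "B \<in> sets (lebesgue_on S)"
      using S by (simp add: sets_restrict_space_iff null_setsD2)
  qed
  define g where "g t = (if (\<lambda>i. s i t) \<longlonglongrightarrow> f t then f t else 0)" for t
  obtain N where N: "{t \<in> space (lebesgue_on S). \<not> (\<lambda>i. s i t) \<longlonglongrightarrow> f t} = N" "N \<in> null_sets (lebesgue_on S)"
    using ae unfolding AE_iff_null_sets by blast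
  have "(\<lambda>t. if t \<in> N then 0 else s i t) \<in> borel_measurable (lebesgue_on S)" for i
    using N(2) borel_measurable_simple_function[OF s[of i]]
    by (intro measurable_If_set) (auto simp: null_sets_def)
  moreover have "(\<lambda>i. if t \<in> N then 0 else s i t) \<longlonglongrightarrow> g t" if "t \<in> space (lebesgue_on S)" for t
    using N(1) that by (auto simp: g_def)
  ultimately have g: "g \<in> borel_measurable (lebesgue_on S)"
    by (rule borel_measurable_LIMSEQ_metric)
  have gf: "AE t in lebesgue_on S. g t = f t"
    using ae by eventually_elim (simp add: g_def)
  show "f \<in> borel_measurable (lebesgue_on S)"
  proof (rule borel_measurableI)
    fix U :: "'b set" assume "open U"
    then have A: "g -` U \<inter> space (lebesgue_on S) \<in> sets (lebesgue_on S)"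
      using g by (intro measurable_sets[OF g]) auto
    have ae_eq: "AE t in lebesgue_on S.
        t \<in> g -` U \<inter> space (lebesgue_on S) \<longleftrightarrow> t \<in> f -` U \<inter> space (lebesgue_on S)"
      using gf by eventually_elim simp
    show "f -` U \<inter> space (lebesgue_on S) \<in> sets (lebesgue_on S)"
      by (rule in_sets_AE[OF ae_eq A Int_lower2])
  qed
next
  assume "f \<in> borel_measurable (lebesgue_on S)"
  from borel_measurable_implies_sequence_metric[OF this, of 0]
  obtain s where "\<And>i. simple_function (lebesgue_on S) (s i)"
    and "\<And>t. t \<in> space (lebesgue_on S) \<Longrightarrow> (\<lambda>i. s i t) \<longlonglongrightarrow> f t"
    by blast
  then show "bochner_measurable (lebesgue_on S) f"
    unfolding bochner_measurable_def by (intro exI[of _ s] conjI allI AE_I2)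
qed

lemma has_strong_integral_iff_has_bochner_integral:
  fixes f :: "'a::euclidean_space \<Rightarrow> 'b::{real_normed_vector, second_countable_topology}"
  assumes "S \<in> sets lebesgue"
  shows "has_strong_integral (lebesgue_on S) f I \<longleftrightarrow> has_bochner_integral (lebesgue_on S) f I"
  unfolding has_strong_integral_def has_bochner_integral.simps
    bochner_measurable_iff_borel_measurable[OF assms] by blast

section \<open>Families of norms and function spaces\<close>

definition is_norm :: "('a::real_vector \<Rightarrow> real) \<Rightarrow> bool" where
  "is_norm n \<longleftrightarrow>
    (\<forall>x. 0 \<le> n x) \<and> (\<forall>x. n x = 0 \<longleftrightarrow> x = 0) \<and>
    (\<forall>c x. n (c *\<^sub>R x) = \<bar>c\<bar> * n x) \<and> (\<forall>x y. n (x + y) \<le> n x + n y)"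

text \<open>
  Functions on $[0,\infty)$ are modelled as functions on \<^typ>\<open>real\<close>. In the spaces of measurable
  functions the values on the negative half-line are irrelevant; elements are representatives of
  the classes modulo almost everywhere equality. In the spaces of continuous functions the values
  on the negative half-line are pinned down by \<^const>\<open>extensional\<close>, so that equality of elements
  is equality on $[0,\infty)$.
\<close>

definition Y1 :: "(real \<Rightarrow> 'a::banach \<Rightarrow> real) \<Rightarrow> (real \<Rightarrow> 'a) set" where
  "Y1 N = {y. bochner_measurable (lebesgue_on {0..}) y \<and>
              (\<integral>\<^sup>+t. ennreal (N t (y t)) \<partial>lebesgue_on {0..}) < \<infinity>}"

definition Yinf :: "(real \<Rightarrow> 'a::banach \<Rightarrow> real) \<Rightarrow> (real \<Rightarrow> 'a) set" where
  "Yinf N = {x. x \<in> extensional {0..} \<and> continuous_on {0..} x \<and>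
                bdd_above ((\<lambda>t. N t (x t)) ` {0..})}"

definition YinfZ :: "(real \<Rightarrow> 'a::banach \<Rightarrow> real) \<Rightarrow> 'a set \<Rightarrow> (real \<Rightarrow> 'a) set" where
  "YinfZ N Z = {x \<in> Yinf N. x 0 \<in> Z}"

definition Yinf' :: "(real \<Rightarrow> 'a::banach \<Rightarrow> real) \<Rightarrow> (real \<Rightarrow> 'a) set" where
  "Yinf' N = {y. bochner_measurable (lebesgue_on {0..}) y \<and>
                 esssup (lebesgue_on {0..}) (\<lambda>t. ennreal (N t (y t))) < \<infinity>}"

section \<open>Evolution families and dichotomies\<close>

text \<open>Only the values \<open>T t s\<close> with \<open>t \<ge> s \<ge> 0\<close> matter.\<close>

definition evolution_family :: "(real \<Rightarrow> real \<Rightarrow> 'a::banach \<Rightarrow>\<^sub>L 'a) \<Rightarrow> bool" where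
  "evolution_family T \<longleftrightarrow>
    (\<forall>t\<ge>0. T t t = id_blinfun) \<and>
    (\<forall>\<tau>\<ge>0. \<forall>s\<ge>\<tau>. \<forall>t\<ge>s. T t s o\<^sub>L T s \<tau> = T t \<tau>) \<and>
    (\<forall>s\<ge>0. \<forall>x. continuous_on {s..} (\<lambda>t. T t s x) \<and> continuous_on {0..s} (\<lambda>t. T s t x))"

definition Ker :: "('a::real_normed_vector \<Rightarrow>\<^sub>L 'b::real_normed_vector) \<Rightarrow> 'a set" where
  "Ker A = {x. A x = 0}"

text \<open>
  For \<open>0 \<le> t \<le> s\<close>, the inverse of the restriction of \<open>T s t\<close> to a map from \<open>Ker (P t)\<close>
  to \<open>Ker (P s)\<close>.
\<close>

definition backward :: "(real \<Rightarrow> real \<Rightarrow> 'a::banach \<Rightarrow>\<^sub>L 'a) \<Rightarrow> (real \<Rightarrow> 'a \<Rightarrow>\<^sub>L 'a) \<Rightarrow>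
    real \<Rightarrow> real \<Rightarrow> 'a \<Rightarrow> 'a" where
  "backward T P t s = inv_into (Ker (P t)) (T s t)"

definition rho_dichotomy :: "(real \<Rightarrow> real) \<Rightarrow> (real \<Rightarrow> real \<Rightarrow> 'a::banach \<Rightarrow>\<^sub>L 'a) \<Rightarrow>
    (real \<Rightarrow> 'a \<Rightarrow> real) \<Rightarrow> bool" where
  "rho_dichotomy \<rho> T N \<longleftrightarrow>
    (\<exists>P :: real \<Rightarrow> 'a \<Rightarrow>\<^sub>L 'a.
      (\<forall>t\<ge>0. P t o\<^sub>L P t = P t) \<and>
      (\<forall>s\<ge>0. \<forall>t\<ge>s. T t s o\<^sub>L P s = P t o\<^sub>L T t s) \<and>
      (\<forall>s\<ge>0. \<forall>t\<ge>s. bij_betw (T t s) (Ker (P s)) (Ker (P t))) \<and>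
      (\<exists>\<mu>>0. \<exists>D>0. \<forall>x.
        (\<forall>s\<ge>0. \<forall>t\<ge>s. N t (T t s (P s x)) \<le> D * exp (- \<mu> * (\<rho> t - \<rho> s)) * N s x) \<and>
        (\<forall>t\<ge>0. \<forall>s\<ge>t. N t (backward T P t s ((id_blinfun - P s) x))
                      \<le> D * exp (- \<mu> * (\<rho> s - \<rho> t)) * N s x)))"

end

theory Submission
  imports Defs "HOL-Probability.Discrete_Topology"
begin

text \<open>
  Write \<open>S(s)\<close> for the vectors with bounded forward orbit from time \<open>s\<close>. Solving the first problem for
  \<open>y(t) = \<chi>\<^bsub>[a,b]\<^esub>(t) T(t,a) v / (b - a)\<close> splits \<open>v\<close> into a vector of \<open>S(a)\<close> and a vector of \<open>T(a,0) Z\<close>, and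
  uniqueness makes the splitting direct. A closed graph theorem bounds the solution operators, and letting
  \<open>b\<close> tend to \<open>a\<close> turns this bound into uniform bounds for the splitting and for both evolutions.
  Feeding an orbit \<open>u\<close>, cut off to \<open>[s,t]\<close>, into the second problem gives the explicit solution
  \<open>(\<rho>(r) - \<rho>(s)) u(r)\<close>, or \<open>(\<rho>(r) - \<rho>(t)) u(r)\<close> in the unstable direction, so that the norm of \<open>u\<close>
  drops by a fixed factor over every \<open>\<rho>\<close>-interval of a fixed length: this is exponential decay.

  The closed graph theorem is not applied on the function spaces themselves. It suffices to bound the solution
  operator along one sequence of right-hand sides \<open>y\<^sub>n\<close> at a time, hence to consider the map that sends a
  bounded sequence \<open>d\<close> to the solution for \<open>\<Sum>n. d\<^sub>n y\<^sub>n\<close>. For the \<open>y\<^sub>n\<close> needed, the integrand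
  \<open>T(t,\<tau>) y(\<tau>)\<close> is a series of scalar functions times fixed vectors.
\<close>

text \<open>A closed graph argument on \<open>Y1 N\<close> itself would have to handle classes
  modulo null sets, and the integral of \<open>T t \<tau> (y \<tau>)\<close> for every
  \<open>y\<close>, although \<open>T\<close> is only strongly continuous and
  \<open>strong_integral\<close> is 0 outside its domain. Pieces of orbits avoid this: if
  \<open>y\<close> runs along an orbit, the evolution law makes \<open>T t \<tau> (y \<tau>)\<close>
  independent of \<open>\<tau>\<close>, and only scalar integrals remain. A growth bound on the
  evolution comes out of the splitting, in both directions, and then supplies the bound on the orbit
  pieces that are put into the second problem. The unstable part is described throughout by initial
  values in \<open>Z\<close>: a vector \<open>T s 0 z\<close> has the past \<open>T t 0 z\<close>,
  so that backward evolution involves no inverse until the very end.\<close>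

section \<open>Zabreiko's lemma and uniform boundedness\<close>

text \<open>Since \<open>p\<close> is finite everywhere, its sublevel sets cover the Banach space,
  and by Baire one of them is dense in a ball. Countable subadditivity replaces closedness of the
  sublevel sets: it carries the bound from the dense set to the whole ball, as in the open mapping
  theorem.\<close>

lemma Zabreiko:
  fixes p :: "'b::banach \<Rightarrow> real"
  assumes nonneg: "\<And>x. 0 \<le> p x"
    and hom: "\<And>r x. p (r *\<^sub>R x) = \<bar>r\<bar> * p x"
    and sub: "\<And>x. summable (\<lambda>k. norm (x k)) \<Longrightarrow> summable (\<lambda>k. p (x k)) \<Longrightarrow>
                p (\<Sum>k. x k) \<le> (\<Sum>k. p (x k))"
  shows "\<exists>K>0. \<forall>x. p x \<le> K * norm x"
proof -
  have p0: "p 0 = 0"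
    using hom[of 0 0] by simp
  have p_add: "p (x + y) \<le> p x + p y" for x y
  proof -
    let ?z = "\<lambda>k::nat. if k = 0 then x else if k = 1 then y else 0"
    have z: "norm (?z k) = 0" "p (?z k) = 0" if "k \<notin> {0, 1}" for k
      using that by (auto simp: p0)
    have "p (\<Sum>k. ?z k) \<le> (\<Sum>k. p (?z k))"
      by (rule sub; rule summable_finite[of "{0, 1}"]) (use z in auto)
    moreover have "(\<Sum>k. ?z k) = x + y"
      by (subst suminf_finite[of "{0, 1}"]) auto
    moreover have "(\<Sum>k. p (?z k)) = p x + p y"
      by (subst suminf_finite[of "{0, 1}"]) (auto simp: p0)
    ultimately show ?thesis
      by simp
  qed
  define A where "A n = {x. p x \<le> real n}" for n
  have "\<exists>n. interior (closure (A n)) \<noteq> {}"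
  proof (rule ccontr)
    assume "\<not> ?thesis"
    then have "Met_TC.mtopology interior_of \<Union> (range (\<lambda>n. closure (A n))) = {}"
      by (intro Met_TC.metric_Baire_category_alt) (auto simp: complete_UNIV)
    moreover have "\<Union> (range (\<lambda>n. closure (A n))) = UNIV"
    proof -
      have "x \<in> \<Union> (range (\<lambda>n. closure (A n)))" for x
      proof -
        obtain n where "p x \<le> real n"
          using real_arch_simple by blast
        then show ?thesis
          using closure_subset by (fastforce simp: A_def)
      qed
      then show ?thesis by blast
    qed
    ultimately show False
      by simp
  qed
  then obtain n x0 r where r: "r > 0" "ball x0 r \<subseteq> closure (A n)"
    by (metis all_not_in_conv mem_interior)
  \<comment> \<open>The ball moves from \<open>x0\<close> to the origin: for \<open>a\<close> near
    \<open>x0 + y\<close> and \<open>b\<close> near \<open>x0 - y\<close>, half of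
    \<open>a - b\<close> is near \<open>y\<close>, and it stays in the sublevel set, which is convex
    and symmetric.\<close>
  have dense: "\<exists>a. p a \<le> n \<and> norm (y - a) < e" if "norm y < r" "e > 0" for y e
  proof -
    have "x0 + y \<in> closure (A n)" "x0 - y \<in> closure (A n)"
      using that r by (auto simp: subset_iff dist_norm)
    then obtain a b where a: "a \<in> A n" "dist a (x0 + y) < e" and b: "b \<in> A n" "dist b (x0 - y) < e"
      using \<open>e > 0\<close> by (metis closure_approachable)
    let ?c = "(1/2) *\<^sub>R (a + (-1) *\<^sub>R b)"
    have "p ?c = (1/2) * p (a + (-1) *\<^sub>R b)"
      by (subst hom) simp
    also have "\<dots> \<le> (1/2) * (p a + p b)"
      using p_add[of a "(-1) *\<^sub>R b"] hom[of "-1" b] by simp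
    finally have "p ?c \<le> n"
      using a b by (simp add: A_def)
    moreover have "y - ?c = (1/2) *\<^sub>R ((b - (x0 - y)) - (a - (x0 + y)))"
      by (simp add: algebra_simps flip: scaleR_add_left)
    then have "norm (y - ?c) = norm ((b - (x0 - y)) - (a - (x0 + y))) / 2"
      by simp
    then have "norm (y - ?c) < e"
      using norm_triangle_ineq4[of "b - (x0 - y)" "a - (x0 + y)"] a b by (simp add: dist_norm)
    ultimately show ?thesis by blast
  qed
  have step: "\<exists>a. p a \<le> n * (1/2)^k \<and> norm (y - a) < r * (1/2)^Suc k"
    if "norm y < r * (1/2)^k" for y and k :: nat
  proof -
    have "norm ((2::real)^k *\<^sub>R y) < r"
      using that by (simp add: field_simps power_one_over)
    from dense[OF this, of "r / 2"] obtain a where a: "p a \<le> n" "norm (2^k *\<^sub>R y - a) < r / 2"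
      using r by auto
    have "y - (1/2)^k *\<^sub>R a = (1/2)^k *\<^sub>R (2^k *\<^sub>R y - a)"
      by (simp add: algebra_simps flip: power_mult_distrib)
    then have "norm (y - (1/2)^k *\<^sub>R a) = (1/2)^k * norm (2^k *\<^sub>R y - a)"
      by simp
    then have "norm (y - (1/2)^k *\<^sub>R a) < r * (1/2)^Suc k"
      using a by (simp add: mult.commute)
    moreover have "p ((1/2)^k *\<^sub>R a) \<le> n * (1/2)^k"
      using a by (simp add: hom mult.commute)
    ultimately show ?thesis by blast
  qed
  define f where "f k y = (SOME a. p a \<le> n * (1/2)^k \<and> norm (y - a) < r * (1/2)^Suc k)" for k y
  have f: "p (f k y) \<le> n * (1/2)^k" "norm (y - f k y) < r * (1/2)^Suc k"
    if "norm y < r * (1/2)^k" for y k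
    using someI_ex[OF step[OF that]] by (simp_all add: f_def)
  have small: "p x \<le> 2 * n" if x: "norm x < r" for x
  proof -
    \<comment> \<open>\<open>y k\<close> is the remainder after \<open>k\<close> corrections. Its
      norm is below \<open>r * (1/2)^k\<close>, so the corrections \<open>a k\<close> add up to
      \<open>x\<close>, while their seminorms are dominated by a geometric series with sum
      \<open>2 * n\<close>.\<close>
    define y where "y = rec_nat x (\<lambda>k y. y - f k y)"
    define a where "a k = f k (y k)" for k
    have y_Suc: "y (Suc k) = y k - a k" for k
      by (simp add: y_def a_def)
    have y: "norm (y k) < r * (1/2)^k" for k
    proof (induction k)
      case (Suc k)
      then show ?case
        using f(2) by (simp only: y_Suc a_def)
    qed (use x in \<open>simp add: y_def\<close>)
    have pa: "p (a k) \<le> n * (1/2)^k" for k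
      unfolding a_def by (rule f(1)[OF y])
    have "norm (a k) \<le> 2 * r * (1/2)^k" for k
    proof -
      have "norm (a k) \<le> norm (y k) + norm (y (Suc k))"
        using norm_triangle_ineq4[of "y k" "y (Suc k)"] by (simp add: y_Suc)
      moreover have "r * (1/2)^Suc k \<le> r * (1/2)^k"
        using r by simp
      ultimately show ?thesis
        using y[of k] y[of "Suc k"] by linarith
    qed
    then have sum_a: "summable (\<lambda>k. norm (a k))"
      by (intro summable_comparison_test[OF _ summable_mult[OF summable_geometric[of "1/2"]]]) auto
    have sum_p: "summable (\<lambda>k. p (a k))"
      by (rule summable_comparison_test[OF _ summable_mult[OF summable_geometric[of "1/2"]]])
        (use pa nonneg in auto)
    have "(\<Sum>k<m. a k) = x - y m" for m
      by (induction m) (auto simp: y_Suc, simp add: y_def)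
    moreover have "y \<longlonglongrightarrow> 0"
    proof (rule Lim_null_comparison[of _ "\<lambda>k. r * (1/2)^k"])
      show "(\<lambda>k. r * (1/2)^k) \<longlonglongrightarrow> 0"
        using tendsto_mult_right_zero[OF LIMSEQ_power_zero[of "1/2::real"], of r] by simp
    qed (use y in \<open>auto intro!: always_eventually less_imp_le\<close>)
    then have "(\<lambda>m. x - y m) \<longlonglongrightarrow> x - 0"
      by (intro tendsto_intros)
    ultimately have "a sums x"
      by (simp add: sums_def)
    then have "p x \<le> (\<Sum>k. p (a k))"
      using sub[OF sum_a sum_p] by (simp add: sums_iff)
    also have "\<dots> \<le> (\<Sum>k. n * (1/2)^k)"
      using pa by (intro suminf_le sum_p summable_mult summable_geometric) auto
    also have "\<dots> = 2 * n"
      by (subst suminf_mult) (simp_all add: suminf_geometric)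
    finally show ?thesis .
  qed
  \<comment> \<open>Scaling \<open>x\<close> to norm \<open>r / 2\<close> gives the factor
    \<open>4 * n / r\<close>; the summand 1 keeps the constant positive if \<open>n\<close> is
    0.\<close>
  have "p x \<le> (4 * n / r + 1) * norm x" for x
  proof (cases "x = 0")
    case False
    have "p ((r / (2 * norm x)) *\<^sub>R x) \<le> 2 * n"
      by (rule small) (use False r in auto)
    then have "p x * r \<le> 4 * n * norm x"
      using False r by (simp add: hom field_simps)
    then have "p x \<le> 4 * n / r * norm x"
      using r by (simp add: field_simps)
    then show ?thesis
      using norm_ge_zero[of x] unfolding distrib_right by linarith
  qed (simp add: p0)
  moreover have "4 * n / r + 1 > 0"
    using r by (simp add: add_nonneg_pos)
  ultimately show ?thesis
    by blast
qed

text \<open>The pointwise supremum of the norms is a seminorm, finite by hypothesis, and countably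
  subadditive because each \<open>A i\<close> is continuous; Zabreiko's lemma applies to it.\<close>

lemma uniform_boundedness:
  fixes A :: "'i \<Rightarrow> 'a::banach \<Rightarrow>\<^sub>L 'b::banach"
  assumes bdd: "\<And>x. bdd_above ((\<lambda>i. norm (A i x)) ` I)" and "I \<noteq> {}"
  shows "\<exists>M>0. \<forall>i\<in>I. \<forall>x. norm (A i x) \<le> M * norm x"
proof -
  define p where "p x = (SUP i\<in>I. norm (A i x))" for x
  have p_ge: "norm (A i x) \<le> p x" if "i \<in> I" for i x
    unfolding p_def using that by (intro cSUP_upper bdd)
  have p_le: "p x \<le> B" if "\<And>i. i \<in> I \<Longrightarrow> norm (A i x) \<le> B" for x B
    unfolding p_def using that \<open>I \<noteq> {}\<close> by (intro cSUP_least) auto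
  have nonneg: "0 \<le> p x" for x
    using \<open>I \<noteq> {}\<close> order_trans[OF norm_ge_zero p_ge] by auto
  have le: "p (r *\<^sub>R x) \<le> \<bar>r\<bar> * p x" for r x
    by (rule p_le) (simp add: blinfun.scaleR_right p_ge mult_left_mono)
  have hom: "p (r *\<^sub>R x) = \<bar>r\<bar> * p x" for r x
  proof (cases "r = 0")
    case False
    then have "\<bar>r\<bar> * p x \<le> p (r *\<^sub>R x)"
      using le[of "1 / r" "r *\<^sub>R x"] by (simp add: field_simps)
    with le show ?thesis
      by (simp add: antisym)
  qed (use le[of 0 x] nonneg[of 0] in simp)
  have sub: "p (\<Sum>k. x k) \<le> (\<Sum>k. p (x k))"
    if "summable (\<lambda>k. norm (x k))" "summable (\<lambda>k. p (x k))" for x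
  proof (rule p_le)
    fix i assume i: "i \<in> I"
    have summ: "summable (\<lambda>k. norm (A i (x k)))"
      using that(2) by (rule summable_comparison_test[rotated]) (use i p_ge in auto)
    have "A i (\<Sum>k. x k) = (\<Sum>k. A i (x k))"
      using summable_norm_cancel[OF that(1)]
      by (rule bounded_linear.suminf[OF blinfun.bounded_linear_right])
    then have "norm (A i (\<Sum>k. x k)) \<le> (\<Sum>k. norm (A i (x k)))"
      using summable_norm_cancel[OF summ] summ summable_norm by metis
    also have "\<dots> \<le> (\<Sum>k. p (x k))"
      using i p_ge summ that(2) by (intro suminf_le) auto
    finally show "norm (A i (\<Sum>k. x k)) \<le> (\<Sum>k. p (x k))" .
  qed
  obtain M where M: "M > 0" "\<And>x. p x \<le> M * norm x"
    using Zabreiko[of p, OF nonneg hom sub] by blast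
  have "norm (A i x) \<le> M * norm x" if "i \<in> I" for i x
    by (rule order_trans[OF p_ge[OF that] M(2)])
  with M(1) show ?thesis
    by blast
qed

section \<open>Bochner integrals of series\<close>

text \<open>Uniform errors, unlike the almost everywhere convergence in
  \<open>bochner_measurable\<close>, can be added over finitely many terms and integrated over a
  finite measure space.\<close>

definition uniformly_simple :: "'a measure \<Rightarrow> ('a \<Rightarrow> 'b::real_normed_vector) \<Rightarrow> bool" where
  "uniformly_simple M f \<longleftrightarrow>
    (\<forall>e>0. \<exists>s. simple_function M s \<and> (\<forall>t\<in>space M. norm (f t - s t) \<le> e))"

lemma uniformly_simple_bounded_linear:
  assumes "uniformly_simple M f" "bounded_linear L"
  shows "uniformly_simple M (\<lambda>t. L (f t))"
  unfolding uniformly_simple_def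
proof (intro allI impI)
  fix e :: real assume "e > 0"
  interpret bounded_linear L by fact
  obtain K where K: "K > 0" "\<And>x. norm (L x) \<le> norm x * K"
    using pos_bounded by blast
  obtain s where s: "simple_function M s" "\<forall>t\<in>space M. norm (f t - s t) \<le> e / K"
    using assms(1) \<open>e > 0\<close> K(1) unfolding uniformly_simple_def by (meson divide_pos_pos)
  have "norm (L (f t) - L (s t)) \<le> e" if "t \<in> space M" for t
  proof -
    have "norm (L (f t) - L (s t)) \<le> norm (f t - s t) * K"
      using K(2)[of "f t - s t"] by (simp add: diff)
    also have "\<dots> \<le> e / K * K"
      using s(2) that K(1) by (intro mult_right_mono) auto
    finally show ?thesis
      using K(1) by simp
  qed
  then show "\<exists>s. simple_function M s \<and> (\<forall>t\<in>space M. norm (L (f t) - s t) \<le> e)"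
    using simple_function_compose1[OF s(1), of L] by blast
qed

lemma uniformly_simple_indicator:
  fixes u :: "real \<Rightarrow> 'b::real_normed_vector"
  assumes "continuous_on {a..b} u" and S: "S \<in> sets lebesgue"
  shows "uniformly_simple (lebesgue_on S) (\<lambda>t. indicator {a..b} t *\<^sub>R u t)"
  unfolding uniformly_simple_def
proof (intro allI impI)
  fix e :: real assume "e > 0"
  have "uniformly_continuous_on {a..b} u"
    using assms(1) by (simp add: compact_uniformly_continuous)
  then obtain d where d: "d > 0"
      "\<And>x y. x \<in> {a..b} \<Longrightarrow> y \<in> {a..b} \<Longrightarrow> dist x y < d \<Longrightarrow> dist (u x) (u y) < e"
    using \<open>e > 0\<close> unfolding uniformly_continuous_on_def by metis
  \<comment> \<open>\<open>q t\<close> is the index of the grid cell of mesh \<open>d\<close> that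
    contains \<open>t\<close>, and \<open>s\<close> evaluates \<open>u\<close> at the left end of
    that cell. Only finitely many cells meet \<open>{a..b}\<close>.\<close>
  define q where "q t = indicator {a..b} t * real_of_int \<lfloor>(t - a) / d\<rfloor>" for t
  define s where "s t = indicator {a..b} t *\<^sub>R u (a + d * q t)" for t
  have "q ` space (lebesgue_on S) \<subseteq> insert 0 (real_of_int ` {0..\<lfloor>(b - a) / d\<rfloor>})"
  proof clarify
    fix t assume "q t \<notin> real_of_int ` {0..\<lfloor>(b - a) / d\<rfloor>}"
    moreover have "q t \<in> real_of_int ` {0..\<lfloor>(b - a) / d\<rfloor>}" if "t \<in> {a..b}"
      using that d(1) by (auto simp: q_def intro!: imageI floor_mono divide_right_mono)
    ultimately have "t \<notin> {a..b}"
      by blast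
    then show "q t = 0"
      by (simp add: q_def)
  qed
  then have fin: "finite (q ` space (lebesgue_on S))"
    by (rule finite_subset) auto
  have "q \<in> borel_measurable borel"
    unfolding q_def by measurable
  then have "q \<in> borel_measurable (lebesgue_on S)"
    by (intro measurable_restrict_space1) (simp add: measurable_completion)
  then have "simple_function (lebesgue_on S) q"
    using fin by (rule simple_function_borel_measurable)
  moreover have "indicat_real {a..b} \<in> borel_measurable (lebesgue_on S)"
    by (intro measurable_restrict_space1) (simp add: measurable_completion)
  then have "simple_function (lebesgue_on S) (indicat_real {a..b})"
    by (rule simple_function_borel_measurable)
      (auto intro: finite_subset[of _ "{0, 1}"] simp: indicator_def)
  ultimately have "simple_function (lebesgue_on S) s"
    unfolding s_def by (rule simple_function_compose2[rotated])
  moreover have "norm (indicator {a..b} t *\<^sub>R u t - s t) \<le> e" for t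
  proof (cases "t \<in> {a..b}")
    case True
    have "d * q t \<le> t - a" "t - a < d * q t + d" "0 \<le> d * q t"
      using True d(1) floor_divide_lower[OF d(1), of "t - a"] floor_divide_upper[OF d(1), of "t - a"]
      by (simp_all add: q_def algebra_simps)
    then have "dist (u t) (u (a + d * q t)) < e"
      using True by (intro d(2)) (auto simp: dist_real_def)
    then show ?thesis
      using True by (simp add: s_def dist_norm)
  qed (use \<open>e > 0\<close> in \<open>simp add: s_def\<close>)
  ultimately show "\<exists>s. simple_function (lebesgue_on S) s \<and>
      (\<forall>t\<in>space (lebesgue_on S). norm (indicator {a..b} t *\<^sub>R u t - s t) \<le> e)"
    by blast
qed

text \<open>The k-th simple function is a partial sum whose \<open>k\<close> terms are each
  approximated within \<open>(1/2)^k / (k + 1)\<close>. The total error is at most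
  \<open>(1/2)^k\<close> everywhere, however slowly the series converges.\<close>

lemma bochner_measurable_series:
  assumes f: "\<And>n::nat. uniformly_simple M (f n)" and F: "AE t in M. (\<lambda>n. f n t) sums F t"
  shows "bochner_measurable M F"
proof -
  have "\<exists>s. simple_function M s \<and> (\<forall>t\<in>space M. norm (f n t - s t) \<le> (1/2)^k / (real k + 1))" for n k
    using f[of n] unfolding uniformly_simple_def by (simp add: add_nonneg_pos)
  then obtain s where s: "\<And>n k. simple_function M (s n k)"
      "\<And>n k t. t \<in> space M \<Longrightarrow> norm (f n t - s n k t) \<le> (1/2)^k / (real k + 1)"
    by metis
  define S where "S k t = (\<Sum>n<k. s n k t)" for k t
  have S: "norm (S k t - (\<Sum>n<k. f n t)) \<le> (1/2)^k" if "t \<in> space M" for k t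
  proof -
    have "norm (S k t - (\<Sum>n<k. f n t)) = norm (\<Sum>n<k. f n t - s n k t)"
      by (simp add: S_def sum_subtractf norm_minus_commute)
    also have "\<dots> \<le> (\<Sum>n<k. (1/2)^k / (real k + 1))"
      using s(2)[OF that] by (intro sum_norm_le)
    also have "\<dots> = (1/2)^k * (real k / (real k + 1))"
      by simp
    also have "\<dots> \<le> (1/2)^k * 1"
      by (intro mult_left_mono) (auto simp: divide_le_eq_1)
    finally show ?thesis by simp
  qed
  have "AE t in M. (\<lambda>k. S k t) \<longlonglongrightarrow> F t"
    using F AE_space
  proof eventually_elim
    case (elim t)
    have "(\<lambda>k. S k t - (\<Sum>n<k. f n t)) \<longlonglongrightarrow> 0"
      using S[OF elim(2)]
      by (intro Lim_null_comparison[OF _ LIMSEQ_power_zero[of "1/2::real"]]) auto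
    from tendsto_add[OF this elim(1)[unfolded sums_def]] show ?case
      by simp
  qed
  moreover have "simple_function M (S k)" for k
    using s(1) unfolding S_def by auto
  ultimately show ?thesis
    unfolding bochner_measurable_def by blast
qed

text \<open>Stated in the extended reals, so that it also covers points where the series converges
  but not absolutely.\<close>

lemma ennreal_norm_sums_le:
  assumes "f sums x"
  shows "ennreal (norm x) \<le> (\<Sum>n. ennreal (norm (f n)))"
proof (rule LIMSEQ_le_const2)
  show "(\<lambda>k. ennreal (norm (\<Sum>n<k. f n))) \<longlonglongrightarrow> ennreal (norm x)"
    using assms unfolding sums_def by (intro tendsto_ennrealI tendsto_norm)
  have "ennreal (norm (\<Sum>n<k. f n)) \<le> (\<Sum>n. ennreal (norm (f n)))" for k
  proof -
    have "ennreal (norm (\<Sum>n<k. f n)) \<le> ennreal (\<Sum>n<k. norm (f n))"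
      by (intro ennreal_leI norm_sum)
    also have "\<dots> = (\<Sum>n<k. ennreal (norm (f n)))"
      by (simp add: sum_ennreal)
    also have "\<dots> \<le> (\<Sum>n. ennreal (norm (f n)))"
      by (intro sum_le_suminf) auto
    finally show ?thesis .
  qed
  then show "\<exists>N. \<forall>k\<ge>N. ennreal (norm (\<Sum>n<k. f n)) \<le> (\<Sum>n. ennreal (norm (f n)))"
    by blast
qed

lemma simple_bochner_integral_sum:
  assumes "finite I" "\<And>i. i \<in> I \<Longrightarrow> Bochner_Integration.simple_bochner_integrable M (f i)"
  shows "Bochner_Integration.simple_bochner_integrable M (\<lambda>x. \<Sum>i\<in>I. f i x) \<and>
    Bochner_Integration.simple_bochner_integral M (\<lambda>x. \<Sum>i\<in>I. f i x) =
      (\<Sum>i\<in>I. Bochner_Integration.simple_bochner_integral M (f i))"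
  using assms
proof (induction I)
  case empty
  then show ?case
    by (auto simp: Bochner_Integration.simple_bochner_integral_def simple_bochner_integrable.simps
        intro!: sum.neutral)
next
  case (insert i I)
  then show ?case
    using simple_bochner_integrable_compose2[of "(+)" M "f i" "\<lambda>x. \<Sum>i\<in>I. f i x"]
    by (simp add: simple_bochner_integral_add)
qed

text \<open>The simple functions demanded by \<open>has_strong_integral\<close> are partial sums
  with each \<open>f n\<close> replaced by a uniformly close simple function. Their distance from
  \<open>F\<close> in mean is at most a tail of the summable series of absolute integrals plus a
  uniform error times the finite total mass.\<close>

lemma has_strong_integral_series:
  fixes f :: "nat \<Rightarrow> 'a \<Rightarrow> real" and v :: "nat \<Rightarrow> 'b::banach"
  assumes "finite_measure M"
    and us: "\<And>n. uniformly_simple M (f n)" and int: "\<And>n. integrable M (f n)"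
    and summ: "summable (\<lambda>n. (\<integral>t. \<bar>f n t\<bar> \<partial>M) * norm (v n))"
    and F: "AE t in M. (\<lambda>n. f n t *\<^sub>R v n) sums F t"
  shows "has_strong_integral M F (\<Sum>n. (\<integral>t. f n t \<partial>M) *\<^sub>R v n)"
proof -
  interpret finite_measure M by fact
  let ?m = "measure M (space M)"
  \<comment> \<open>The error allowed for term \<open>n\<close> at stage \<open>k\<close>: divided
    by \<open>norm (v n) + 1\<close> to stay small after multiplication by \<open>v n\<close>, and
    by \<open>k + 1\<close> because \<open>k\<close> such errors are added.\<close>
  define e where "e n k = (1/2)^k / ((real k + 1) * (norm (v n) + 1))" for n k
  have e_pos: "e n k > 0" for n k
    by (auto simp: e_def intro!: divide_pos_pos mult_pos_pos add_nonneg_pos)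
  have e: "(\<Sum>n<k. e n k * norm (v n)) \<le> (1/2)^k" for k
  proof -
    have "e n k * norm (v n) \<le> (1/2)^k / (real k + 1)" for n
    proof -
      have "e n k * norm (v n) = (1/2)^k / (real k + 1) * (norm (v n) / (norm (v n) + 1))"
        by (simp add: e_def)
      also have "\<dots> \<le> (1/2)^k / (real k + 1) * 1"
        by (intro mult_left_mono) (auto simp: divide_le_eq_1 add_nonneg_pos)
      finally show ?thesis by simp
    qed
    then have "(\<Sum>n<k. e n k * norm (v n)) \<le> (\<Sum>n<k. (1/2)^k / (real k + 1))"
      by (rule sum_mono)
    also have "\<dots> = (1/2)^k * (real k / (real k + 1))"
      by simp
    also have "\<dots> \<le> (1/2)^k * 1"
      by (intro mult_left_mono) (auto simp: divide_le_eq_1)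
    finally show ?thesis by simp
  qed
  have "\<exists>s. simple_function M s \<and> (\<forall>t\<in>space M. norm (f n t - s t) \<le> e n k)" for n k
    using us e_pos unfolding uniformly_simple_def by blast
  then obtain s where s: "\<And>n k. simple_function M (s n k)"
      "\<And>n k t. t \<in> space M \<Longrightarrow> norm (f n t - s n k t) \<le> e n k"
    by metis
  have sbi: "Bochner_Integration.simple_bochner_integrable M g" if "simple_function M g"
    for g :: "'a \<Rightarrow> 'c::real_normed_vector"
    using that by (auto intro: simple_bochner_integrable.intros)
  define S where "S k t = (\<Sum>n<k. s n k t *\<^sub>R v n)" for k t
  have S_simple: "simple_function M (S k)" for k
    using simple_function_compose1[OF s(1), of "\<lambda>r. r *\<^sub>R v _"] unfolding S_def by auto
  have S_int: "Bochner_Integration.simple_bochner_integral M (S k) = (\<Sum>n<k. (\<integral>t. s n k t \<partial>M) *\<^sub>R v n)" for k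
  proof -
    have "Bochner_Integration.simple_bochner_integral M (S k) =
      (\<Sum>n<k. Bochner_Integration.simple_bochner_integral M (\<lambda>t. s n k t *\<^sub>R v n))"
      unfolding S_def
      using simple_function_compose1[OF s(1), of "\<lambda>r. r *\<^sub>R v _"]
      by (intro simple_bochner_integral_sum[THEN conjunct2] sbi) auto
    also have "\<dots> = (\<Sum>n<k. (\<integral>t. s n k t \<partial>M) *\<^sub>R v n)"
    proof (rule sum.cong[OF refl])
      fix n
      show "Bochner_Integration.simple_bochner_integral M (\<lambda>t. s n k t *\<^sub>R v n) = (\<integral>t. s n k t \<partial>M) *\<^sub>R v n"
        using simple_bochner_integral_linear[OF linear_scaleR_left sbi[OF s(1)]]
        by (simp add: simple_bochner_integrable_eq_integral[OF sbi[OF s(1)]])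
    qed
    finally show ?thesis .
  qed
  have s_int: "integrable M (s n k)" for n k
    using sbi[OF s(1)] has_bochner_integral_simple_bochner_integrable integrable.intros by blast
  have dist: "norm ((\<integral>t. s n k t \<partial>M) - (\<integral>t. f n t \<partial>M)) \<le> e n k * ?m" for n k
  proof -
    have "norm ((\<integral>t. s n k t \<partial>M) - (\<integral>t. f n t \<partial>M)) = norm (\<integral>t. s n k t - f n t \<partial>M)"
      using s_int int by simp
    also have "\<dots> \<le> (\<integral>t. e n k \<partial>M)"
      using s_int int s(2)
      by (intro Bochner_Integration.integral_norm_bound[THEN order_trans] integral_mono) (auto simp: abs_minus_commute)
    finally show ?thesis by (simp add: mult.commute)
  qed
  have summ_I: "summable (\<lambda>n. (\<integral>t. f n t \<partial>M) *\<^sub>R v n)"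
    by (rule summable_comparison_test[OF _ summ])
      (auto intro!: mult_right_mono integral_abs_bound)
  have "bochner_measurable M F"
    by (rule bochner_measurable_series[OF _ F])
      (intro uniformly_simple_bounded_linear[OF us] bounded_linear_scaleR_left)
  moreover have "(\<lambda>k. Bochner_Integration.simple_bochner_integral M (S k)) \<longlonglongrightarrow> (\<Sum>n. (\<integral>t. f n t \<partial>M) *\<^sub>R v n)"
  proof -
    let ?I = "\<lambda>k. \<Sum>n<k. (\<integral>t. f n t \<partial>M) *\<^sub>R v n"
    have "norm (Bochner_Integration.simple_bochner_integral M (S k) - ?I k) \<le> (1/2)^k * ?m" for k
    proof -
      have "norm (Bochner_Integration.simple_bochner_integral M (S k) - ?I k)
          = norm (\<Sum>n<k. ((\<integral>t. s n k t \<partial>M) - (\<integral>t. f n t \<partial>M)) *\<^sub>R v n)"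
        by (simp add: S_int sum_subtractf scaleR_left_diff_distrib)
      also have "\<dots> \<le> (\<Sum>n<k. e n k * ?m * norm (v n))"
        using dist by (intro sum_norm_le) (simp add: mult_right_mono)
      also have "\<dots> = (\<Sum>n<k. e n k * norm (v n)) * ?m"
        by (subst sum_distrib_right) (rule sum.cong, simp_all)
      also have "\<dots> \<le> (1/2)^k * ?m"
        using e by (intro mult_right_mono) auto
      finally show ?thesis .
    qed
    moreover have "(\<lambda>k. (1/2::real)^k * ?m) \<longlonglongrightarrow> 0"
      using tendsto_mult_left_zero[OF LIMSEQ_power_zero[of "1/2::real"]] by simp
    ultimately have "(\<lambda>k. Bochner_Integration.simple_bochner_integral M (S k) - ?I k) \<longlonglongrightarrow> 0"
      by (auto intro: Lim_null_comparison[of _ "\<lambda>k. (1/2)^k * ?m"])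
    from tendsto_add[OF this summable_LIMSEQ[OF summ_I]] show ?thesis
      by simp
  qed
  moreover have "(\<lambda>k. \<integral>\<^sup>+t. norm (F t - S k t) \<partial>M) \<longlonglongrightarrow> 0"
  proof -
    define a where "a n = (\<integral>t. \<bar>f n t\<bar> \<partial>M) * norm (v n)" for n
    have sum_a: "summable a" and a_nonneg: "a n \<ge> 0" for n
      using summ by (simp_all add: a_def[abs_def])
    have [measurable]: "f n \<in> borel_measurable M" for n
      using int by auto
    have f_int: "(\<integral>\<^sup>+t. ennreal (\<bar>f n t\<bar> * norm (v n)) \<partial>M) = ennreal (a n)" for n
    proof -
      have "(\<integral>\<^sup>+t. ennreal (\<bar>f n t\<bar> * norm (v n)) \<partial>M) = ennreal (\<integral>t. \<bar>f n t\<bar> * norm (v n) \<partial>M)"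
        by (intro nn_integral_eq_integral) (auto intro: int)
      then show ?thesis
        by (simp add: a_def)
    qed
    have bound: "(\<integral>\<^sup>+t. norm (F t - S k t) \<partial>M) \<le> ennreal ((\<Sum>n. a (n + k)) + (1/2)^k * ?m)" for k
    proof -
      have "(\<integral>\<^sup>+t. norm (F t - S k t) \<partial>M) \<le>
          (\<integral>\<^sup>+t. (\<Sum>n. ennreal (\<bar>f (n + k) t\<bar> * norm (v (n + k)))) + ennreal ((1/2)^k) \<partial>M)"
      proof (rule nn_integral_mono_AE)
        show "AE t in M. ennreal (norm (F t - S k t)) \<le>
          (\<Sum>n. ennreal (\<bar>f (n + k) t\<bar> * norm (v (n + k)))) + ennreal ((1/2)^k)"
          using F AE_space
        proof eventually_elim
          case (elim t)
          \<comment> \<open>\<open>?G\<close> is the tail of the series at \<open>t\<close>; the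
            rest of the difference comes from the simple approximation.\<close>
          let ?G = "F t - (\<Sum>n<k. f n t *\<^sub>R v n)"
          have "(\<lambda>n. f (n + k) t *\<^sub>R v (n + k)) sums ?G"
            using elim(1) by (rule sums_split_initial_segment)
          from ennreal_norm_sums_le[OF this]
          have 1: "ennreal (norm ?G) \<le> (\<Sum>n. ennreal (\<bar>f (n + k) t\<bar> * norm (v (n + k))))"
            by simp
          have "norm (\<Sum>n<k. (f n t - s n k t) *\<^sub>R v n) \<le> (\<Sum>n<k. e n k * norm (v n))"
            using s(2)[OF elim(2)] by (intro sum_norm_le) (simp add: mult_right_mono)
          then have 2: "norm (\<Sum>n<k. (f n t - s n k t) *\<^sub>R v n) \<le> (1/2)^k"
            using e[of k] by linarith
          have eq: "F t - S k t = ?G + (\<Sum>n<k. (f n t - s n k t) *\<^sub>R v n)"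
            by (simp add: S_def sum_subtractf scaleR_left_diff_distrib)
          have "norm (F t - S k t) \<le> norm ?G + (1/2)^k"
            unfolding eq using 2 norm_triangle_ineq[of ?G "\<Sum>n<k. (f n t - s n k t) *\<^sub>R v n"] by linarith
          then have "ennreal (norm (F t - S k t)) \<le> ennreal (norm ?G) + ennreal ((1/2)^k)"
            by (simp add: ennreal_leI flip: ennreal_plus)
          also have "\<dots> \<le> (\<Sum>n. ennreal (\<bar>f (n + k) t\<bar> * norm (v (n + k)))) + ennreal ((1/2)^k)"
            using 1 by (rule add_right_mono)
          finally show ?case .
        qed
      qed
      also have "\<dots> = (\<integral>\<^sup>+t. (\<Sum>n. ennreal (\<bar>f (n + k) t\<bar> * norm (v (n + k)))) \<partial>M)
          + (\<integral>\<^sup>+t. ennreal ((1/2)^k) \<partial>M)"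
        by (rule nn_integral_add) measurable
      also have "\<dots> = (\<Sum>n. \<integral>\<^sup>+t. ennreal (\<bar>f (n + k) t\<bar> * norm (v (n + k))) \<partial>M)
          + ennreal ((1/2)^k) * emeasure M (space M)"
        by (subst nn_integral_suminf) simp_all
      also have "\<dots> = (\<Sum>n. ennreal (a (n + k))) + ennreal ((1/2)^k * ?m)"
        by (simp only: f_int) (simp add: emeasure_eq_measure ennreal_mult)
      also have "\<dots> = ennreal (\<Sum>n. a (n + k)) + ennreal ((1/2)^k * ?m)"
        using a_nonneg summable_ignore_initial_segment[OF sum_a] by (subst suminf_ennreal2) auto
      also have "\<dots> = ennreal ((\<Sum>n. a (n + k)) + (1/2)^k * ?m)"
        using a_nonneg summable_ignore_initial_segment[OF sum_a]
        by (intro ennreal_plus[symmetric] suminf_nonneg) auto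
      finally show ?thesis .
    qed
    have "(\<lambda>k. (\<Sum>n. a n) - (\<Sum>n<k. a n) + (1/2)^k * ?m) \<longlonglongrightarrow> (\<Sum>n. a n) - (\<Sum>n. a n) + 0 * ?m"
      by (intro tendsto_intros summable_LIMSEQ[OF sum_a] LIMSEQ_power_zero) auto
    then have "(\<lambda>k. (\<Sum>n. a (n + k)) + (1/2)^k * ?m) \<longlonglongrightarrow> 0"
      by (simp add: suminf_minus_initial_segment[OF sum_a])
    then have "(\<lambda>k. ennreal ((\<Sum>n. a (n + k)) + (1/2)^k * ?m)) \<longlonglongrightarrow> ennreal 0"
      by (rule tendsto_ennrealI)
    then show ?thesis
      using bound by (auto intro: tendsto_sandwich[of "\<lambda>_. 0", rotated 2])
  qed
  ultimately show ?thesis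
    unfolding has_strong_integral_def using sbi[OF S_simple] by blast
qed

text \<open>\<open>max a (min b t)\<close> is the point of \<open>{a..b}\<close> nearest to
  \<open>t\<close>. With this clamp one formula covers every position of \<open>{s..t}\<close>
  relative to \<open>{a..b}\<close>; for disjoint intervals the two clamped points coincide and the
  integral is 0.\<close>

lemma
  fixes g G :: "real \<Rightarrow> real"
  assumes G: "\<And>t. t \<ge> 0 \<Longrightarrow> (G has_real_derivative g t) (at t within {0..})"
    and g: "continuous_on {0..} g" and "0 \<le> a" "a \<le> b" "0 \<le> s" "s \<le> t"
  shows integrable_indicator_clamp: "integrable (lebesgue_on {s..t}) (\<lambda>\<tau>. indicator {a..b} \<tau> * g \<tau>)"
    and integral_indicator_clamp: "(\<integral>\<tau>. indicator {a..b} \<tau> * g \<tau> \<partial>lebesgue_on {s..t})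
      = G (max a (min b t)) - G (max a (min b s))"
proof -
  let ?f = "\<lambda>\<tau>. indicator {max a s..min b t} \<tau> *\<^sub>R g \<tau>"
  have f: "indicator {s..t} \<tau> *\<^sub>R (indicator {a..b} \<tau> * g \<tau>) = ?f \<tau>" for \<tau>
    by (auto simp: indicator_def)
  have cont: "continuous_on {max a s..min b t} g"
    using g by (rule continuous_on_subset) (use assms in auto)
  have int: "integrable lborel ?f"
    using borel_integrable_atLeastAtMost'[OF cont] by (simp add: set_integrable_def)
  then have int': "integrable lebesgue ?f"
    by (simp add: integrable_completion)
  then show "integrable (lebesgue_on {s..t}) (\<lambda>\<tau>. indicator {a..b} \<tau> * g \<tau>)"
    by (subst integrable_restrict_space) (simp_all only: f, simp_all)
  have "(\<integral>\<tau>. indicator {a..b} \<tau> * g \<tau> \<partial>lebesgue_on {s..t}) = (\<integral>\<tau>. ?f \<tau> \<partial>lebesgue)"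
    by (subst integral_restrict_space) (simp_all only: f, simp_all)
  also have "\<dots> = (\<integral>\<tau>. ?f \<tau> \<partial>lborel)"
    using int by (intro integral_completion) auto
  also have "\<dots> = G (max a (min b t)) - G (max a (min b s))"
  proof (cases "max a s \<le> min b t")
    case True
    have "(G has_vector_derivative g x) (at x within {max a s..min b t})"
      if "max a s \<le> x" "x \<le> min b t" for x
      using has_vector_derivative_within_subset[of G "g x" x "{0..}"] G[of x] that assms
      by (auto simp: has_real_derivative_iff_has_vector_derivative)
    from integral_FTC_atLeastAtMost[OF True this cont] show ?thesis
      using True assms by (simp add: min_def max_def split: if_splits)
  next
    case False
    then have "?f = (\<lambda>_. 0)"
      by (auto simp: indicator_def)
    then show ?thesis
      using False assms by (auto simp: min_def max_def)
  qed
  finally show "(\<integral>\<tau>. indicator {a..b} \<tau> * g \<tau> \<partial>lebesgue_on {s..t})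
      = G (max a (min b t)) - G (max a (min b s))" .
qed

text \<open>The two intervals overlap in a set of length at most \<open>b - a\<close> and at most
  \<open>t\<close>. The first bound serves data in \<open>Y1\<close>, where
  \<open>(b n - a n) * \<beta> n\<close> is summable, the second data in \<open>Yinf'\<close>, where
  \<open>\<beta>\<close> itself is.\<close>

lemma integral_abs_indicator_le:
  fixes g G :: "real \<Rightarrow> real"
  assumes g: "continuous_on {0..} g" and "0 \<le> a" "a \<le> b" "0 \<le> s" "s \<le> t"
    and B: "\<And>\<tau>. \<tau> \<in> {0..t} \<Longrightarrow> \<bar>g \<tau>\<bar> \<le> B"
  shows "(\<integral>\<tau>. \<bar>indicator {a..b} \<tau> * g \<tau>\<bar> \<partial>lebesgue_on {s..t}) \<le> B * min t (b - a)"
proof -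
  have "0 \<le> B"
    using order_trans[OF abs_ge_zero B, of t] assms by auto
  let ?c = "\<lambda>\<tau>. max a (min b \<tau>)"
  have 1: "(\<integral>\<tau>. indicator {a..b} \<tau> * B \<partial>lebesgue_on {s..t}) = B * ?c t - B * ?c s"
      "integrable (lebesgue_on {s..t}) (\<lambda>\<tau>. indicator {a..b} \<tau> * B)"
    using assms
    by (intro integral_indicator_clamp[where G="\<lambda>t. B * t"] integrable_indicator_clamp[where G="\<lambda>t. B * t"];
      auto intro!: derivative_eq_intros)+
  have "(\<integral>\<tau>. \<bar>indicator {a..b} \<tau> * g \<tau>\<bar> \<partial>lebesgue_on {s..t})
      \<le> (\<integral>\<tau>. indicator {a..b} \<tau> * B \<partial>lebesgue_on {s..t})"
  proof (rule integral_mono)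
    show "integrable (lebesgue_on {s..t}) (\<lambda>\<tau>. \<bar>indicator {a..b} \<tau> * g \<tau>\<bar>)"
    proof (rule Bochner_Integration.integrable_bound[OF 1(2)])
      have "g \<in> borel_measurable (lebesgue_on {s..t})"
        using continuous_on_subset[OF g, of "{s..t}"] \<open>0 \<le> s\<close>
        by (intro continuous_imp_measurable_on_sets_lebesgue) auto
      moreover have "indicat_real {a..b} \<in> borel_measurable (lebesgue_on {s..t})"
        by (intro measurable_restrict_space1) (simp add: measurable_completion)
      ultimately show "(\<lambda>\<tau>. \<bar>indicator {a..b} \<tau> * g \<tau>\<bar>) \<in> borel_measurable (lebesgue_on {s..t})"
        by measurable
      show "AE \<tau> in lebesgue_on {s..t}. norm \<bar>indicator {a..b} \<tau> * g \<tau>\<bar> \<le> norm (indicator {a..b} \<tau> * B)"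
      proof (rule AE_I2)
        fix \<tau> assume "\<tau> \<in> space (lebesgue_on {s..t})"
        then show "norm \<bar>indicator {a..b} \<tau> * g \<tau>\<bar> \<le> norm (indicator {a..b} \<tau> * B)"
          using B[of \<tau>] \<open>0 \<le> s\<close> by (cases "\<tau> \<in> {a..b}") auto
      qed
    qed
    show "\<bar>indicator {a..b} \<tau> * g \<tau>\<bar> \<le> indicator {a..b} \<tau> * B" if "\<tau> \<in> space (lebesgue_on {s..t})" for \<tau>
      using B[of \<tau>] that \<open>0 \<le> s\<close> by (cases "\<tau> \<in> {a..b}") auto
  qed (rule 1)
  also have "\<dots> = B * (?c t - ?c s)"
    using 1 by (simp add: right_diff_distrib)
  also have "\<dots> \<le> B * min t (b - a)"
    using assms \<open>0 \<le> B\<close> by (intro mult_left_mono) (auto simp: min_def max_def)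
  finally show ?thesis .
qed

section \<open>Evolution families and mild solutions\<close>

text \<open>\<open>c t\<close> stands for \<open>C * exp (\<epsilon> * \<rho> t)\<close>: on each
  bounded time interval it makes the norms \<open>N t\<close> uniformly equivalent to the given
  norm.\<close>

locale evolution_norms =
  fixes T :: "real \<Rightarrow> real \<Rightarrow> 'a::banach \<Rightarrow>\<^sub>L 'a"
    and N :: "real \<Rightarrow> 'a \<Rightarrow> real"
    and c :: "real \<Rightarrow> real"
  assumes evol: "evolution_family T"
    and N_norm: "\<And>t. t \<ge> 0 \<Longrightarrow> is_norm (N t)"
    and N_cont: "\<And>x. continuous_on {0..} (\<lambda>t. N t x)"
    and norm_le_N: "\<And>t x. t \<ge> 0 \<Longrightarrow> norm x \<le> N t x"
    and N_le_norm: "\<And>t x. t \<ge> 0 \<Longrightarrow> N t x \<le> c t * norm x"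
    and c_nonneg: "\<And>t. t \<ge> 0 \<Longrightarrow> 0 \<le> c t"
    and c_mono: "\<And>s t. 0 \<le> s \<Longrightarrow> s \<le> t \<Longrightarrow> c s \<le> c t"
begin

lemma T_id: "t \<ge> 0 \<Longrightarrow> T t t x = x"
  using evol by (simp add: evolution_family_def)

lemma T_comp: "0 \<le> r \<Longrightarrow> r \<le> s \<Longrightarrow> s \<le> t \<Longrightarrow> T t s (T s r x) = T t r x"
  using evol unfolding evolution_family_def by (metis blinfun_apply_blinfun_compose)

lemma T_cont: "s \<ge> 0 \<Longrightarrow> continuous_on {s..} (\<lambda>t. T t s x)"
  and T_cont': "s \<ge> 0 \<Longrightarrow> continuous_on {0..s} (\<lambda>t. T s t x)"
  using evol by (simp_all add: evolution_family_def)

lemma N_nonneg: "t \<ge> 0 \<Longrightarrow> 0 \<le> N t x"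
  and N_eq_0: "t \<ge> 0 \<Longrightarrow> N t x = 0 \<longleftrightarrow> x = 0"
  and N_scale: "t \<ge> 0 \<Longrightarrow> N t (r *\<^sub>R x) = \<bar>r\<bar> * N t x"
  and N_add: "t \<ge> 0 \<Longrightarrow> N t (x + y) \<le> N t x + N t y"
  using N_norm[of t] by (simp_all add: is_norm_def)

lemma N_minus: "t \<ge> 0 \<Longrightarrow> N t (- x) = N t x"
  using N_scale[of t "-1" x] by simp

lemma N_diff: "t \<ge> 0 \<Longrightarrow> N t (x - y) \<le> N t x + N t y"
  using N_add[of t x "- y"] N_minus[of t y] by simp

lemma N_sum: "t \<ge> 0 \<Longrightarrow> N t (\<Sum>i\<in>I. x i) \<le> (\<Sum>i\<in>I. N t (x i))"
proof (induction I rule: infinite_finite_induct)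
  case (insert i I)
  then show ?case
    using N_add[of t "x i" "\<Sum>i\<in>I. x i"] by simp
qed (use N_eq_0[of t 0] in simp_all)

lemma N_tendsto:
  assumes "t \<ge> 0" "(f \<longlongrightarrow> x) F"
  shows "((\<lambda>k. N t (f k)) \<longlongrightarrow> N t x) F"
proof -
  have "\<bar>N t y - N t x\<bar> \<le> c t * norm (y - x)" for y
    using N_add[OF assms(1), of "y - x" x] N_add[OF assms(1), of "x - y" y]
      N_le_norm[OF assms(1), of "y - x"] N_minus[OF assms(1), of "y - x"] by simp
  moreover have "((\<lambda>k. c t * norm (f k - x)) \<longlongrightarrow> c t * norm (x - x)) F"
    using assms(2) by (intro tendsto_intros)
  then have "((\<lambda>k. c t * norm (f k - x)) \<longlongrightarrow> 0) F"
    by simp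
  ultimately have "((\<lambda>k. N t (f k) - N t x) \<longlongrightarrow> 0) F"
    by (auto intro: Lim_null_comparison[of _ "\<lambda>k. c t * norm (f k - x)"])
  then show ?thesis
    by (rule LIM_zero_cancel)
qed

lemma N_sums_le:
  assumes "t \<ge> 0" "f sums x" "summable (\<lambda>k. N t (f k))"
  shows "N t x \<le> (\<Sum>k. N t (f k))"
proof (rule LIMSEQ_le_const2)
  show "(\<lambda>k. N t (\<Sum>i<k. f i)) \<longlonglongrightarrow> N t x"
    using assms(1,2) unfolding sums_def by (rule N_tendsto)
  have "N t (\<Sum>i<k. f i) \<le> (\<Sum>k. N t (f k))" for k
    using N_sum[OF assms(1), of f "{..<k}"] sum_le_suminf[OF assms(3), of "{..<k}"]
      N_nonneg[OF assms(1)] by (auto intro: order_trans)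
  then show "\<exists>n. \<forall>k\<ge>n. N t (\<Sum>i<k. f i) \<le> (\<Sum>k. N t (f k))"
    by blast
qed

text \<open>Strong continuity bounds \<open>T t s x\<close> over the compact interval of all
  \<open>s\<close> for each \<open>x\<close>, and uniform boundedness makes this an operator bound.
  It controls infinitely many blocks with different starting times at once.\<close>

lemma T_bounded:
  assumes "t \<ge> 0"
  obtains M where "M > 0" "\<And>s x. 0 \<le> s \<Longrightarrow> s \<le> t \<Longrightarrow> norm (T t s x) \<le> M * norm x"
proof -
  have "bdd_above ((\<lambda>s. norm (T t s x)) ` {0..t})" for x
    using compact_continuous_image[OF continuous_on_norm[OF T_cont'[OF assms]] compact_Icc]
    by (rule compact_imp_bounded[THEN bounded_imp_bdd_above])
  moreover have "{0..t} \<noteq> {}"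
    using assms by simp
  ultimately have "\<exists>M>0. \<forall>s\<in>{0..t}. \<forall>x. norm (T t s x) \<le> M * norm x"
    by (rule uniform_boundedness[of "T t" "{0..t}"])
  then obtain M where M: "M > 0" "\<And>s x. s \<in> {0..t} \<Longrightarrow> norm (T t s x) \<le> M * norm x"
    by blast
  show thesis
    by (rule that[OF M(1)]) (simp add: M(2))
qed

text \<open>The integral term is an arbitrary \<open>h\<close>, so that the closed graph theorem
  below can speak of linear maps \<open>J s t\<close> of the data instead of integrals.\<close>

definition mild :: "(real \<Rightarrow> real \<Rightarrow> 'a) \<Rightarrow> (real \<Rightarrow> 'a) \<Rightarrow> bool" where
  "mild h x \<longleftrightarrow> (\<forall>s\<ge>0. \<forall>t\<ge>s. x t = T t s (x s) + h s t)"

lemma mildD: "mild h x \<Longrightarrow> 0 \<le> s \<Longrightarrow> s \<le> t \<Longrightarrow> x t = T t s (x s) + h s t"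
  unfolding mild_def by blast

lemma YinfZI:
  assumes "x \<in> extensional {0..}" "continuous_on {0..} x" "x 0 \<in> Z" "\<And>t. t \<ge> 0 \<Longrightarrow> N t (x t) \<le> B"
  shows "x \<in> YinfZ N Z"
proof -
  have "bdd_above ((\<lambda>t. N t (x t)) ` {0..})"
    using assms(4) by (intro bdd_aboveI[of _ B]) auto
  with assms(1-3) show ?thesis
    by (simp add: YinfZ_def Yinf_def)
qed

lemma YinfZD:
  assumes "x \<in> YinfZ N Z"
  shows "x \<in> extensional {0..}" "continuous_on {0..} x" "x 0 \<in> Z"
    and "bdd_above ((\<lambda>t. N t (x t)) ` {0..})"
  using assms by (simp_all add: YinfZ_def Yinf_def)

text \<open>Elements of \<open>Yinf\<close> are pinned down on the negative half-line, so a multiple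
  has to be restricted again before uniqueness can be applied to it.\<close>

lemma YinfZ_scale:
  assumes x: "x \<in> YinfZ N Z" and Z: "subspace Z"
  shows "restrict (\<lambda>t. r *\<^sub>R x t) {0..} \<in> YinfZ N Z"
proof (rule YinfZI)
  have "continuous_on {0..} (\<lambda>t. r *\<^sub>R x t)"
    by (intro continuous_intros YinfZD(2)[OF x])
  then show "continuous_on {0..} (restrict (\<lambda>t. r *\<^sub>R x t) {0..})"
    by (rule continuous_on_eq) simp
  show "N t (restrict (\<lambda>t. r *\<^sub>R x t) {0..} t) \<le> \<bar>r\<bar> * (SUP t\<in>{0..}. N t (x t))" if "t \<ge> 0" for t
    using that cSUP_upper[OF _ YinfZD(4)[OF x], of t] by (simp add: N_scale mult_left_mono)
qed (use YinfZD(3)[OF x] Z in \<open>simp_all add: subspace_scale\<close>)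

lemma mild_scale:
  assumes "mild h x"
  shows "mild (\<lambda>s t. r *\<^sub>R h s t) (restrict (\<lambda>t. r *\<^sub>R x t) {0..})"
  unfolding mild_def
proof (intro allI impI)
  fix s t :: real assume st: "0 \<le> s" "s \<le> t"
  have "x t = T t s (x s) + h s t"
    using assms st by (rule mildD)
  then show "restrict (\<lambda>t. r *\<^sub>R x t) {0..} t = T t s (restrict (\<lambda>t. r *\<^sub>R x t) {0..} s) + r *\<^sub>R h s t"
    using st by (simp add: scaleR_add_right blinfun.scaleR_right)
qed

lemma mild_cong:
  assumes "\<And>s t. 0 \<le> s \<Longrightarrow> s \<le> t \<Longrightarrow> h s t = h' s t"
  shows "mild h x \<longleftrightarrow> mild h' x"
  unfolding mild_def by (simp add: assms cong: all_cong imp_cong)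

text \<open>A closed graph theorem: the norm of the solution is a countably subadditive seminorm of the data.\<close>

lemma mild_solution_bounded:
  fixes J :: "real \<Rightarrow> real \<Rightarrow> 'c::banach \<Rightarrow> 'a"
  assumes J: "\<And>s t. 0 \<le> s \<Longrightarrow> s \<le> t \<Longrightarrow> bounded_linear (J s t)"
    and Z: "closed Z" "subspace Z"
    and ex1: "\<And>y. \<exists>!x. x \<in> YinfZ N Z \<and> mild (\<lambda>s t. J s t y) x"
  shows "\<exists>K>0. \<forall>y x t. x \<in> YinfZ N Z \<longrightarrow> mild (\<lambda>s t. J s t y) x \<longrightarrow> 0 \<le> t \<longrightarrow> N t (x t) \<le> K * norm y"
proof -
  define X where "X y = (THE x. x \<in> YinfZ N Z \<and> mild (\<lambda>s t. J s t y) x)" for y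
  have X: "X y \<in> YinfZ N Z" "mild (\<lambda>s t. J s t y) (X y)" for y
    using theI'[OF ex1[of y]] by (simp_all add: X_def)
  have X_unique: "x = X y" if "x \<in> YinfZ N Z" "mild (\<lambda>s t. J s t y) x" for x y
    using ex1[of y] X[of y] that by blast
  define p where "p y = (SUP t\<in>{0..}. N t (X y t))" for y
  have p_ge: "N t (X y t) \<le> p y" if "t \<ge> 0" for t y
    unfolding p_def using that by (intro cSUP_upper YinfZD(4)[OF X(1)]) simp
  have p_le: "p y \<le> B" if "\<And>t. t \<ge> 0 \<Longrightarrow> N t (X y t) \<le> B" for y B
    unfolding p_def using that by (intro cSUP_least) auto
  have nonneg: "0 \<le> p y" for y
    using p_ge[of 0 y] N_nonneg[of 0 "X y 0"] by simp
  have X_scale: "X (r *\<^sub>R y) t = r *\<^sub>R X y t" if "t \<ge> 0" for r y t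
  proof -
    have "mild (\<lambda>s t. J s t (r *\<^sub>R y)) (restrict (\<lambda>t. r *\<^sub>R X y t) {0..})"
      using mild_scale[OF X(2), of r]
      by (rule mild_cong[THEN iffD1, rotated]) (simp add: linear_scale bounded_linear.linear J)
    then have "restrict (\<lambda>t. r *\<^sub>R X y t) {0..} = X (r *\<^sub>R y)"
      by (intro X_unique YinfZ_scale X(1) Z)
    from fun_cong[OF this, of t] show ?thesis
      using that by simp
  qed
  have le: "p (r *\<^sub>R y) \<le> \<bar>r\<bar> * p y" for r y
    by (rule p_le) (simp add: X_scale N_scale p_ge mult_left_mono)
  have hom: "p (r *\<^sub>R y) = \<bar>r\<bar> * p y" for r y
  proof (cases "r = 0")
    case False
    then have "\<bar>r\<bar> * p y \<le> p (r *\<^sub>R y)"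
      using le[of "1 / r" "r *\<^sub>R y"] by (simp add: field_simps)
    with le show ?thesis
      by (simp add: antisym)
  qed (use le[of 0 y] nonneg[of 0] in simp)
  have sub: "p (\<Sum>k. y k) \<le> (\<Sum>k. p (y k))"
    if "summable (\<lambda>k. norm (y k))" "summable (\<lambda>k. p (y k))" for y
  proof -
    \<comment> \<open>The candidate is the termwise sum of the solutions. As \<open>N t\<close>
      dominates the norm, \<open>p (y k)\<close> bounds \<open>X (y k)\<close> at all times and the
      series converges uniformly. The initial value stays in the closed subspace \<open>Z\<close>,
      and the equation passes to the limit because \<open>T t s\<close> and \<open>J s t\<close> are
      continuous.\<close>
    let ?x = "restrict (\<lambda>t. \<Sum>k. X (y k) t) {0..}"
    have norm_le: "norm (X (y k) t) \<le> p (y k)" if "t \<ge> 0" for k t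
      using order_trans[OF norm_le_N[OF that] p_ge[OF that]] .
    have summ: "summable (\<lambda>k. X (y k) t)" "summable (\<lambda>k. N t (X (y k) t))" if "t \<ge> 0" for t
      using that norm_le[OF that] N_nonneg[OF that] p_ge[OF that]
      by (auto intro: summable_comparison_test[OF _ \<open>summable (\<lambda>k. p (y k))\<close>])
    have N_le: "N t (\<Sum>k. X (y k) t) \<le> (\<Sum>k. p (y k))" if "t \<ge> 0" for t
    proof -
      have "N t (\<Sum>k. X (y k) t) \<le> (\<Sum>k. N t (X (y k) t))"
        using summ[OF that] by (intro N_sums_le[OF that]) (auto simp: summable_sums)
      also have "\<dots> \<le> (\<Sum>k. p (y k))"
        using summ[OF that] p_ge[OF that] \<open>summable (\<lambda>k. p (y k))\<close> by (intro suminf_le) auto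
      finally show ?thesis .
    qed
    have "?x = X (\<Sum>k. y k)"
    proof (rule X_unique)
      show "?x \<in> YinfZ N Z"
      proof (rule YinfZI)
        have "uniform_limit {0..} (\<lambda>n t. \<Sum>k<n. X (y k) t) (\<lambda>t. \<Sum>k. X (y k) t) sequentially"
          using norm_le that(2) by (intro Weierstrass_m_test) auto
        then have "continuous_on {0..} (\<lambda>t. \<Sum>k. X (y k) t)"
          by (rule uniform_limit_theorem[rotated])
            (auto intro!: always_eventually continuous_on_sum YinfZD(2)[OF X(1)])
        then show "continuous_on {0..} ?x"
          by (rule continuous_on_eq) simp
        have lim: "(\<lambda>n. \<Sum>k<n. X (y k) 0) \<longlonglongrightarrow> (\<Sum>k. X (y k) 0)"
          using summ(1)[of 0] by (intro summable_LIMSEQ) simp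
        have "(\<Sum>k<n. X (y k) 0) \<in> Z" for n
          using YinfZD(3)[OF X(1)] Z(2) by (intro subspace_sum)
        then have "(\<Sum>k. X (y k) 0) \<in> Z"
          by (intro closed_sequentially[OF Z(1) _ lim]) blast
        then show "?x 0 \<in> Z"
          by simp
      qed (use N_le in auto)
      show "mild (\<lambda>s t. J s t (\<Sum>k. y k)) ?x"
        unfolding mild_def
      proof (intro allI impI)
        fix s t :: real assume st: "0 \<le> s" "s \<le> t"
        have eq: "(\<lambda>k. X (y k) t) = (\<lambda>k. T t s (X (y k) s) + J s t (y k))"
          by (intro ext mildD[OF X(2) st])
        have "(\<lambda>k. T t s (X (y k) s)) sums T t s (\<Sum>k. X (y k) s)"
          using summ(1) st by (intro bounded_linear.sums[OF blinfun.bounded_linear_right] summable_sums) auto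
        moreover have "(\<lambda>k. J s t (y k)) sums J s t (\<Sum>k. y k)"
          using st summable_norm_cancel[OF that(1)]
          by (intro bounded_linear.sums[OF J] summable_sums) auto
        ultimately have "(\<lambda>k. X (y k) t) sums (T t s (\<Sum>k. X (y k) s) + J s t (\<Sum>k. y k))"
          unfolding eq by (rule sums_add)
        from sums_unique[OF this, symmetric] show "?x t = T t s (?x s) + J s t (\<Sum>k. y k)"
          using st by simp
      qed
    qed
    then have "X (\<Sum>k. y k) t = (\<Sum>k. X (y k) t)" if "t \<ge> 0" for t
      using that by (metis atLeast_iff restrict_apply')
    then show ?thesis
      using N_le by (intro p_le) simp
  qed
  obtain K where K: "K > 0" "\<And>y. p y \<le> K * norm y"
    using Zabreiko[of p, OF nonneg hom sub] by blast
  show ?thesis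
  proof (intro exI[of _ K] conjI K(1) allI impI)
    fix y x t assume "x \<in> YinfZ N Z" "mild (\<lambda>s t. J s t y) x" "t \<ge> (0::real)"
    then show "N t (x t) \<le> K * norm y"
      using X_unique[of x y] p_ge[of t y] K(2)[of y] by simp
  qed
qed

end

section \<open>Block right-hand sides\<close>

lemma norm_apply_bcontfun_le: "norm (apply_bcontfun f x) \<le> norm f"
  using dist_bounded[of f x 0] by (simp add: dist_norm)

instance bcontfun :: (metric_space, banach) banach ..

text \<open>Bounded sequences are encoded as bounded continuous functions on a discrete copy of the
  naturals, where every function is continuous; this makes them a Banach space under the supremum
  norm. As a coefficient sequence, \<open>unit_seq n\<close> selects the n-th term of a
  series.\<close>

definition unit_seq :: "nat \<Rightarrow> nat discrete \<Rightarrow>\<^sub>C real" where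
  "unit_seq n = Bcontfun (\<lambda>m. if m = discrete n then 1 else 0)"

lemma unit_seq_apply: "unit_seq n (discrete m) = (if m = n then 1 else 0)"
proof -
  have "continuous_on UNIV (\<lambda>m. if m = discrete n then 1 else (0::real))"
    by (simp add: continuous_on_open_vimage open_discrete)
  then have "(\<lambda>m. if m = discrete n then 1 else (0::real)) \<in> bcontfun"
    by (rule bcontfun_normI[of _ 1]) auto
  then show ?thesis
    by (simp add: unit_seq_def Bcontfun_inverse discrete_inject)
qed

lemma norm_unit_seq: "norm (unit_seq n) \<le> 1"
proof -
  have "dist (unit_seq n) 0 \<le> 1"
  proof (rule dist_bound)
    fix m :: "nat discrete"
    show "dist (unit_seq n m) (apply_bcontfun 0 m) \<le> 1"
      by (cases m) (simp add: unit_seq_apply)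
  qed
  then show ?thesis
    by (simp add: dist_norm)
qed

text \<open>Bounded coefficients preserve absolute convergence. This provides the continuity of the
  maps \<open>J s t\<close> required by \<open>mild_solution_bounded\<close>.\<close>

lemma bounded_linear_bcontfun_series:
  fixes h :: "nat \<Rightarrow> 'b::banach"
  assumes h: "summable (\<lambda>n. norm (h n))"
  shows "bounded_linear (\<lambda>c::nat discrete \<Rightarrow>\<^sub>C real. \<Sum>n. c (discrete n) *\<^sub>R h n)"
proof -
  have le: "norm (c (discrete n) *\<^sub>R h n) \<le> norm c * norm (h n)" for c :: "nat discrete \<Rightarrow>\<^sub>C real" and n
    using norm_apply_bcontfun_le[of c "discrete n"] by (simp add: mult_right_mono)
  have summ_norm: "summable (\<lambda>n. norm (c (discrete n) *\<^sub>R h n))" for c :: "nat discrete \<Rightarrow>\<^sub>C real"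
    by (rule summable_comparison_test[OF _ summable_mult[OF h, of "norm c"]]) (use le in auto)
  note summ = summable_norm_cancel[OF summ_norm]
  show ?thesis
  proof (rule bounded_linear_intro)
    show "(\<Sum>n. (c + d) (discrete n) *\<^sub>R h n) = (\<Sum>n. c (discrete n) *\<^sub>R h n) + (\<Sum>n. d (discrete n) *\<^sub>R h n)"
      for c d :: "nat discrete \<Rightarrow>\<^sub>C real"
      using suminf_add[OF summ[of c] summ[of d]] by (simp add: scaleR_add_left)
    show "(\<Sum>n. (r *\<^sub>R c) (discrete n) *\<^sub>R h n) = r *\<^sub>R (\<Sum>n. c (discrete n) *\<^sub>R h n)"
      for r and c :: "nat discrete \<Rightarrow>\<^sub>C real"
      using suminf_scaleR_right[OF summ[of c], of r] by simp
    show "norm (\<Sum>n. c (discrete n) *\<^sub>R h n) \<le> norm c * (\<Sum>n. norm (h n))" for c :: "nat discrete \<Rightarrow>\<^sub>C real"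
    proof -
      have "norm (\<Sum>n. c (discrete n) *\<^sub>R h n) \<le> (\<Sum>n. norm (c (discrete n) *\<^sub>R h n))"
        by (rule summable_norm[OF summ_norm])
      also have "\<dots> \<le> (\<Sum>n. norm c * norm (h n))"
        by (rule suminf_le[OF le summ_norm summable_mult[OF h]])
      also have "\<dots> = norm c * (\<Sum>n. norm (h n))"
        by (rule suminf_mult[OF h])
      finally show ?thesis .
    qed
  qed
qed

section \<open>Cut-off orbits, their integrals, and bounds for the solutions\<close>

context evolution_norms
begin

text \<open>The weight \<open>g\<close> is 1 in the first problem and \<open>\<rho>'\<close> in the
  second.\<close>

definition forcing :: "(real \<Rightarrow> real) \<Rightarrow> (real \<Rightarrow> 'a) \<Rightarrow> real \<Rightarrow> real \<Rightarrow> 'a" where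
  "forcing g y s t = strong_integral (lebesgue_on {s..t}) (\<lambda>\<tau>. g \<tau> *\<^sub>R T t \<tau> (y \<tau>))"

definition block :: "real \<Rightarrow> real \<Rightarrow> 'a \<Rightarrow> real \<Rightarrow> 'a" where
  "block a b v \<tau> = indicator {a..b} \<tau> *\<^sub>R T \<tau> a v"

text \<open>The bound \<open>\<beta>\<close> is a parameter rather than the supremum: on short
  intervals it may be any number above \<open>N a v\<close>, and in the second problem it comes from
  \<open>bounded_growth\<close>.\<close>

definition block_bound :: "real \<Rightarrow> real \<Rightarrow> 'a \<Rightarrow> real \<Rightarrow> bool" where
  "block_bound a b v \<beta> \<longleftrightarrow> 0 \<le> a \<and> a < b \<and> (\<forall>\<tau>\<in>{a..b}. N \<tau> (T \<tau> a v) \<le> \<beta>)"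

definition block_series ::
    "(nat \<Rightarrow> real) \<Rightarrow> (nat \<Rightarrow> real) \<Rightarrow> (nat \<Rightarrow> 'a) \<Rightarrow> (nat discrete \<Rightarrow>\<^sub>C real) \<Rightarrow> real \<Rightarrow> 'a" where
  "block_series a b v d \<tau> = (\<Sum>n. d (discrete n) *\<^sub>R block (a n) (b n) (v n) \<tau>)"

lemma block_bound_norm_le:
  assumes "block_bound a b v \<beta>"
  shows "norm v \<le> \<beta>"
proof -
  have "norm v \<le> N a (T a a v)"
    using assms norm_le_N[of a v] by (simp add: T_id block_bound_def)
  also have "\<dots> \<le> \<beta>"
    using assms by (simp add: block_bound_def)
  finally show ?thesis .
qed

lemma N_block_le: "block_bound a b v \<beta> \<Longrightarrow> N \<tau> (block a b v \<tau>) \<le> indicator {a..b} \<tau> * \<beta>" if "\<tau> \<ge> 0"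
  using that N_eq_0[of \<tau> 0] by (cases "\<tau> \<in> {a..b}") (auto simp: block_def block_bound_def)

lemma norm_block_le:
  assumes "\<tau> \<ge> 0" "block_bound a b v \<beta>"
  shows "norm (block a b v \<tau>) \<le> indicator {a..b} \<tau> * \<beta>"
  using norm_le_N[OF assms(1)] N_block_le[OF assms] by (rule order_trans)

text \<open>The evolution law carries every point of the orbit piece to the same vector at time
  \<open>t\<close>. If \<open>t < a\<close>, then \<open>T t a\<close> has no meaning, but no
  \<open>\<tau> \<le> t\<close> lies in the block.\<close>

lemma T_block:
  assumes "0 \<le> a" "0 \<le> \<tau>" "\<tau> \<le> t"
  shows "T t \<tau> (block a b v \<tau>) = indicator {a..b} \<tau> *\<^sub>R (if a \<le> t then T t a v else 0)"
  using assms by (cases "\<tau> \<in> {a..b}") (auto simp: block_def T_comp)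

lemma uniformly_simple_block:
  assumes "0 \<le> a" "S \<in> sets lebesgue"
  shows "uniformly_simple (lebesgue_on S) (block a b v)"
  unfolding block_def[abs_def]
  by (intro uniformly_simple_indicator assms continuous_on_subset[OF T_cont]) (use assms in auto)

text \<open>Integration term by term: each term is a scalar integral, evaluated by the clamp
  formula, times a fixed vector. \<open>B\<close> bounds \<open>g\<close> and \<open>M\<close>
  bounds the operators \<open>T t s\<close> on \<open>{0..t}\<close>, which makes the terms
  summable.\<close>

lemma forcing_block_series:
  assumes G: "\<And>t. t \<ge> 0 \<Longrightarrow> (G has_real_derivative g t) (at t within {0..})"
    and g: "continuous_on {0..} g"
    and bb: "\<And>n. block_bound (a n) (b n) (v n) (\<beta> n)"
    and summ: "summable (\<lambda>n. min t (b n - a n) * \<beta> n)"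
    and AE: "AE \<tau> in lebesgue_on {0..}. summable (\<lambda>n. indicator {a n..b n} \<tau> * \<beta> n)"
    and st: "0 \<le> s" "s \<le> t"
  defines "h \<equiv> \<lambda>n. (G (max (a n) (min (b n) t)) - G (max (a n) (min (b n) s))) *\<^sub>R T t (a n) (v n)"
  shows "summable (\<lambda>n. norm (h n))"
    and "forcing g (block_series a b v d) s t = (\<Sum>n. d (discrete n) *\<^sub>R h n)"
proof -
  have ab: "0 \<le> a n" "a n < b n" for n
    using bb[of n] by (auto simp: block_bound_def)
  have \<beta>: "0 \<le> \<beta> n" for n
    using block_bound_norm_le[OF bb] norm_ge_zero order_trans by metis
  have "compact (g ` {0..t})"
    by (rule compact_continuous_image[OF continuous_on_subset[OF g]]) auto
  then have "\<exists>B. \<forall>\<tau>\<in>{0..t}. \<bar>g \<tau>\<bar> \<le> B"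
    using compact_imp_bounded[of "g ` {0..t}"] by (simp add: bounded_iff)
  then obtain B where B: "\<And>\<tau>. \<tau> \<in> {0..t} \<Longrightarrow> \<bar>g \<tau>\<bar> \<le> B"
    by blast
  obtain M where M: "M > 0" "\<And>s x. 0 \<le> s \<Longrightarrow> s \<le> t \<Longrightarrow> norm (T t s x) \<le> M * norm x"
    using T_bounded[of t] st by auto
  \<comment> \<open>For \<open>a n > t\<close> the vector \<open>T t (a n) (v n)\<close> in
    \<open>h n\<close> is arbitrary, but both clamped end points equal \<open>a n\<close> and its
    coefficient is 0. Replacing the vector by 0 makes the bound \<open>M * \<beta> n\<close> hold
    for all \<open>n\<close>.\<close>
  define u where "u n = (if a n \<le> t then T t (a n) (v n) else 0)" for n
  have u: "norm (u n) \<le> M * \<beta> n" for n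
  proof (cases "a n \<le> t")
    case True
    then have "norm (u n) \<le> M * norm (v n)"
      using M(2) ab by (simp add: u_def)
    also have "\<dots> \<le> M * \<beta> n"
      using block_bound_norm_le[OF bb] M(1) by (intro mult_left_mono) auto
    finally show ?thesis .
  qed (use M(1) \<beta> in \<open>simp add: u_def\<close>)
  have h: "h n = (G (max (a n) (min (b n) t)) - G (max (a n) (min (b n) s))) *\<^sub>R u n" for n
    using st ab[of n] by (auto simp: h_def u_def)
  have int: "(\<integral>\<tau>. indicator {a n..b n} \<tau> * (r * g \<tau>) \<partial>lebesgue_on {s..t})
        = r * (G (max (a n) (min (b n) t)) - G (max (a n) (min (b n) s)))"
      "integrable (lebesgue_on {s..t}) (\<lambda>\<tau>. indicator {a n..b n} \<tau> * (r * g \<tau>))" for n r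
  proof -
    have G': "((\<lambda>t. r * G t) has_real_derivative r * g t) (at t within {0..})" if "t \<ge> 0" for t
      using DERIV_cmult[OF G[OF that]] .
    show "(\<integral>\<tau>. indicator {a n..b n} \<tau> * (r * g \<tau>) \<partial>lebesgue_on {s..t})
        = r * (G (max (a n) (min (b n) t)) - G (max (a n) (min (b n) s)))"
      using integral_indicator_clamp[OF G' _ ab(1)[of n] less_imp_le[OF ab(2)[of n]] st] g
      by (simp add: continuous_intros right_diff_distrib)
    show "integrable (lebesgue_on {s..t}) (\<lambda>\<tau>. indicator {a n..b n} \<tau> * (r * g \<tau>))"
      using integrable_indicator_clamp[OF G' _ ab(1)[of n] less_imp_le[OF ab(2)[of n]] st] g
      by (simp add: continuous_intros)
  qed
  have abs_int: "(\<integral>\<tau>. \<bar>indicator {a n..b n} \<tau> * (r * g \<tau>)\<bar> \<partial>lebesgue_on {s..t}) * norm (u n)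
      \<le> (\<bar>r\<bar> * B * M) * (min t (b n - a n) * \<beta> n)" for n r
  proof -
    have "\<bar>r * g \<tau>\<bar> \<le> \<bar>r\<bar> * B" if "\<tau> \<in> {0..t}" for \<tau>
      using B[OF that] by (simp add: abs_mult mult_left_mono)
    then have "(\<integral>\<tau>. \<bar>indicator {a n..b n} \<tau> * (r * g \<tau>)\<bar> \<partial>lebesgue_on {s..t}) \<le> \<bar>r\<bar> * B * min t (b n - a n)"
      using ab[of n] st g by (intro integral_abs_indicator_le continuous_intros) auto
    from mult_mono[OF this u] show ?thesis
      using B[of t] st ab[of n] order_trans[OF abs_ge_zero B[of t]] by (simp add: ac_simps)
  qed
  show "summable (\<lambda>n. norm (h n))"
  proof (rule summable_comparison_test[OF _ summable_mult[OF summ, of "\<bar>1\<bar> * B * M"]], intro exI allI impI)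
    fix n
    have "norm (h n) = \<bar>\<integral>\<tau>. indicator {a n..b n} \<tau> * (1 * g \<tau>) \<partial>lebesgue_on {s..t}\<bar> * norm (u n)"
      by (subst int(1)) (simp add: h)
    also have "\<dots> \<le> (\<integral>\<tau>. \<bar>indicator {a n..b n} \<tau> * (1 * g \<tau>)\<bar> \<partial>lebesgue_on {s..t}) * norm (u n)"
      by (intro mult_right_mono integral_abs_bound) auto
    also have "\<dots> \<le> \<bar>1\<bar> * B * M * (min t (b n - a n) * \<beta> n)"
      by (rule abs_int)
    finally show "norm (norm (h n)) \<le> \<bar>1\<bar> * B * M * (min t (b n - a n) * \<beta> n)"
      by simp
  qed
  have "has_strong_integral (lebesgue_on {s..t}) (\<lambda>\<tau>. g \<tau> *\<^sub>R T t \<tau> (block_series a b v d \<tau>))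
      (\<Sum>n. (\<integral>\<tau>. indicator {a n..b n} \<tau> * (d (discrete n) * g \<tau>) \<partial>lebesgue_on {s..t}) *\<^sub>R u n)"
  proof (rule has_strong_integral_series)
    show "finite_measure (lebesgue_on {s..t})"
      by (rule finite_measure_lebesgue_on) auto
    show "uniformly_simple (lebesgue_on {s..t}) (\<lambda>\<tau>. indicator {a n..b n} \<tau> * (d (discrete n) * g \<tau>))" for n
    proof -
      have "continuous_on {a n..b n} (\<lambda>\<tau>. d (discrete n) * g \<tau>)"
        by (intro continuous_intros continuous_on_subset[OF g]) (use ab(1)[of n] in auto)
      from uniformly_simple_indicator[OF this, of "{s..t}"] show ?thesis
        by simp
    qed
    show "integrable (lebesgue_on {s..t}) (\<lambda>\<tau>. indicator {a n..b n} \<tau> * (d (discrete n) * g \<tau>))" for n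
      by (rule int(2))
    show "summable (\<lambda>n. (\<integral>\<tau>. \<bar>indicator {a n..b n} \<tau> * (d (discrete n) * g \<tau>)\<bar> \<partial>lebesgue_on {s..t}) * norm (u n))"
    proof (rule summable_comparison_test[OF _ summable_mult[OF summ, of "norm d * B * M"]], intro exI allI impI)
      fix n
      have "(\<integral>\<tau>. \<bar>indicator {a n..b n} \<tau> * (d (discrete n) * g \<tau>)\<bar> \<partial>lebesgue_on {s..t}) * norm (u n)
          \<le> (\<bar>d (discrete n)\<bar> * B * M) * (min t (b n - a n) * \<beta> n)"
        by (rule abs_int)
      also have "\<dots> \<le> (norm d * B * M) * (min t (b n - a n) * \<beta> n)"
        using norm_apply_bcontfun_le[of d "discrete n"] order_trans[OF abs_ge_zero B[of t]] M(1) st ab[of n] \<beta>[of n]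
        by (intro mult_right_mono) auto
      finally show "norm ((\<integral>\<tau>. \<bar>indicator {a n..b n} \<tau> * (d (discrete n) * g \<tau>)\<bar> \<partial>lebesgue_on {s..t}) * norm (u n))
          \<le> (norm d * B * M) * (min t (b n - a n) * \<beta> n)"
        by simp
    qed
    have "AE \<tau> in lebesgue. \<tau> \<in> {0..} \<longrightarrow> summable (\<lambda>n. indicator {a n..b n} \<tau> * \<beta> n)"
      using AE by (subst (asm) AE_restrict_space_iff) auto
    then have "AE \<tau> in lebesgue. \<tau> \<in> {s..t} \<longrightarrow>
        (\<lambda>n. (indicator {a n..b n} \<tau> * (d (discrete n) * g \<tau>)) *\<^sub>R u n) sums (g \<tau> *\<^sub>R T t \<tau> (block_series a b v d \<tau>))"
    proof eventually_elim
      case (elim \<tau>)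
      show ?case
      proof
        assume \<tau>: "\<tau> \<in> {s..t}"
        then have "summable (\<lambda>n. indicator {a n..b n} \<tau> * \<beta> n)"
          using elim st by auto
        then have "summable (\<lambda>n. norm d * (indicator {a n..b n} \<tau> * \<beta> n))"
          by (rule summable_mult)
        then have "summable (\<lambda>n. d (discrete n) *\<^sub>R block (a n) (b n) (v n) \<tau>)"
        proof (rule summable_comparison_test[rotated], intro exI allI impI)
          fix n
          show "norm (d (discrete n) *\<^sub>R block (a n) (b n) (v n) \<tau>) \<le> norm d * (indicator {a n..b n} \<tau> * \<beta> n)"
            using norm_block_le[OF _ bb, of \<tau> n] \<tau> st norm_apply_bcontfun_le[of d "discrete n"]
            by (simp add: mult_mono)
        qed
        then have "(\<lambda>n. d (discrete n) *\<^sub>R block (a n) (b n) (v n) \<tau>) sums block_series a b v d \<tau>"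
          unfolding block_series_def by (rule summable_sums)
        then have "(\<lambda>n. g \<tau> *\<^sub>R T t \<tau> (d (discrete n) *\<^sub>R block (a n) (b n) (v n) \<tau>)) sums (g \<tau> *\<^sub>R T t \<tau> (block_series a b v d \<tau>))"
          by (intro sums_scaleR_right bounded_linear.sums[OF blinfun.bounded_linear_right])
        moreover have "g \<tau> *\<^sub>R T t \<tau> (d (discrete n) *\<^sub>R block (a n) (b n) (v n) \<tau>) = (indicator {a n..b n} \<tau> * (d (discrete n) * g \<tau>)) *\<^sub>R u n" for n
          using T_block[OF ab(1), of \<tau> t n] \<tau> st by (simp add: blinfun.scaleR_right u_def ac_simps)
        ultimately show "(\<lambda>n. (indicator {a n..b n} \<tau> * (d (discrete n) * g \<tau>)) *\<^sub>R u n) sums (g \<tau> *\<^sub>R T t \<tau> (block_series a b v d \<tau>))"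
          by simp
      qed
    qed
    then show "AE \<tau> in lebesgue_on {s..t}.
        (\<lambda>n. (indicator {a n..b n} \<tau> * (d (discrete n) * g \<tau>)) *\<^sub>R u n) sums (g \<tau> *\<^sub>R T t \<tau> (block_series a b v d \<tau>))"
      by (subst AE_restrict_space_iff) auto
  qed
  then have "forcing g (block_series a b v d) s t
      = (\<Sum>n. (\<integral>\<tau>. indicator {a n..b n} \<tau> * (d (discrete n) * g \<tau>) \<partial>lebesgue_on {s..t}) *\<^sub>R u n)"
    unfolding forcing_def by (rule strong_integral_eq)
  then show "forcing g (block_series a b v d) s t = (\<Sum>n. d (discrete n) *\<^sub>R h n)"
    by (simp only: int(1)) (simp add: h)
qed

lemma block_series_unit_seq: "block_series a b v (unit_seq n) = block (a n) (b n) (v n)"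
proof
  fix \<tau>
  have "block_series a b v (unit_seq n) \<tau> = (\<Sum>m\<in>{n}. unit_seq n (discrete m) *\<^sub>R block (a m) (b m) (v m) \<tau>)"
    unfolding block_series_def by (rule suminf_finite) (auto simp: unit_seq_apply)
  then show "block_series a b v (unit_seq n) \<tau> = block (a n) (b n) (v n) \<tau>"
    by (simp add: unit_seq_apply)
qed

text \<open>The series formula for a sequence whose vectors after the first are 0.\<close>

lemma forcing_block:
  assumes G: "\<And>t. t \<ge> 0 \<Longrightarrow> (G has_real_derivative g t) (at t within {0..})"
    and g: "continuous_on {0..} g" and bb: "block_bound a b v \<beta>" and st: "0 \<le> s" "s \<le> t"
  shows "forcing g (block a b v) s t = (G (max a (min b t)) - G (max a (min b s))) *\<^sub>R T t a v"
proof -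
  define v' where "v' n = (if n = (0::nat) then v else 0)" for n
  define \<beta>' where "\<beta>' n = (if n = (0::nat) then \<beta> else 0)" for n
  have ab: "0 \<le> a" "a < b"
    using bb by (auto simp: block_bound_def)
  have "N \<tau> 0 = 0" if "\<tau> \<ge> 0" for \<tau>
    using N_eq_0[OF that, of 0] by simp
  then have "block_bound a b (v' n) (\<beta>' n)" for n
    using bb by (auto simp: block_bound_def v'_def \<beta>'_def)
  moreover have "summable (\<lambda>n. min t (b - a) * \<beta>' n)"
    by (rule summable_finite[of "{0}"]) (auto simp: \<beta>'_def)
  moreover have "summable (\<lambda>n. indicator {a..b} \<tau> * \<beta>' n)" for \<tau>
    by (rule summable_finite[of "{0}"]) (auto simp: \<beta>'_def)
  ultimately have "forcing g (block_series (\<lambda>n. a) (\<lambda>n. b) v' (unit_seq 0)) s t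
      = (\<Sum>n. unit_seq 0 (discrete n) *\<^sub>R ((G (max a (min b t)) - G (max a (min b s))) *\<^sub>R T t a (v' n)))"
    by (intro forcing_block_series(2)[OF G g _ _ _ st]) auto
  also have "\<dots> = (\<Sum>n\<in>{0}. unit_seq 0 (discrete n) *\<^sub>R ((G (max a (min b t)) - G (max a (min b s))) *\<^sub>R T t a (v' n)))"
    by (rule suminf_finite) (auto simp: unit_seq_apply)
  finally show ?thesis
    by (simp add: block_series_unit_seq unit_seq_apply v'_def)
qed

lemma block_bound_scale:
  assumes "block_bound a b v \<beta>" "r \<ge> 0"
  shows "block_bound a b (r *\<^sub>R v) (r * \<beta>)"
  using assms by (auto simp: block_bound_def blinfun.scaleR_right N_scale mult_left_mono)

text \<open>\<open>\<kappa> a b * \<beta>\<close> measures the size of a block;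
  \<open>\<kappa> a b\<close> is \<open>b - a\<close> for integrable and 1 for bounded data. If no
  constant worked, there would be blocks whose solutions exceed \<open>4 ^ n\<close> times their
  size. Shrunk to size \<open>(1/2) ^ n\<close>, they can be summed with arbitrary bounded
  coefficients inside \<open>Y\<close>. The closed graph theorem over the bounded sequences then
  bounds the solutions for all unit sequences by one constant, although the n-th still exceeds
  \<open>2 ^ n\<close> at some time.\<close>

lemma block_solution_bounded:
  fixes \<kappa> :: "real \<Rightarrow> real \<Rightarrow> real"
  assumes G: "\<And>t. t \<ge> 0 \<Longrightarrow> (G has_real_derivative g t) (at t within {0..})"
    and g: "continuous_on {0..} g" and Z: "closed Z" "subspace Z"
    and ex1: "\<And>y. y \<in> Y \<Longrightarrow> \<exists>!x. x \<in> YinfZ N Z \<and> mild (forcing g y) x"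
    and mem: "\<And>a b v \<beta> d. (\<And>n. block_bound (a n) (b n) (v n) (\<beta> n)) \<Longrightarrow>
        summable (\<lambda>n. \<kappa> (a n) (b n) * \<beta> n) \<Longrightarrow> block_series a b v d \<in> Y"
    and AE: "\<And>a b v \<beta>. (\<And>n. block_bound (a n) (b n) (v n) (\<beta> n)) \<Longrightarrow>
        summable (\<lambda>n. \<kappa> (a n) (b n) * \<beta> n) \<Longrightarrow>
        AE \<tau> in lebesgue_on {0..}. summable (\<lambda>n. indicator {a n..b n} \<tau> * \<beta> n)"
    and summ: "\<And>a b v \<beta> t. (\<And>n. block_bound (a n) (b n) (v n) (\<beta> n)) \<Longrightarrow>
        summable (\<lambda>n. \<kappa> (a n) (b n) * \<beta> n) \<Longrightarrow> t \<ge> 0 \<Longrightarrow>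
        summable (\<lambda>n. min t (b n - a n) * \<beta> n)"
    and \<kappa>: "\<And>a b. 0 \<le> a \<Longrightarrow> a < b \<Longrightarrow> 0 < \<kappa> a b"
  shows "\<exists>K>0. \<forall>a b v \<beta> x t. block_bound a b v \<beta> \<longrightarrow> 0 < \<beta> \<longrightarrow> x \<in> YinfZ N Z \<longrightarrow>
    mild (forcing g (block a b v)) x \<longrightarrow> 0 \<le> t \<longrightarrow> N t (x t) \<le> K * \<kappa> a b * \<beta>"
proof (rule ccontr)
  assume neg: "\<not> ?thesis"
  define P where "P n a b v \<beta> x t \<longleftrightarrow> block_bound a b v \<beta> \<and> 0 < \<beta> \<and> x \<in> YinfZ N Z \<and>
    mild (forcing g (block a b v)) x \<and> 0 \<le> t \<and> 4 ^ n * \<kappa> a b * \<beta> < N t (x t)" for n :: nat and a b v \<beta> x t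
  have "\<exists>a b v \<beta> x t. P n a b v \<beta> x t" for n
  proof -
    have "(4::real) ^ n > 0"
      by simp
    with neg show ?thesis
      unfolding P_def by (metis not_le)
  qed
  then obtain a b v \<beta> x t where P: "\<And>n. P n (a n) (b n) (v n) (\<beta> n) (x n) (t n)"
    by metis
  have bb: "block_bound (a n) (b n) (v n) (\<beta> n)" and \<beta>: "0 < \<beta> n" and x: "x n \<in> YinfZ N Z"
    and mild_x: "mild (forcing g (block (a n) (b n) (v n))) (x n)" and t: "0 \<le> t n"
    and large: "4 ^ n * \<kappa> (a n) (b n) * \<beta> n < N (t n) (x n (t n))" for n
    using P[of n] by (auto simp: P_def)
  have \<kappa>_pos: "0 < \<kappa> (a n) (b n)" for n
    using bb[of n] \<kappa> by (simp add: block_bound_def)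
  \<comment> \<open>The scaling makes the size
    \<open>\<kappa> (a n) (b n) * (r n * \<beta> n)\<close> equal to
    \<open>(1/2) ^ n\<close>.\<close>
  define r where "r n = 1 / (2 ^ n * \<kappa> (a n) (b n) * \<beta> n)" for n
  have r: "r n > 0" for n
    using \<kappa>_pos[of n] \<beta>[of n] by (simp add: r_def)
  define w where "w n = r n *\<^sub>R v n" for n
  have bb': "block_bound (a n) (b n) (w n) (r n * \<beta> n)" for n
    unfolding w_def using r[of n] by (intro block_bound_scale bb) simp
  have "\<kappa> (a n) (b n) * (r n * \<beta> n) = (1 / 2) ^ n" for n
    using \<kappa>_pos[of n] \<beta>[of n] by (simp add: r_def power_one_over field_simps)
  then have summ_\<kappa>: "summable (\<lambda>n. \<kappa> (a n) (b n) * (r n * \<beta> n))"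
    by (simp add: summable_geometric)
  define J where "J s t d = (\<Sum>n. apply_bcontfun d (discrete n) *\<^sub>R
      ((G (max (a n) (min (b n) t)) - G (max (a n) (min (b n) s))) *\<^sub>R T t (a n) (w n)))" for s t d
  have J: "bounded_linear (J s t)" if "0 \<le> s" "s \<le> t" for s t
    unfolding J_def[abs_def] using that
    by (intro bounded_linear_bcontfun_series
        forcing_block_series(1)[OF G g bb' summ[OF bb' summ_\<kappa>] AE[OF bb' summ_\<kappa>]]) auto
  have forcing: "forcing g (block_series a b w d) s t = J s t d" if "0 \<le> s" "s \<le> t" for s t d
    unfolding J_def using that
    by (intro forcing_block_series(2)[OF G g bb' summ[OF bb' summ_\<kappa>] AE[OF bb' summ_\<kappa>]]) auto
  then have mild_J: "mild (\<lambda>s t. J s t d) x \<longleftrightarrow> mild (forcing g (block_series a b w d)) x" for d x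
    by (intro mild_cong) simp
  have "\<exists>!x. x \<in> YinfZ N Z \<and> mild (\<lambda>s t. J s t d) x" for d
    unfolding mild_J by (intro ex1 mem[OF bb' summ_\<kappa>])
  from mild_solution_bounded[of J, OF J Z this]
  obtain K where K: "K > 0"
    "\<And>d x t. x \<in> YinfZ N Z \<Longrightarrow> mild (\<lambda>s t. J s t d) x \<Longrightarrow> 0 \<le> t \<Longrightarrow> N t (x t) \<le> K * norm d"
    by blast
  have le: "2 ^ n \<le> K" for n
  proof -
    let ?x = "restrict (\<lambda>t. r n *\<^sub>R x n t) {0..}"
    have "mild (forcing g (block (a n) (b n) (w n))) ?x"
      using mild_scale[OF mild_x[of n], of "r n"]
      by (rule mild_cong[THEN iffD1, rotated])
        (simp add: forcing_block[OF G g bb] forcing_block[OF G g bb'],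
         simp add: w_def blinfun.scaleR_right mult.commute)
    then have "mild (\<lambda>s t. J s t (unit_seq n)) ?x"
      by (simp add: mild_J block_series_unit_seq)
    then have "N (t n) (?x (t n)) \<le> K * norm (unit_seq n)"
      by (intro K(2) YinfZ_scale x Z t)
    also have "\<dots> \<le> K"
      using norm_unit_seq[of n] K(1) by simp
    also have "N (t n) (?x (t n)) = r n * N (t n) (x n (t n))"
      using t[of n] r[of n] by (simp add: N_scale)
    finally have "r n * N (t n) (x n (t n)) \<le> K" .
    moreover have "r n * (4 ^ n * \<kappa> (a n) (b n) * \<beta> n) \<le> r n * N (t n) (x n (t n))"
      using large[of n] r[of n] by (intro mult_left_mono) auto
    moreover have "r n * (4 ^ n * \<kappa> (a n) (b n) * \<beta> n) = 2 ^ n"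
    proof -
      have "(4::real) ^ n = 2 ^ n * 2 ^ n"
        by (simp flip: power_mult_distrib)
      then show ?thesis
        using \<kappa>_pos[of n] \<beta>[of n] by (simp add: r_def)
    qed
    ultimately show ?thesis
      by simp
  qed
  obtain n where "K < 2 ^ n"
    using real_arch_pow[of 2 K] by auto
  with le[of n] show False
    by simp
qed

lemma block_series_norm_le:
  fixes d :: "nat discrete \<Rightarrow>\<^sub>C real"
  assumes "0 \<le> \<tau>" "\<And>n. block_bound (a n) (b n) (v n) (\<beta> n)"
    and summ: "summable (\<lambda>n. indicator {a n..b n} \<tau> * \<beta> n)"
  shows "(\<lambda>n. d (discrete n) *\<^sub>R block (a n) (b n) (v n) \<tau>) sums block_series a b v d \<tau>"
    and "N \<tau> (block_series a b v d \<tau>) \<le> norm d * (\<Sum>n. indicator {a n..b n} \<tau> * \<beta> n)"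
proof -
  have le: "N \<tau> (d (discrete n) *\<^sub>R block (a n) (b n) (v n) \<tau>) \<le> norm d * (indicator {a n..b n} \<tau> * \<beta> n)" for n
    using N_block_le[OF assms(1,2)] norm_apply_bcontfun_le[of d "discrete n"] N_nonneg[OF assms(1)]
    by (simp add: N_scale[OF assms(1)] mult_mono)
  have summ_N: "summable (\<lambda>n. N \<tau> (d (discrete n) *\<^sub>R block (a n) (b n) (v n) \<tau>))"
    by (rule summable_comparison_test[OF _ summable_mult[OF summ, of "norm d"]])
      (use le N_nonneg[OF assms(1)] in auto)
  have "summable (\<lambda>n. d (discrete n) *\<^sub>R block (a n) (b n) (v n) \<tau>)"
    by (rule summable_comparison_test[OF _ summ_N]) (intro exI allI impI norm_le_N[OF assms(1)])
  then show sums: "(\<lambda>n. d (discrete n) *\<^sub>R block (a n) (b n) (v n) \<tau>) sums block_series a b v d \<tau>"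
    unfolding block_series_def by (rule summable_sums)
  have "N \<tau> (block_series a b v d \<tau>) \<le> (\<Sum>n. N \<tau> (d (discrete n) *\<^sub>R block (a n) (b n) (v n) \<tau>))"
    by (rule N_sums_le[OF assms(1) sums summ_N])
  also have "\<dots> \<le> (\<Sum>n. norm d * (indicator {a n..b n} \<tau> * \<beta> n))"
    by (rule suminf_le[OF le summ_N summable_mult[OF summ]])
  also have "\<dots> = norm d * (\<Sum>n. indicator {a n..b n} \<tau> * \<beta> n)"
    by (rule suminf_mult[OF summ])
  finally show "N \<tau> (block_series a b v d \<tau>) \<le> norm d * (\<Sum>n. indicator {a n..b n} \<tau> * \<beta> n)" .
qed

lemma bochner_measurable_block_series:
  fixes d :: "nat discrete \<Rightarrow>\<^sub>C real"
  assumes bb: "\<And>n. block_bound (a n) (b n) (v n) (\<beta> n)"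
    and AE: "AE \<tau> in lebesgue_on {0..}. summable (\<lambda>n. indicator {a n..b n} \<tau> * \<beta> n)"
  shows "bochner_measurable (lebesgue_on {0..}) (block_series a b v d)"
proof (rule bochner_measurable_series)
  show "uniformly_simple (lebesgue_on {0..}) (\<lambda>\<tau>. d (discrete n) *\<^sub>R block (a n) (b n) (v n) \<tau>)" for n
    using bb[of n]
    by (intro uniformly_simple_bounded_linear[OF uniformly_simple_block] bounded_linear_scaleR_right)
      (auto simp: block_bound_def)
  show "AE \<tau> in lebesgue_on {0..}. (\<lambda>n. d (discrete n) *\<^sub>R block (a n) (b n) (v n) \<tau>) sums block_series a b v d \<tau>"
    using AE AE_space
  proof eventually_elim
    case (elim \<tau>)
    then show ?case
      using block_series_norm_le(1)[OF _ bb, of \<tau>] by simp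
  qed
qed

lemma block_bound_nonneg: "block_bound a b v \<beta> \<Longrightarrow> 0 \<le> \<beta>"
  using block_bound_norm_le norm_ge_zero order_trans by metis

text \<open>The integral of the dominating series is the sum of
  \<open>(b n - a n) * \<beta> n\<close>. Its finiteness forces convergence at almost every time
  and, up to the factor \<open>norm d\<close>, bounds the integral of the norms of the block
  series.\<close>

lemma Y1_blocks:
  assumes bb: "\<And>n. block_bound (a n) (b n) (v n) (\<beta> n)"
    and summ: "summable (\<lambda>n. (b n - a n) * \<beta> n)"
  shows "AE \<tau> in lebesgue_on {0..}. summable (\<lambda>n. indicator {a n..b n} \<tau> * \<beta> n)"
    and "block_series a b v d \<in> Y1 N"
    and "t \<ge> 0 \<Longrightarrow> summable (\<lambda>n. min t (b n - a n) * \<beta> n)"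
proof -
  have ab: "0 \<le> a n" "a n < b n" for n
    using bb[of n] by (auto simp: block_bound_def)
  have \<beta>: "0 \<le> \<beta> n" for n
    using block_bound_nonneg[OF bb] .
  have meas [measurable]: "(\<lambda>\<tau>. ennreal (indicator {a n..b n} \<tau> * \<beta> n)) \<in> borel_measurable (lebesgue_on {0..})" for n
    by (intro measurable_restrict_space1 measurable_completion) simp
  have int: "(\<integral>\<^sup>+\<tau>. ennreal (indicator {a n..b n} \<tau> * \<beta> n) \<partial>lebesgue_on {0..}) = ennreal ((b n - a n) * \<beta> n)" for n
  proof -
    have "(\<integral>\<^sup>+\<tau>. ennreal (indicator {a n..b n} \<tau> * \<beta> n) \<partial>lebesgue_on {0..})
        = (\<integral>\<^sup>+\<tau>. ennreal (indicator {a n..b n} \<tau> * \<beta> n) * indicator {0..} \<tau> \<partial>lebesgue)"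
      by (rule nn_integral_restrict_space) auto
    also have "\<dots> = (\<integral>\<^sup>+\<tau>. ennreal (\<beta> n) * indicator {a n..b n} \<tau> \<partial>lebesgue)"
      using ab(1)[of n] by (intro nn_integral_cong) (auto simp: indicator_def)
    also have "\<dots> = ennreal (\<beta> n) * ennreal (b n - a n)"
      using ab[of n] by (simp add: nn_integral_cmult_indicator)
    finally show ?thesis
      using ab[of n] \<beta>[of n] by (simp add: ennreal_mult mult.commute)
  qed
  have int_sum: "(\<integral>\<^sup>+\<tau>. (\<Sum>n. ennreal (indicator {a n..b n} \<tau> * \<beta> n)) \<partial>lebesgue_on {0..}) = ennreal (\<Sum>n. (b n - a n) * \<beta> n)"
    unfolding nn_integral_suminf[OF meas] int
    using summ ab \<beta> by (intro suminf_ennreal2) (auto intro!: mult_nonneg_nonneg simp: less_imp_le)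
  have "AE \<tau> in lebesgue_on {0..}. (\<Sum>n. ennreal (indicator {a n..b n} \<tau> * \<beta> n)) \<noteq> \<infinity>"
  proof (rule nn_integral_PInf_AE)
    show "(\<lambda>\<tau>. \<Sum>n. ennreal (indicator {a n..b n} \<tau> * \<beta> n)) \<in> borel_measurable (lebesgue_on {0..})"
      by (intro borel_measurable_suminf_order meas)
  qed (simp add: int_sum)
  then show AE: "AE \<tau> in lebesgue_on {0..}. summable (\<lambda>n. indicator {a n..b n} \<tau> * \<beta> n)"
  proof eventually_elim
    case (elim \<tau>)
    then show ?case
      using \<beta> by (intro summable_suminf_not_top) auto
  qed
  have "(\<integral>\<^sup>+\<tau>. ennreal (N \<tau> (block_series a b v d \<tau>)) \<partial>lebesgue_on {0..})
      \<le> (\<integral>\<^sup>+\<tau>. ennreal (norm d) * (\<Sum>n. ennreal (indicator {a n..b n} \<tau> * \<beta> n)) \<partial>lebesgue_on {0..})"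
  proof (rule nn_integral_mono_AE)
    show "AE \<tau> in lebesgue_on {0..}. ennreal (N \<tau> (block_series a b v d \<tau>))
        \<le> ennreal (norm d) * (\<Sum>n. ennreal (indicator {a n..b n} \<tau> * \<beta> n))"
      using AE AE_space
    proof eventually_elim
      case (elim \<tau>)
      then have "ennreal (N \<tau> (block_series a b v d \<tau>)) \<le> ennreal (norm d * (\<Sum>n. indicator {a n..b n} \<tau> * \<beta> n))"
        using block_series_norm_le(2)[OF _ bb, of \<tau>] by (intro ennreal_leI) simp
      also have "\<dots> = ennreal (norm d) * (\<Sum>n. ennreal (indicator {a n..b n} \<tau> * \<beta> n))"
      proof -
        have "(\<Sum>n. ennreal (indicator {a n..b n} \<tau> * \<beta> n)) = ennreal (\<Sum>n. indicator {a n..b n} \<tau> * \<beta> n)"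
          using elim(1) \<beta> by (intro suminf_ennreal2) auto
        moreover have "0 \<le> (\<Sum>n. indicator {a n..b n} \<tau> * \<beta> n)"
          using elim(1) \<beta> by (intro suminf_nonneg) auto
        ultimately show ?thesis
          by (simp only: ennreal_mult norm_ge_zero)
      qed
      finally show ?case .
    qed
  qed
  also have "\<dots> = ennreal (norm d) * ennreal (\<Sum>n. (b n - a n) * \<beta> n)"
    by (subst nn_integral_cmult) (simp_all only: int_sum, intro borel_measurable_suminf_order meas)
  also have "\<dots> < \<infinity>"
    by (simp add: ennreal_mult_less_top)
  finally show "block_series a b v d \<in> Y1 N"
    using bochner_measurable_block_series[OF bb AE] by (simp add: Y1_def)
  show "summable (\<lambda>n. min t (b n - a n) * \<beta> n)" if "t \<ge> 0"
    by (rule summable_comparison_test[OF _ summ])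
      (use ab \<beta> that in \<open>auto intro!: mult_right_mono simp: abs_mult less_imp_le\<close>)
qed

text \<open>For simple functions the claim reduces to continuity of \<open>N t x\<close> in
  \<open>t\<close>, and the limit uses continuity of \<open>N t\<close> in \<open>x\<close>. The
  exceptional null set is harmless because Lebesgue measure is complete. The result is a premise for
  the bound on \<open>esssup\<close> below.\<close>

lemma N_borel_measurable:
  assumes "bochner_measurable (lebesgue_on {0..}) y"
  shows "(\<lambda>t. N t (y t)) \<in> borel_measurable (lebesgue_on {0..})"
proof -
  obtain s where s: "\<And>i::nat. simple_function (lebesgue_on {0..}) (s i)"
    and lim: "AE t in lebesgue_on {0..}. (\<lambda>i. s i t) \<longlonglongrightarrow> y t"
    using assms unfolding bochner_measurable_def by blast
  have [measurable]: "(\<lambda>t. N t x) \<in> borel_measurable (lebesgue_on {0..})" for x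
    by (rule continuous_imp_measurable_on_sets_lebesgue[OF N_cont]) auto
  have "(\<lambda>t. N t (s i t)) \<in> borel_measurable (lebesgue_on {0..})" for i
  proof -
    let ?M = "lebesgue_on {0..}"
    have "(\<lambda>t. \<Sum>x\<in>s i ` space ?M. indicator (s i -` {x} \<inter> space ?M) t * N t x) \<in> borel_measurable ?M"
      using simple_functionD(2)[OF s]
      by (intro borel_measurable_sum borel_measurable_times borel_measurable_indicator) auto
    moreover have "(\<Sum>x\<in>s i ` space ?M. indicator (s i -` {x} \<inter> space ?M) t * N t x) = N t (s i t)"
      if "t \<in> space ?M" for t
      using simple_functionD(1)[OF s, of i] that
      by (subst sum.remove[of _ "s i t"]) (auto simp: indicator_def intro!: sum.neutral)
    ultimately show ?thesis
      by (subst (asm) measurable_cong) auto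
  qed
  then have "(\<lambda>t. if t \<in> {0..} then N t (s i t) else 0) \<in> borel_measurable lebesgue" for i
    by (subst borel_measurable_if) auto
  then have "(\<lambda>t. lim (\<lambda>i. if t \<in> {0..} then N t (s i t) else 0)) \<in> borel_measurable lebesgue"
    by (rule borel_measurable_lim_metric)
  moreover have "AE t in lebesgue. lim (\<lambda>i. if t \<in> {0..} then N t (s i t) else 0) = (if t \<in> {0..} then N t (y t) else 0)"
    using lim[THEN AE_restrict_space_iff[THEN iffD1, rotated], simplified]
  proof eventually_elim
    case (elim t)
    show ?case
    proof (cases "t \<ge> 0")
      case True
      then have "(\<lambda>i. N t (s i t)) \<longlonglongrightarrow> N t (y t)"
        using elim by (intro N_tendsto) auto
      then show ?thesis
        using True by (simp add: limI)
    qed (simp add: limI)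
  qed
  ultimately have "(\<lambda>t. if t \<in> {0..} then N t (y t) else 0) \<in> borel_measurable lebesgue"
    by (rule borel_measurable_AE)
  then show ?thesis
    by (subst (asm) borel_measurable_if) auto
qed

text \<open>Here the dominating series converges at every time with a sum of at most
  \<open>suminf \<beta>\<close>, whatever the lengths of the blocks; this is the case
  \<open>\<kappa> a b = 1\<close>.\<close>

lemma Yinf'_blocks:
  assumes bb: "\<And>n. block_bound (a n) (b n) (v n) (\<beta> n)" and summ: "summable \<beta>"
  shows "summable (\<lambda>n. indicator {a n..b n} \<tau> * \<beta> n)"
    and "block_series a b v d \<in> Yinf' N"
    and "t \<ge> 0 \<Longrightarrow> summable (\<lambda>n. min t (b n - a n) * \<beta> n)"
proof -
  have ab: "0 \<le> a n" "a n < b n" for n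
    using bb[of n] by (auto simp: block_bound_def)
  have \<beta>: "0 \<le> \<beta> n" for n
    using block_bound_nonneg[OF bb] .
  have ind_le: "indicator {a n..b n} \<tau> * \<beta> n \<le> \<beta> n" for \<tau> n
    using \<beta>[of n] by (simp add: indicator_def)
  show summ_ind: "summable (\<lambda>n. indicator {a n..b n} \<tau> * \<beta> n)" for \<tau>
    by (rule summable_comparison_test[OF _ summ]) (use ind_le \<beta> in auto)
  have meas: "bochner_measurable (lebesgue_on {0..}) (block_series a b v d)"
    using summ_ind by (intro bochner_measurable_block_series[OF bb] AE_I2)
  have le: "N \<tau> (block_series a b v d \<tau>) \<le> norm d * suminf \<beta>" if "\<tau> \<ge> 0" for \<tau>
  proof -
    have "N \<tau> (block_series a b v d \<tau>) \<le> norm d * (\<Sum>n. indicator {a n..b n} \<tau> * \<beta> n)"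
      by (rule block_series_norm_le(2)[OF that bb summ_ind])
    also have "\<dots> \<le> norm d * suminf \<beta>"
      by (intro mult_left_mono suminf_le ind_le summ_ind summ) simp
    finally show ?thesis .
  qed
  have "esssup (lebesgue_on {0..}) (\<lambda>\<tau>. ennreal (N \<tau> (block_series a b v d \<tau>))) \<le> ennreal (norm d * suminf \<beta>)"
    using N_borel_measurable[OF meas] le by (intro esssup_I AE_I2 ennreal_leI) auto
  also have "\<dots> < \<infinity>"
    by simp
  finally show "block_series a b v d \<in> Yinf' N"
    using meas by (simp add: Yinf'_def)
  show "summable (\<lambda>n. min t (b n - a n) * \<beta> n)" if "t \<ge> 0"
    by (rule summable_comparison_test[OF _ summable_mult[OF summ, of t]])
      (use ab \<beta> that in \<open>auto intro!: mult_right_mono simp: abs_mult less_imp_le\<close>)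
qed

end

section \<open>The splitting\<close>

context evolution_norms
begin

lemma block_mem:
  assumes bb: "block_bound a b v \<beta>"
  shows "block a b v \<in> Y1 N" "block a b v \<in> Yinf' N"
proof -
  \<comment> \<open>Any summable family that starts with \<open>v\<close> would do:
    \<open>unit_seq 0\<close> keeps only the term \<open>n = 0\<close>.\<close>
  let ?v = "\<lambda>n. (1/2)^n *\<^sub>R v" and ?\<beta> = "\<lambda>n. (1/2)^n * \<beta>"
  have bb': "block_bound a b (?v n) (?\<beta> n)" for n
    using bb by (rule block_bound_scale) simp
  have summ: "summable ?\<beta>"
    by (intro summable_mult2 summable_geometric) simp
  have eq: "block_series (\<lambda>n. a) (\<lambda>n. b) ?v (unit_seq 0) = block a b v"
    by (subst block_series_unit_seq) simp
  show "block a b v \<in> Y1 N"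
    using Y1_blocks(2)[of "\<lambda>n. a" "\<lambda>n. b", OF bb' summable_mult[OF summ], of "unit_seq 0"] by (simp only: eq)
  show "block a b v \<in> Yinf' N"
    using Yinf'_blocks(2)[of "\<lambda>n. a" "\<lambda>n. b", OF bb' summ, of "unit_seq 0"] by (simp only: eq)
qed

lemma N_T_bounded_Icc:
  assumes "0 \<le> a"
  shows "\<exists>B. \<forall>t\<in>{a..b}. N t (T t a x) \<le> B"
proof -
  have "compact ((\<lambda>t. T t a x) ` {a..b})"
    by (rule compact_continuous_image[OF continuous_on_subset[OF T_cont[OF assms]]]) auto
  then have "\<exists>B. \<forall>t\<in>{a..b}. norm (T t a x) \<le> B"
    using compact_imp_bounded[of "(\<lambda>t. T t a x) ` {a..b}"] by (simp add: bounded_iff)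
  then obtain B where B: "\<And>t. t \<in> {a..b} \<Longrightarrow> norm (T t a x) \<le> B"
    by blast
  have "N t (T t a x) \<le> c b * B" if t: "t \<in> {a..b}" for t
  proof -
    have "N t (T t a x) \<le> c t * norm (T t a x)"
      using assms t by (intro N_le_norm) auto
    also have "\<dots> \<le> c b * B"
      using assms t B[OF t] by (intro mult_mono c_mono c_nonneg) auto
    finally show ?thesis .
  qed
  then show ?thesis
    by blast
qed

text \<open>This is what permits \<open>b\<close> to tend to \<open>a\<close>: short blocks have
  bounds arbitrarily close to \<open>N a v\<close>.\<close>

lemma block_bound_exists:
  assumes "0 \<le> a" "N a v < \<beta>" "0 < \<delta>"
  obtains b where "b < a + \<delta>" "block_bound a b v \<beta>"
proof -
  \<comment> \<open>In \<open>N \<tau> (T \<tau> a v)\<close> both the norm and the vector move with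
    \<open>\<tau>\<close>. The majorant \<open>\<phi>\<close> separates the two changes, is
    continuous, and equals \<open>N a v\<close> at \<open>a\<close>.\<close>
  define \<phi> where "\<phi> \<tau> = N \<tau> v + c (a + 1) * norm (T \<tau> a v - v)" for \<tau>
  have "continuous_on {a..a+1} \<phi>"
    unfolding \<phi>_def using assms(1)
    by (intro continuous_intros continuous_on_subset[OF N_cont] continuous_on_subset[OF T_cont]) auto
  moreover have "\<phi> a = N a v"
    using assms(1) by (simp add: \<phi>_def T_id)
  ultimately obtain d where d: "d > 0" "\<And>\<tau>. \<tau> \<in> {a..a+1} \<Longrightarrow> dist \<tau> a < d \<Longrightarrow> dist (\<phi> \<tau>) (\<phi> a) < \<beta> - N a v"
    using assms(2) unfolding continuous_on_iff by (metis atLeastAtMost_iff diff_gt_0_iff_gt le_add_same_cancel1 order_refl zero_le_one)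
  define b where "b = a + min (min (d / 2) (\<delta> / 2)) 1"
  have b: "a < b" "b < a + \<delta>" "b < a + d" "b \<le> a + 1"
    using d(1) assms(3) by (auto simp: b_def min_def)
  have "N \<tau> (T \<tau> a v) \<le> \<beta>" if \<tau>: "\<tau> \<in> {a..b}" for \<tau>
  proof -
    have "N \<tau> (T \<tau> a v) \<le> N \<tau> v + N \<tau> (T \<tau> a v - v)"
      using N_add[of \<tau> v "T \<tau> a v - v"] \<tau> assms(1) by simp
    also have "N \<tau> (T \<tau> a v - v) \<le> c \<tau> * norm (T \<tau> a v - v)"
      using \<tau> assms(1) by (intro N_le_norm) auto
    also have "c \<tau> * norm (T \<tau> a v - v) \<le> c (a + 1) * norm (T \<tau> a v - v)"
      using \<tau> b assms(1) by (intro mult_right_mono c_mono) auto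
    finally have "N \<tau> (T \<tau> a v) \<le> \<phi> \<tau>"
      by (simp add: \<phi>_def)
    moreover have "dist (\<phi> \<tau>) (\<phi> a) < \<beta> - N a v"
      using \<tau> b by (intro d(2)) (auto simp: dist_real_def)
    ultimately show ?thesis
      using \<open>\<phi> a = N a v\<close> by (simp add: dist_real_def)
  qed
  then have "block_bound a b v \<beta>"
    using assms(1) b by (simp add: block_bound_def)
  with b(2) show thesis
    by (rule that)
qed

text \<open>This will be the range of the projection at time \<open>s\<close>, with the image of
  \<open>Z\<close> under \<open>T s 0\<close> as its kernel.\<close>

definition stable :: "real \<Rightarrow> 'a set" where
  "stable s = {x. \<exists>B. \<forall>t\<ge>s. N t (T t s x) \<le> B}"

lemma subspace_stable:
  assumes "0 \<le> s"
  shows "subspace (stable s)"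
proof (rule subspaceI)
  show "0 \<in> stable s"
    using assms N_eq_0[of _ 0] by (auto simp: stable_def intro!: exI[of _ 0])
next
  fix x y assume "x \<in> stable s" "y \<in> stable s"
  then obtain A B where "\<And>t. t \<ge> s \<Longrightarrow> N t (T t s x) \<le> A" "\<And>t. t \<ge> s \<Longrightarrow> N t (T t s y) \<le> B"
    by (auto simp: stable_def)
  then have "N t (T t s (x + y)) \<le> A + B" if "t \<ge> s" for t
    using that assms N_add[of t "T t s x" "T t s y"] by (fastforce simp: blinfun.add_right)
  then show "x + y \<in> stable s"
    by (auto simp: stable_def)
next
  fix r x assume "x \<in> stable s"
  then obtain A where "\<And>t. t \<ge> s \<Longrightarrow> N t (T t s x) \<le> A"
    by (auto simp: stable_def)
  then have "N t (T t s (r *\<^sub>R x)) \<le> \<bar>r\<bar> * A" if "t \<ge> s" for t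
    using that assms by (simp add: blinfun.scaleR_right N_scale mult_left_mono)
  then show "r *\<^sub>R x \<in> stable s"
    by (auto simp: stable_def)
qed

lemma stable_T:
  assumes "0 \<le> s" "s \<le> t" "x \<in> stable s"
  shows "T t s x \<in> stable t"
proof -
  obtain B where "\<And>r. r \<ge> s \<Longrightarrow> N r (T r s x) \<le> B"
    using assms(3) by (auto simp: stable_def)
  then have "N r (T r t (T t s x)) \<le> B" if "r \<ge> t" for r
    using that assms by (simp add: T_comp)
  then show ?thesis
    by (auto simp: stable_def)
qed

text \<open>On the compact interval before \<open>b\<close> the orbit is bounded anyway.\<close>

lemma stableI:
  assumes "0 \<le> s" "\<And>t. t \<ge> b \<Longrightarrow> N t (T t s x) \<le> B"
  shows "x \<in> stable s"
proof -
  obtain A where A: "\<And>t. t \<in> {s..b} \<Longrightarrow> N t (T t s x) \<le> A"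
    using N_T_bounded_Icc[OF assms(1), of b x] by blast
  have "N t (T t s x) \<le> max A B" if "t \<ge> s" for t
    using A[of t] assms(2)[of t] that by (cases "t \<le> b") auto
  then show ?thesis
    by (auto simp: stable_def)
qed

end

section \<open>Consequences of the two admissibility assumptions\<close>

locale admissible_evolution = evolution_norms T N c
  for T :: "real \<Rightarrow> real \<Rightarrow> 'a::banach \<Rightarrow>\<^sub>L 'a" and N :: "real \<Rightarrow> 'a \<Rightarrow> real" and c :: "real \<Rightarrow> real" +
  fixes \<rho> \<rho>' :: "real \<Rightarrow> real" and Z :: "'a set"
  assumes rho_mono: "strict_mono_on {0..} \<rho>"
    and rho_deriv: "\<And>t. t \<ge> 0 \<Longrightarrow> (\<rho> has_real_derivative \<rho>' t) (at t within {0..})"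
    and rho_C1: "continuous_on {0..} \<rho>'"
    and Z: "closed Z" "subspace Z"
    and Y1_ex1: "\<And>y. y \<in> Y1 N \<Longrightarrow> \<exists>!x. x \<in> YinfZ N Z \<and> mild (forcing (\<lambda>_. 1) y) x"
    and Yinf'_ex1: "\<And>y. y \<in> Yinf' N \<Longrightarrow> \<exists>!x. x \<in> YinfZ N Z \<and> mild (forcing \<rho>' y) x"
begin

text \<open>The bound is proportional to the length of the block, so it survives the division by
  \<open>b - a\<close> in \<open>splitting\<close> as \<open>b\<close> tends to
  \<open>a\<close>.\<close>

lemma Y1_solution_bounded:
  "\<exists>K>0. \<forall>a b v \<beta> x t. block_bound a b v \<beta> \<longrightarrow> 0 < \<beta> \<longrightarrow> x \<in> YinfZ N Z \<longrightarrow>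
    mild (forcing (\<lambda>_. 1) (block a b v)) x \<longrightarrow> 0 \<le> t \<longrightarrow> N t (x t) \<le> K * (b - a) * \<beta>"
  by (rule block_solution_bounded[where G="\<lambda>t. t" and \<kappa>="\<lambda>a b. b - a" and Y="Y1 N", OF _ _ Z Y1_ex1 Y1_blocks(2) Y1_blocks(1,3)])
    auto

lemma Yinf'_solution_bounded:
  "\<exists>K>0. \<forall>a b v \<beta> x t. block_bound a b v \<beta> \<longrightarrow> 0 < \<beta> \<longrightarrow> x \<in> YinfZ N Z \<longrightarrow>
    mild (forcing \<rho>' (block a b v)) x \<longrightarrow> 0 \<le> t \<longrightarrow> N t (x t) \<le> K * 1 * \<beta>"
  by (rule block_solution_bounded[where G=\<rho> and \<kappa>="\<lambda>a b. 1" and Y="Yinf' N", OF rho_deriv rho_C1 Z Yinf'_ex1 Yinf'_blocks(2) AE_I2 Yinf'_blocks(3)])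
    (auto intro: Yinf'_blocks(1))

text \<open>Boundedness from time \<open>t\<close> on makes the whole orbit of \<open>z\<close>
  bounded. It then solves the first problem with right-hand side 0, as the zero function does, and
  uniqueness identifies the two.\<close>

lemma Z_stable_imp_0:
  assumes "z \<in> Z" "0 \<le> t" "T t 0 z \<in> stable t"
  shows "z = 0"
proof -
  \<comment> \<open>The zero right-hand side, written as a block to make
    \<open>forcing_block\<close> and \<open>block_mem\<close> available.\<close>
  have bb: "block_bound 0 1 0 0"
    using N_eq_0[of _ 0] by (auto simp: block_bound_def)
  have mild: "mild (forcing (\<lambda>_. 1) (block 0 1 0)) x \<longleftrightarrow> mild (\<lambda>s t. 0) x" for x
    by (rule mild_cong) (simp add: forcing_block[where G="\<lambda>t. t", OF _ _ bb])
  obtain B where B: "\<And>r. r \<ge> t \<Longrightarrow> N r (T r t (T t 0 z)) \<le> B"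
    using assms(3) by (auto simp: stable_def)
  have "z \<in> stable 0"
    by (rule stableI[of _ t _ B]) (use B assms(2) in \<open>simp_all add: T_comp\<close>)
  then obtain A where A: "\<And>r. r \<ge> 0 \<Longrightarrow> N r (T r 0 z) \<le> A"
    by (auto simp: stable_def)
  let ?x = "restrict (\<lambda>r. T r 0 z) {0..}" and ?o = "restrict (\<lambda>r. 0) {0..} :: real \<Rightarrow> 'a"
  have "?x \<in> YinfZ N Z"
  proof (rule YinfZI)
    show "continuous_on {0..} ?x"
      by (rule continuous_on_eq[OF T_cont[of 0 z]]) auto
  qed (use A assms in \<open>auto simp: T_id\<close>)
  moreover have "?o \<in> YinfZ N Z"
  proof (rule YinfZI[of _ _ 0])
    show "continuous_on {0..} ?o"
      by (rule continuous_on_eq[OF continuous_on_const[of _ 0]]) auto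
  qed (use N_eq_0[of _ 0] Z in \<open>auto simp: subspace_0\<close>)
  moreover have "mild (\<lambda>s t. 0) ?x" "mild (\<lambda>s t. 0) ?o"
    by (auto simp: mild_def T_comp)
  ultimately have "?x = ?o"
    using Y1_ex1[OF block_mem(1)[OF bb]] unfolding mild by blast
  from fun_cong[OF this, of 0] show ?thesis
    by (simp add: T_id)
qed

lemma Z_stable_unique:
  assumes "z \<in> Z" "z' \<in> Z" "0 \<le> a" "v - T a 0 z \<in> stable a" "v - T a 0 z' \<in> stable a"
  shows "z = z'"
proof -
  have "(v - T a 0 z) - (v - T a 0 z') \<in> stable a"
    by (rule subspace_diff[OF subspace_stable[OF assms(3)] assms(4,5)])
  then have "T a 0 (z' - z) \<in> stable a"
    by (simp add: blinfun.diff_right)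
  then have "z' - z = 0"
    using assms Z by (intro Z_stable_imp_0[of _ a]) (auto simp: subspace_diff)
  then show ?thesis
    by simp
qed

lemma splitting:
  "\<exists>K>0. \<forall>a\<ge>0. \<forall>v. \<exists>z\<in>Z. v - T a 0 z \<in> stable a \<and>
    (\<forall>t. 0 \<le> t \<longrightarrow> t \<le> a \<longrightarrow> N t (T t 0 z) \<le> K * N a v) \<and>
    (\<forall>t\<ge>a. N t (T t a (v - T a 0 z)) \<le> K * N a v)"
proof -
  obtain K where K: "K > 0" "\<And>a b v \<beta> x t. block_bound a b v \<beta> \<Longrightarrow> 0 < \<beta> \<Longrightarrow> x \<in> YinfZ N Z \<Longrightarrow>
      mild (forcing (\<lambda>_. 1) (block a b v)) x \<Longrightarrow> 0 \<le> t \<Longrightarrow> N t (x t) \<le> K * (b - a) * \<beta>"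
    using Y1_solution_bounded by blast
  have approx: "\<exists>z\<in>Z. v - T a 0 z \<in> stable a \<and>
      (\<forall>t. 0 \<le> t \<longrightarrow> t \<le> a \<longrightarrow> N t (T t 0 z) \<le> K * \<beta>) \<and>
      (\<forall>t\<ge>a + \<delta>. N t (T t a (v - T a 0 z)) \<le> K * \<beta>)"
    if a: "0 \<le> a" and \<beta>: "N a v < \<beta>" and \<delta>: "0 < \<delta>" for a v \<beta> \<delta>
  proof -
    have \<beta>_pos: "0 < \<beta>"
      using N_nonneg[OF a, of v] \<beta> by simp
    obtain b where b: "b < a + \<delta>" and bb: "block_bound a b v \<beta>"
      using block_bound_exists[OF a \<beta> \<delta>] .
    have ab: "a < b"
      using bb by (simp add: block_bound_def)
    obtain x where x: "x \<in> YinfZ N Z" and mild: "mild (forcing (\<lambda>_. 1) (block a b v)) x"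
      using Y1_ex1[OF block_mem(1)[OF bb]] by blast
    have x_le: "N t (x t) \<le> K * (b - a) * \<beta>" if "t \<ge> 0" for t
      using K(2)[OF bb \<beta>_pos x mild that] .
    have x_eq: "x t = T t s (x s) + (max a (min b t) - max a (min b s)) *\<^sub>R T t a v" if "0 \<le> s" "s \<le> t" for s t
      using mildD[OF mild that] forcing_block[where G="\<lambda>t. t" and g="\<lambda>_. 1", OF _ _ bb that] by simp
    \<comment> \<open>Up to time \<open>a\<close> the solution is the orbit of \<open>x 0\<close>;
      from \<open>b\<close> on it is the orbit of the vector
      \<open>x a + (b - a) *\<^sub>R v\<close> started at time \<open>a\<close>. Division by
      \<open>b - a\<close> therefore writes \<open>v\<close> as \<open>T a 0 z\<close> plus a vector
      with bounded orbit.\<close>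
    define z where "z = (- 1 / (b - a)) *\<^sub>R x 0"
    have z: "z \<in> Z"
      unfolding z_def by (rule subspace_scale[OF Z(2) YinfZD(3)[OF x]])
    have x_before: "x t = T t 0 (x 0)" if "0 \<le> t" "t \<le> a" for t
    proof -
      have "max a (min b t) = a" "max a (min b 0) = a"
        using that a by auto
      then show ?thesis
        using x_eq[of 0 t] that by simp
    qed
    have before: "N t (T t 0 z) \<le> K * \<beta>" if t: "0 \<le> t" "t \<le> a" for t
    proof -
      have "N t (T t 0 z) = N t (x t) / (b - a)"
        using t ab unfolding x_before[OF t] by (simp add: z_def blinfun.scaleR_right blinfun.minus_right N_scale N_minus)
      also have "\<dots> \<le> K * \<beta>"
        using x_le[OF t(1)] ab by (simp add: field_simps)
      finally show ?thesis .
    qed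
    have after: "N t (T t a (v - T a 0 z)) \<le> K * \<beta>" if t: "b \<le> t" for t
    proof -
      have "max a (min b t) = b" "max a (min b a) = a"
        using t ab by auto
      then have "x t = T t a (x a) + (b - a) *\<^sub>R T t a v"
        using x_eq[of a t] t ab a by simp
      then have "T t a (v - T a 0 z) = (1 / (b - a)) *\<^sub>R x t"
        using ab unfolding x_before[OF a order_refl]
        by (simp add: z_def blinfun.add_right blinfun.scaleR_right blinfun.minus_right scaleR_add_right)
      then have "N t (T t a (v - T a 0 z)) = N t (x t) / (b - a)"
        using t ab a by (simp add: N_scale)
      also have "\<dots> \<le> K * \<beta>"
        using x_le[of t] t ab a by (simp add: field_simps)
      finally show ?thesis .
    qed
    have "v - T a 0 z \<in> stable a"
      using a after by (rule stableI)
    with z before after b show ?thesis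
      by (intro bexI[of _ z]) auto
  qed
  have "\<exists>z\<in>Z. v - T a 0 z \<in> stable a \<and>
    (\<forall>t. 0 \<le> t \<longrightarrow> t \<le> a \<longrightarrow> N t (T t 0 z) \<le> (K + 1) * N a v) \<and>
    (\<forall>t\<ge>a. N t (T t a (v - T a 0 z)) \<le> (K + 1) * N a v)" if a: "0 \<le> a" for a v
  proof -
    obtain z where z: "z \<in> Z" "v - T a 0 z \<in> stable a"
      using approx[OF a, of v "N a v + 1" 1] by auto
    \<comment> \<open>The vector given by \<open>approx\<close> might depend on
      \<open>\<beta>\<close> and \<open>\<delta>\<close>, but \<open>Z_stable_unique\<close> forces
      it to be the \<open>z\<close> fixed above. So \<open>\<beta>\<close> can tend to
      \<open>N a v\<close> and \<open>\<delta>\<close> can be as small as desired.\<close>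
    have approx_z: "(\<forall>t. 0 \<le> t \<longrightarrow> t \<le> a \<longrightarrow> N t (T t 0 z) \<le> K * \<beta>) \<and>
      (\<forall>t\<ge>a + \<delta>. N t (T t a (v - T a 0 z)) \<le> K * \<beta>)" if "N a v < \<beta>" "0 < \<delta>" for \<beta> \<delta>
      using approx[OF a that] Z_stable_unique[OF z(1) _ a z(2)] by blast
    have limit: "q \<le> K * N a v" if "\<And>\<beta>. N a v < \<beta> \<Longrightarrow> q \<le> K * \<beta>" for q
    proof (rule field_le_epsilon)
      fix e :: real assume "e > 0"
      then show "q \<le> K * N a v + e"
        using that[of "N a v + e / K"] K(1) by (simp add: distrib_left)
    qed
    have before: "N t (T t 0 z) \<le> K * N a v" if "0 \<le> t" "t \<le> a" for t
      using approx_z[of _ 1] that by (intro limit) auto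
    have Nv: "0 \<le> N a v"
      using N_nonneg[OF a] .
    \<comment> \<open>The limit reaches only \<open>t > a\<close>. At \<open>t = a\<close> the
      triangle inequality and the bound on \<open>T a 0 z\<close> are used instead, hence
      \<open>K + 1\<close>.\<close>
    have after: "N t (T t a (v - T a 0 z)) \<le> (K + 1) * N a v" if "t \<ge> a" for t
    proof (cases "t = a")
      case True
      then show ?thesis
        using N_diff[OF a, of v "T a 0 z"] before[of a] a by (simp add: T_id distrib_right)
    next
      case False
      then have "N t (T t a (v - T a 0 z)) \<le> K * N a v"
        using approx_z[of _ "t - a"] that by (intro limit) auto
      then show ?thesis
        using Nv by (simp add: distrib_right)
    qed
    have "K * N a v \<le> (K + 1) * N a v"
      using Nv by (simp add: distrib_right)
    with z before after show ?thesis
      by (intro bexI[of _ z]) (auto intro: order_trans)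
  qed
  then show ?thesis
    using K(1) by (intro exI[of _ "K + 1"]) auto
qed

text \<open>By uniqueness a stable vector splits with \<open>z = 0\<close>, and
  \<open>T s 0 z\<close> splits with \<open>z\<close> itself. For these vectors the bounds of
  \<open>splitting\<close> become growth bounds, forward on the stable and backward on the unstable
  side.\<close>

lemma bounded_growth:
  "\<exists>K>0.
    (\<forall>s t v. 0 \<le> s \<longrightarrow> s \<le> t \<longrightarrow> v \<in> stable s \<longrightarrow> N t (T t s v) \<le> K * N s v) \<and>
    (\<forall>s t z. 0 \<le> t \<longrightarrow> t \<le> s \<longrightarrow> z \<in> Z \<longrightarrow> N t (T t 0 z) \<le> K * N s (T s 0 z)) \<and>
    (\<forall>s v. 0 \<le> s \<longrightarrow> (\<exists>z\<in>Z. v - T s 0 z \<in> stable s \<and> N s (T s 0 z) \<le> K * N s v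
      \<and> N s (v - T s 0 z) \<le> K * N s v))"
proof -
  obtain K where K: "K > 0" "\<And>a v. a \<ge> 0 \<Longrightarrow> \<exists>z\<in>Z. v - T a 0 z \<in> stable a \<and>
    (\<forall>t. 0 \<le> t \<longrightarrow> t \<le> a \<longrightarrow> N t (T t 0 z) \<le> K * N a v) \<and>
    (\<forall>t\<ge>a. N t (T t a (v - T a 0 z)) \<le> K * N a v)"
    using splitting by blast
  show ?thesis
  proof (intro exI[of _ K] conjI allI impI K(1))
    fix s t :: real and v assume st: "0 \<le> s" "s \<le> t" "v \<in> stable s"
    obtain z where z: "z \<in> Z" "v - T s 0 z \<in> stable s" "N t (T t s (v - T s 0 z)) \<le> K * N s v"
      using K(2)[OF st(1), of v] st by blast
    have "z = 0"
      using z st Z by (intro Z_stable_unique[of z 0 s v]) (auto simp: subspace_0)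
    with z show "N t (T t s v) \<le> K * N s v"
      by simp
  next
    fix s t :: real and z assume st: "0 \<le> t" "t \<le> s" "z \<in> Z"
    then have s: "0 \<le> s"
      by simp
    obtain z' where z': "z' \<in> Z" "T s 0 z - T s 0 z' \<in> stable s" "N t (T t 0 z') \<le> K * N s (T s 0 z)"
      using K(2)[OF s, of "T s 0 z"] st by blast
    have "z' = z"
      using z' st subspace_0[OF subspace_stable[OF s]] by (intro Z_stable_unique[of z' z s "T s 0 z"]) auto
    with z' show "N t (T t 0 z) \<le> K * N s (T s 0 z)"
      by simp
  next
    fix s v assume s: "0 \<le> (s::real)"
    obtain z where "z \<in> Z" "v - T s 0 z \<in> stable s" "N s (T s 0 z) \<le> K * N s v"
        "N s (T s s (v - T s 0 z)) \<le> K * N s v"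
      using K(2)[OF s, of v] s by blast
    then show "\<exists>z\<in>Z. v - T s 0 z \<in> stable s \<and> N s (T s 0 z) \<le> K * N s v
      \<and> N s (v - T s 0 z) \<le> K * N s v"
      using s by (intro bexI[of _ z]) (simp_all add: T_id)
  qed
qed

end

section \<open>Exponential decay\<close>

text \<open>By \<open>decay\<close>, \<open>f\<close> drops by a factor \<open>exp 1\<close> over every interval of length \<open>exp 1 * L\<close>.\<close>

lemma exponential_decay:
  fixes f :: "real \<Rightarrow> real"
  assumes K: "0 < K" and L: "0 < L" and nonneg: "\<And>x. x \<in> {p..q} \<Longrightarrow> 0 \<le> f x"
    and growth: "\<And>x y. p \<le> x \<Longrightarrow> x \<le> y \<Longrightarrow> y \<le> q \<Longrightarrow> f y \<le> K * f x"
    and decay: "\<And>x y. p \<le> x \<Longrightarrow> x \<le> y \<Longrightarrow> y \<le> q \<Longrightarrow> (y - x) * f y \<le> L * f x"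
    and "p \<le> q"
  shows "f q \<le> K * exp 1 * exp (- (1 / (exp 1 * L)) * (q - p)) * f p"
proof -
  \<comment> \<open>A drop by a factor \<open>q\<close> takes the length \<open>q * L\<close>, which
    gives the rate \<open>ln q / (q * L)\<close>; this is largest for
    \<open>q = exp 1\<close>.\<close>
  let ?H = "exp 1 * L"
  have H: "?H > 0"
    using L by simp
  have iter: "f (p + real n * ?H) \<le> exp (- real n) * f p" if "p + real n * ?H \<le> q" for n
    using that
  proof (induction n)
    case (Suc n)
    let ?x = "p + real n * ?H" and ?y = "p + real (Suc n) * ?H"
    have yx: "?y - ?x = ?H"
      by (simp add: algebra_simps)
    have xp: "p \<le> ?x" "?x \<le> ?y"
      using yx L by (simp_all del: of_nat_Suc)
    have "?H * f ?y \<le> L * f ?x"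
      using decay[OF xp Suc.prems] unfolding yx .
    then have "f ?y \<le> exp (- 1) * f ?x"
      using L by (simp add: exp_minus field_simps)
    also have "\<dots> \<le> exp (- 1) * (exp (- real n) * f p)"
      using Suc xp(2) by (intro mult_left_mono) auto
    also have "\<dots> = exp (- real (Suc n)) * f p"
      by (simp flip: exp_add mult.assoc)
    finally show ?case .
  qed simp
  define n where "n = nat \<lfloor>(q - p) / ?H\<rfloor>"
  have n: "real n \<le> (q - p) / ?H" "(q - p) / ?H < real n + 1"
    using H \<open>p \<le> q\<close> by (simp_all add: n_def)
  have le: "p + real n * ?H \<le> q"
    using n(1) H by (simp add: field_simps)
  have "f q \<le> K * f (p + real n * ?H)"
    using le H by (intro growth) auto
  also have "\<dots> \<le> K * (exp (- real n) * f p)"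
    using K iter[OF le] by (intro mult_left_mono) auto
  \<comment> \<open>Rounding down loses less than one step, which costs at most the factor
    \<open>exp 1\<close>.\<close>
  also have "\<dots> \<le> K * (exp (1 - (q - p) / ?H) * f p)"
    using K n(2) nonneg[of p] \<open>p \<le> q\<close> by (intro mult_left_mono mult_right_mono) auto
  also have "\<dots> = K * exp 1 * exp (- (1 / ?H) * (q - p)) * f p"
    by (simp flip: exp_add)
  finally show ?thesis .
qed

section \<open>Decay from the second problem\<close>

context admissible_evolution
begin

lemma rho_le: "0 \<le> s \<Longrightarrow> s \<le> t \<Longrightarrow> \<rho> s \<le> \<rho> t"
  using rho_mono by (auto simp: strict_mono_on_def le_less)

lemma rho_cont: "continuous_on {0..} \<rho>"
  using rho_deriv by (intro DERIV_continuous_on[where D=\<rho>']) auto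

lemma rho_clamp_cont:
  assumes "0 \<le> a" "a \<le> b"
  shows "continuous_on {0..} (\<lambda>r. \<rho> (max a (min b r)))"
  by (rule continuous_on_compose2[OF rho_cont]) (use assms in \<open>auto intro!: continuous_intros\<close>)

lemma stable_decay:
  "\<exists>L>0. \<forall>s t v. 0 \<le> s \<longrightarrow> s \<le> t \<longrightarrow> v \<in> stable s \<longrightarrow> (\<rho> t - \<rho> s) * N t (T t s v) \<le> L * N s v"
proof -
  obtain K where K: "K > 0"
    "\<And>s t v. 0 \<le> s \<Longrightarrow> s \<le> t \<Longrightarrow> v \<in> stable s \<Longrightarrow> N t (T t s v) \<le> K * N s v"
    using bounded_growth by blast
  obtain K' where K': "K' > 0" "\<And>a b v \<beta> x t. block_bound a b v \<beta> \<Longrightarrow> 0 < \<beta> \<Longrightarrow> x \<in> YinfZ N Z \<Longrightarrow>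
      mild (forcing \<rho>' (block a b v)) x \<Longrightarrow> 0 \<le> t \<Longrightarrow> N t (x t) \<le> K' * 1 * \<beta>"
    using Yinf'_solution_bounded by blast
  have "(\<rho> t - \<rho> s) * N t (T t s v) \<le> K' * K * N s v" if st: "0 \<le> s" "s \<le> t" and v: "v \<in> stable s" for s t v
  \<comment> \<open>A block needs \<open>s < t\<close>, and \<open>Yinf'_solution_bounded\<close>
    needs a positive bound.\<close>
  proof (cases "s = t \<or> v = 0")
    case True
    then show ?thesis
      using st K(1) K'(1) N_nonneg[of s v] N_eq_0[of t 0] by auto
  next
    case False
    \<comment> \<open>By \<open>bounded_growth\<close> this bounds the whole forward orbit, so the
      final constant is \<open>K' * K\<close>.\<close>
    define \<beta> where "\<beta> = K * N s v"
    have "0 < \<beta>"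
      using False K(1) N_nonneg[of s v] N_eq_0[of s v] st by (simp add: \<beta>_def less_le)
    have le: "N r (T r s v) \<le> \<beta>" if "s \<le> r" for r
      unfolding \<beta>_def using st that v by (intro K(2)) auto
    have bb: "block_bound s t v \<beta>"
      using st False le by (auto simp: block_bound_def)
    \<comment> \<open>The clamp freezes the factor outside \<open>{s..t}\<close>: it is 0 before
      \<open>s\<close> and \<open>\<rho> t - \<rho> s\<close> after \<open>t\<close>. The maximum in
      \<open>T (max r s) s v\<close> avoids \<open>r < s\<close>, where the factor is 0 anyway. The
      initial value is 0, hence in \<open>Z\<close>.\<close>
    define x where "x = restrict (\<lambda>r. (\<rho> (max s (min t r)) - \<rho> s) *\<^sub>R T (max r s) s v) {0..}"
    have \<rho>: "\<rho> s \<le> \<rho> (max s (min t r))" "\<rho> (max s (min t r)) \<le> \<rho> t" for r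
      using st by (auto intro!: rho_le)
    have "x \<in> YinfZ N Z"
    proof (rule YinfZI)
      have "continuous_on {0..} (\<lambda>r. T (max r s) s v)"
        by (rule continuous_on_compose2[OF T_cont[OF st(1)]]) (auto intro!: continuous_intros)
      then have "continuous_on {0..} (\<lambda>r. (\<rho> (max s (min t r)) - \<rho> s) *\<^sub>R T (max r s) s v)"
        using rho_clamp_cont[OF st] by (intro continuous_on_scaleR continuous_on_diff continuous_on_const)
      then show "continuous_on {0..} x"
        unfolding x_def by (rule continuous_on_eq) simp
      show "x 0 \<in> Z"
        using st Z by (simp add: x_def subspace_0)
      show "N r (x r) \<le> (\<rho> t - \<rho> s) * \<beta>" if r: "0 \<le> r" for r
      proof (cases "s \<le> r")
        case True
        then have "N r (x r) = (\<rho> (max s (min t r)) - \<rho> s) * N r (T r s v)"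
          using r \<rho>(1)[of r] by (simp add: x_def N_scale max_absorb1)
        also have "\<dots> \<le> (\<rho> t - \<rho> s) * \<beta>"
          using \<rho>[of r] le[OF True] N_nonneg[OF r] by (intro mult_mono) auto
        finally show ?thesis .
      next
        case False
        then have "max s (min t r) = s"
          using st by auto
        then show ?thesis
          using r \<open>0 < \<beta>\<close> rho_le[OF st] N_eq_0[OF r, of 0] by (simp add: x_def)
      qed
    qed (simp add: x_def)
    moreover have "mild (forcing \<rho>' (block s t v)) x"
      unfolding mild_def
    proof (intro allI impI)
      fix q r :: real assume qr: "0 \<le> q" "q \<le> r"
      have eq: "forcing \<rho>' (block s t v) q r = (\<rho> (max s (min t r)) - \<rho> (max s (min t q))) *\<^sub>R T r s v"
        by (rule forcing_block[OF rho_deriv rho_C1 bb qr])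
      show "x r = T r q (x q) + forcing \<rho>' (block s t v) q r"
      proof (cases "s \<le> r")
        case True
        show ?thesis
        proof (cases "s \<le> q")
          case q: True
          have "T r q (x q) = (\<rho> (max s (min t q)) - \<rho> s) *\<^sub>R T r s v"
            using qr q st by (simp add: x_def blinfun.scaleR_right T_comp max_absorb1)
          then show ?thesis
            using qr True by (simp add: eq x_def max_absorb1 flip: scaleR_add_left)
        next
          case False
          then have "max s (min t q) = s"
            using st by auto
          then show ?thesis
            using qr True by (simp add: eq x_def max_absorb1)
        qed
      next
        case False
        then have "max s (min t q) = s" "max s (min t r) = s"
          using st qr by auto
        then show ?thesis
          using qr by (simp add: eq x_def)
      qed
    qed
    ultimately have "N t (x t) \<le> K' * 1 * \<beta>"
      using bb \<open>0 < \<beta>\<close> st by (intro K'(2)) auto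
    moreover have "N t (x t) = (\<rho> t - \<rho> s) * N t (T t s v)"
      using st rho_le[OF st] by (simp add: x_def N_scale max_absorb1 max_absorb2)
    ultimately show ?thesis
      by (simp add: \<beta>_def mult.assoc)
  qed
  then show ?thesis
    using K(1) K'(1) by (intro exI[of _ "K' * K"]) simp
qed

lemma unstable_decay:
  "\<exists>L>0. \<forall>s t z. 0 \<le> t \<longrightarrow> t \<le> s \<longrightarrow> z \<in> Z \<longrightarrow> (\<rho> s - \<rho> t) * N t (T t 0 z) \<le> L * N s (T s 0 z)"
proof -
  obtain K where K: "K > 0"
    "\<And>s t z. 0 \<le> t \<Longrightarrow> t \<le> s \<Longrightarrow> z \<in> Z \<Longrightarrow> N t (T t 0 z) \<le> K * N s (T s 0 z)"
    using bounded_growth by blast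
  obtain K' where K': "K' > 0" "\<And>a b v \<beta> x t. block_bound a b v \<beta> \<Longrightarrow> 0 < \<beta> \<Longrightarrow> x \<in> YinfZ N Z \<Longrightarrow>
      mild (forcing \<rho>' (block a b v)) x \<Longrightarrow> 0 \<le> t \<Longrightarrow> N t (x t) \<le> K' * 1 * \<beta>"
    using Yinf'_solution_bounded by blast
  have "(\<rho> s - \<rho> t) * N t (T t 0 z) \<le> K' * K * N s (T s 0 z)" if st: "0 \<le> t" "t \<le> s" and z: "z \<in> Z" for s t z
  proof (cases "s = t \<or> N s (T s 0 z) = 0")
    case True
    then show ?thesis
    proof
      assume "N s (T s 0 z) = 0"
      moreover have "N t (T t 0 z) = 0"
        using K(2)[OF st z] calculation N_nonneg[OF st(1), of "T t 0 z"] by simp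
      ultimately show ?thesis
        by simp
    qed (use st K(1) K'(1) N_nonneg[of s "T s 0 z"] in auto)
  next
    case False
    define \<beta> where "\<beta> = K * N s (T s 0 z)"
    have "0 < \<beta>"
      using False K(1) N_nonneg[of s "T s 0 z"] st by (simp add: \<beta>_def less_le)
    have le: "N r (T r 0 z) \<le> \<beta>" if "0 \<le> r" "r \<le> s" for r
      unfolding \<beta>_def using that z by (intro K(2)) auto
    have bb: "block_bound t s (T t 0 z) \<beta>"
      using st False le by (auto simp: block_bound_def T_comp)
    \<comment> \<open>Here the factor vanishes after \<open>s\<close>, so the orbit beyond
      \<open>s\<close>, which may grow, does not matter. Before \<open>t\<close> the factor is the
      constant \<open>\<rho> t - \<rho> s\<close>; hence the initial value is a multiple of
      \<open>z\<close> and lies in \<open>Z\<close>.\<close>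
    define x where "x = restrict (\<lambda>r. (\<rho> (max t (min s r)) - \<rho> s) *\<^sub>R T r 0 z) {0..}"
    have \<rho>: "\<rho> t \<le> \<rho> (max t (min s r))" "\<rho> (max t (min s r)) \<le> \<rho> s" for r
      using st by (auto intro!: rho_le)
    have "x \<in> YinfZ N Z"
    proof (rule YinfZI)
      have "continuous_on {0..} (\<lambda>r. (\<rho> (max t (min s r)) - \<rho> s) *\<^sub>R T r 0 z)"
        using rho_clamp_cont[OF st] T_cont[of 0 z]
        by (intro continuous_on_scaleR continuous_on_diff continuous_on_const) auto
      then show "continuous_on {0..} x"
        unfolding x_def by (rule continuous_on_eq) simp
      show "x 0 \<in> Z"
        using z Z by (simp add: x_def T_id subspace_scale)
      show "N r (x r) \<le> (\<rho> s - \<rho> t) * \<beta>" if r: "0 \<le> r" for r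
      proof (cases "r \<le> s")
        case True
        have "N r (x r) = (\<rho> s - \<rho> (max t (min s r))) * N r (T r 0 z)"
          using r \<rho>(2)[of r] by (simp add: x_def N_scale)
        also have "\<dots> \<le> (\<rho> s - \<rho> t) * \<beta>"
          using \<rho>[of r] le[OF r True] N_nonneg[OF r] by (intro mult_mono) auto
        finally show ?thesis .
      next
        case False
        then have "max t (min s r) = s"
          using st by auto
        then show ?thesis
          using r \<open>0 < \<beta>\<close> rho_le[OF st] N_eq_0[OF r, of 0] by (simp add: x_def)
      qed
    qed (simp add: x_def)
    moreover have "mild (forcing \<rho>' (block t s (T t 0 z))) x"
      unfolding mild_def
    proof (intro allI impI)
      fix q r :: real assume qr: "0 \<le> q" "q \<le> r"
      have "forcing \<rho>' (block t s (T t 0 z)) q r = (\<rho> (max t (min s r)) - \<rho> (max t (min s q))) *\<^sub>R T r t (T t 0 z)"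
        by (rule forcing_block[OF rho_deriv rho_C1 bb qr])
      also have "\<dots> = (\<rho> (max t (min s r)) - \<rho> (max t (min s q))) *\<^sub>R T r 0 z"
      proof (cases "t \<le> r")
        case False
        then have "max t (min s q) = t" "max t (min s r) = t"
          using st qr by auto
        then show ?thesis
          by simp
      qed (use st in \<open>simp add: T_comp\<close>)
      finally have eq: "forcing \<rho>' (block t s (T t 0 z)) q r = (\<rho> (max t (min s r)) - \<rho> (max t (min s q))) *\<^sub>R T r 0 z" .
      have "T r q (x q) = (\<rho> (max t (min s q)) - \<rho> s) *\<^sub>R T r 0 z"
        using qr by (simp add: x_def blinfun.scaleR_right T_comp)
      then show "x r = T r q (x q) + forcing \<rho>' (block t s (T t 0 z)) q r"
        using qr by (simp add: eq x_def flip: scaleR_add_left)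
    qed
    ultimately have "N t (x t) \<le> K' * 1 * \<beta>"
      using bb \<open>0 < \<beta>\<close> st by (intro K'(2)) auto
    moreover have "N t (x t) = (\<rho> s - \<rho> t) * N t (T t 0 z)"
      using st rho_le[OF st] by (simp add: x_def N_scale max_absorb1 min_absorb2)
    ultimately show ?thesis
      by (simp add: \<beta>_def mult.assoc)
  qed
  then show ?thesis
    using K(1) K'(1) by (intro exI[of _ "K' * K"]) simp
qed

text \<open>Reparametrization by \<open>\<rho>\<close> turns the factors in
  \<open>stable_decay\<close> and \<open>unstable_decay\<close> into lengths of intervals, as
  \<open>exponential_decay\<close> expects. That every value in between is attained is the
  intermediate value theorem.\<close>

lemma rho_inverse:
  assumes "0 \<le> s" "s \<le> t"
  shows "\<exists>\<xi>. \<xi> (\<rho> s) = s \<and> \<xi> (\<rho> t) = t \<and>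
    (\<forall>y\<in>{\<rho> s..\<rho> t}. s \<le> \<xi> y \<and> \<xi> y \<le> t \<and> \<rho> (\<xi> y) = y) \<and>
    (\<forall>x\<in>{\<rho> s..\<rho> t}. \<forall>y\<in>{\<rho> s..\<rho> t}. x \<le> y \<longrightarrow> \<xi> x \<le> \<xi> y)"
proof -
  define \<xi> where "\<xi> = the_inv_into {0..} \<rho>"
  have \<xi>_rho: "\<xi> (\<rho> r) = r" if "0 \<le> r" for r
    unfolding \<xi>_def using that rho_mono
    by (intro the_inv_into_f_f strict_mono_on_imp_inj_on) auto
  have \<xi>: "s \<le> \<xi> y \<and> \<xi> y \<le> t \<and> \<rho> (\<xi> y) = y" if y: "y \<in> {\<rho> s..\<rho> t}" for y
  proof -
    have "continuous_on {s..t} \<rho>"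
      using assms by (intro continuous_on_subset[OF rho_cont]) auto
    then obtain r where "s \<le> r" "r \<le> t" "\<rho> r = y"
      using IVT'[of \<rho> s y t] y assms by auto
    then show ?thesis
      using \<xi>_rho[of r] assms by auto
  qed
  show ?thesis
  proof (intro exI[of _ \<xi>] conjI ballI impI)
    fix x y assume xy: "x \<in> {\<rho> s..\<rho> t}" "y \<in> {\<rho> s..\<rho> t}" "x \<le> y"
    show "\<xi> x \<le> \<xi> y"
    proof (rule ccontr)
      assume "\<not> \<xi> x \<le> \<xi> y"
      then have "\<rho> (\<xi> y) < \<rho> (\<xi> x)"
        using \<xi>[OF xy(1)] \<xi>[OF xy(2)] assms by (intro strict_mono_onD[OF rho_mono]) auto
      then show False
        using \<xi>[OF xy(1)] \<xi>[OF xy(2)] xy(3) by simp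
    qed
  qed (use assms \<xi> \<xi>_rho in auto)
qed

lemma exponential_bounds:
  "\<exists>\<mu>>0. \<exists>D>0.
    (\<forall>s t v. 0 \<le> s \<longrightarrow> s \<le> t \<longrightarrow> v \<in> stable s \<longrightarrow>
      N t (T t s v) \<le> D * exp (- \<mu> * (\<rho> t - \<rho> s)) * N s v) \<and>
    (\<forall>s t z. 0 \<le> t \<longrightarrow> t \<le> s \<longrightarrow> z \<in> Z \<longrightarrow>
      N t (T t 0 z) \<le> D * exp (- \<mu> * (\<rho> s - \<rho> t)) * N s (T s 0 z))"
proof -
  obtain K where K: "K > 0"
    "\<And>s t v. 0 \<le> s \<Longrightarrow> s \<le> t \<Longrightarrow> v \<in> stable s \<Longrightarrow> N t (T t s v) \<le> K * N s v"
    "\<And>s t z. 0 \<le> t \<Longrightarrow> t \<le> s \<Longrightarrow> z \<in> Z \<Longrightarrow> N t (T t 0 z) \<le> K * N s (T s 0 z)"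
    using bounded_growth by blast
  obtain L1 where L1: "L1 > 0"
    "\<And>s t v. 0 \<le> s \<Longrightarrow> s \<le> t \<Longrightarrow> v \<in> stable s \<Longrightarrow> (\<rho> t - \<rho> s) * N t (T t s v) \<le> L1 * N s v"
    using stable_decay by blast
  obtain L2 where L2: "L2 > 0"
    "\<And>s t z. 0 \<le> t \<Longrightarrow> t \<le> s \<Longrightarrow> z \<in> Z \<Longrightarrow> (\<rho> s - \<rho> t) * N t (T t 0 z) \<le> L2 * N s (T s 0 z)"
    using unstable_decay by blast
  define L where "L = max L1 L2"
  have L: "0 < L" "L1 \<le> L" "L2 \<le> L"
    using L1(1) by (auto simp: L_def)
  let ?\<mu> = "1 / (exp 1 * L)" and ?D = "K * exp 1"
  have stab: "N t (T t s v) \<le> ?D * exp (- ?\<mu> * (\<rho> t - \<rho> s)) * N s v"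
    if st: "0 \<le> s" "s \<le> t" and v: "v \<in> stable s" for s t v
  proof -
    obtain \<xi> where \<xi>0: "\<xi> (\<rho> s) = s" "\<xi> (\<rho> t) = t"
      and \<xi>: "\<And>y. y \<in> {\<rho> s..\<rho> t} \<Longrightarrow> s \<le> \<xi> y \<and> \<xi> y \<le> t \<and> \<rho> (\<xi> y) = y"
      and mono: "\<And>x y. x \<in> {\<rho> s..\<rho> t} \<Longrightarrow> y \<in> {\<rho> s..\<rho> t} \<Longrightarrow> x \<le> y \<Longrightarrow> \<xi> x \<le> \<xi> y"
      using rho_inverse[OF st] by blast
    define f where "f y = N (\<xi> y) (T (\<xi> y) s v)" for y
    have "f (\<rho> t) \<le> K * exp 1 * exp (- ?\<mu> * (\<rho> t - \<rho> s)) * f (\<rho> s)"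
    proof (rule exponential_decay[OF K(1) L(1)])
      show "0 \<le> f x" if "x \<in> {\<rho> s..\<rho> t}" for x
        using \<xi>[OF that] st N_nonneg by (simp add: f_def)
      show "\<rho> s \<le> \<rho> t"
        by (rule rho_le[OF st])
      fix x y assume "\<rho> s \<le> x" "x \<le> y" "y \<le> \<rho> t"
      then have xy: "x \<in> {\<rho> s..\<rho> t}" "y \<in> {\<rho> s..\<rho> t}" "\<xi> x \<le> \<xi> y"
        using mono by auto
      note \<xi>x = \<xi>[OF xy(1)] and \<xi>y = \<xi>[OF xy(2)]
      have eq: "T (\<xi> y) s v = T (\<xi> y) (\<xi> x) (T (\<xi> x) s v)"
        using \<xi>x xy(3) st by (simp add: T_comp)
      have stab_x: "T (\<xi> x) s v \<in> stable (\<xi> x)"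
        using \<xi>x st v by (intro stable_T) auto
      show "f y \<le> K * f x"
        unfolding f_def eq using \<xi>x xy(3) st stab_x by (intro K(2)) auto
      have "(\<rho> (\<xi> y) - \<rho> (\<xi> x)) * N (\<xi> y) (T (\<xi> y) (\<xi> x) (T (\<xi> x) s v)) \<le> L1 * N (\<xi> x) (T (\<xi> x) s v)"
        using \<xi>x xy(3) st stab_x by (intro L1(2)) auto
      then have "(y - x) * f y \<le> L1 * f x"
        using \<xi>x \<xi>y by (simp add: f_def eq)
      also have "\<dots> \<le> L * f x"
        using L(2) \<xi>x st N_nonneg by (intro mult_right_mono) (auto simp: f_def)
      finally show "(y - x) * f y \<le> L * f x" .
    qed
    then show ?thesis
      using st by (simp add: f_def \<xi>0 T_id)
  qed
  have unst: "N t (T t 0 z) \<le> ?D * exp (- ?\<mu> * (\<rho> s - \<rho> t)) * N s (T s 0 z)"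
    if ts: "0 \<le> t" "t \<le> s" and z: "z \<in> Z" for s t z
  proof -
    obtain \<xi> where \<xi>0: "\<xi> (\<rho> t) = t" "\<xi> (\<rho> s) = s"
      and \<xi>: "\<And>y. y \<in> {\<rho> t..\<rho> s} \<Longrightarrow> t \<le> \<xi> y \<and> \<xi> y \<le> s \<and> \<rho> (\<xi> y) = y"
      and mono: "\<And>x y. x \<in> {\<rho> t..\<rho> s} \<Longrightarrow> y \<in> {\<rho> t..\<rho> s} \<Longrightarrow> x \<le> y \<Longrightarrow> \<xi> x \<le> \<xi> y"
      using rho_inverse[OF ts] by blast
    \<comment> \<open>The new time runs with reversed sign, since norms on the unstable side decay
      as time decreases.\<close>
    define f where "f y = N (\<xi> (- y)) (T (\<xi> (- y)) 0 z)" for y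
    have "f (- \<rho> t) \<le> K * exp 1 * exp (- ?\<mu> * (- \<rho> t - - \<rho> s)) * f (- \<rho> s)"
    proof (rule exponential_decay[OF K(1) L(1)])
      show "0 \<le> f x" if "x \<in> {- \<rho> s..- \<rho> t}" for x
        using \<xi>[of "- x"] that ts N_nonneg by (auto simp: f_def)
      show "- \<rho> s \<le> - \<rho> t"
        using rho_le[OF ts] by simp
      fix x y assume "- \<rho> s \<le> x" "x \<le> y" "y \<le> - \<rho> t"
      then have xy: "- x \<in> {\<rho> t..\<rho> s}" "- y \<in> {\<rho> t..\<rho> s}" "\<xi> (- y) \<le> \<xi> (- x)"
        using mono by auto
      note \<xi>x = \<xi>[OF xy(1)] and \<xi>y = \<xi>[OF xy(2)]
      show "f y \<le> K * f x"
        unfolding f_def using \<xi>y xy(3) ts z by (intro K(3)) auto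
      have "(\<rho> (\<xi> (- x)) - \<rho> (\<xi> (- y))) * N (\<xi> (- y)) (T (\<xi> (- y)) 0 z) \<le> L2 * N (\<xi> (- x)) (T (\<xi> (- x)) 0 z)"
        using \<xi>y xy(3) ts z by (intro L2(2)) auto
      then have "(y - x) * f y \<le> L2 * f x"
        using \<xi>x \<xi>y by (simp add: f_def)
      also have "\<dots> \<le> L * f x"
        using L(3) \<xi>x ts N_nonneg by (intro mult_right_mono) (auto simp: f_def)
      finally show "(y - x) * f y \<le> L * f x" .
    qed
    then show ?thesis
      by (simp add: f_def \<xi>0)
  qed
  have "0 < ?\<mu>" "0 < ?D"
    using L(1) K(1) by simp_all
  with stab unst show ?thesis
    by blast
qed

text \<open>The unstable part of \<open>v\<close> at time \<open>s\<close> is recorded by its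
  initial value in \<open>Z\<close>. In this description the evolution leaves it unchanged:
  \<open>zeta t (T t s v) = zeta s v\<close>.\<close>

definition zeta :: "real \<Rightarrow> 'a \<Rightarrow> 'a" where
  "zeta s v = (THE z. z \<in> Z \<and> v - T s 0 z \<in> stable s)"

lemma zeta_eq: "0 \<le> s \<Longrightarrow> z \<in> Z \<Longrightarrow> v - T s 0 z \<in> stable s \<Longrightarrow> zeta s v = z"
  unfolding zeta_def by (rule the_equality) (auto intro: Z_stable_unique)

lemma zeta:
  assumes "0 \<le> s"
  shows "zeta s v \<in> Z" "v - T s 0 (zeta s v) \<in> stable s"
  using bounded_growth assms zeta_eq[OF assms] by metis+

theorem admissible_imp_rho_dichotomy: "rho_dichotomy \<rho> T N"
proof -
  obtain K where K: "K > 0" "\<And>s v. 0 \<le> s \<Longrightarrow>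
      \<exists>z\<in>Z. v - T s 0 z \<in> stable s \<and> N s (T s 0 z) \<le> K * N s v \<and> N s (v - T s 0 z) \<le> K * N s v"
    using bounded_growth by blast
  have zeta_le: "N s (T s 0 (zeta s v)) \<le> K * N s v" "N s (v - T s 0 (zeta s v)) \<le> K * N s v"
    if "0 \<le> s" for s v
    using K(2)[OF that, of v] zeta_eq[OF that] by auto
  obtain \<mu> D where \<mu>: "0 < \<mu>" and D: "0 < D"
    and stab: "\<And>s t v. 0 \<le> s \<Longrightarrow> s \<le> t \<Longrightarrow> v \<in> stable s \<Longrightarrow>
      N t (T t s v) \<le> D * exp (- \<mu> * (\<rho> t - \<rho> s)) * N s v"
    and unst: "\<And>s t z. 0 \<le> t \<Longrightarrow> t \<le> s \<Longrightarrow> z \<in> Z \<Longrightarrow>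
      N t (T t 0 z) \<le> D * exp (- \<mu> * (\<rho> s - \<rho> t)) * N s (T s 0 z)"
    using exponential_bounds by blast
  have zeta_add: "zeta s (u + v) = zeta s u + zeta s v" if s: "0 \<le> s" for s u v
  proof (rule zeta_eq[OF s])
    show "zeta s u + zeta s v \<in> Z"
      by (rule subspace_add[OF Z(2) zeta(1)[OF s] zeta(1)[OF s]])
    have "(u - T s 0 (zeta s u)) + (v - T s 0 (zeta s v)) \<in> stable s"
      by (rule subspace_add[OF subspace_stable[OF s] zeta(2)[OF s] zeta(2)[OF s]])
    then show "u + v - T s 0 (zeta s u + zeta s v) \<in> stable s"
      by (simp add: blinfun.add_right algebra_simps)
  qed
  have zeta_scale: "zeta s (r *\<^sub>R v) = r *\<^sub>R zeta s v" if s: "0 \<le> s" for s r v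
  proof (rule zeta_eq[OF s])
    show "r *\<^sub>R zeta s v \<in> Z"
      by (rule subspace_scale[OF Z(2) zeta(1)[OF s]])
    have "r *\<^sub>R (v - T s 0 (zeta s v)) \<in> stable s"
      by (rule subspace_scale[OF subspace_stable[OF s] zeta(2)[OF s]])
    then show "r *\<^sub>R v - T s 0 (r *\<^sub>R zeta s v) \<in> stable s"
      by (simp add: blinfun.scaleR_right scaleR_diff_right)
  qed
  have zeta_T: "zeta t (T t s v) = zeta s v" if st: "0 \<le> s" "s \<le> t" for s t v
  proof (rule zeta_eq)
    have "T t s (v - T s 0 (zeta s v)) \<in> stable t"
      using st by (intro stable_T zeta(2)) auto
    then show "T t s v - T t 0 (zeta s v) \<in> stable t"
      using st by (simp add: blinfun.diff_right T_comp)
  qed (use st zeta(1) in auto)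
  have zeta_stable: "zeta s v = 0" if "0 \<le> s" "v \<in> stable s" for s v
    using that Z by (intro zeta_eq) (simp_all add: subspace_0)
  have zeta_Z: "zeta s (T s 0 z) = z" if "0 \<le> s" "z \<in> Z" for s z
    using that subspace_0[OF subspace_stable] by (intro zeta_eq) simp_all
  define P where "P s = Blinfun (\<lambda>v. v - T s 0 (zeta s v))" for s
  have P: "P s v = v - T s 0 (zeta s v)" if s: "0 \<le> s" for s v
  proof -
    \<comment> \<open>Linearity of \<open>zeta\<close> reflects uniqueness of the splitting; the
      operator is bounded because \<open>K\<close> bounds the splitting in \<open>N s\<close> and
      \<open>c s\<close> compares the norms.\<close>
    have "bounded_linear (\<lambda>v. v - T s 0 (zeta s v))"
    proof (rule bounded_linear_intro)
      fix v
      have "norm (v - T s 0 (zeta s v)) \<le> N s (v - T s 0 (zeta s v))"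
        by (rule norm_le_N[OF s])
      also have "\<dots> \<le> K * N s v"
        by (rule zeta_le(2)[OF s])
      also have "\<dots> \<le> K * (c s * norm v)"
        using K(1) N_le_norm[OF s] by (intro mult_left_mono) auto
      finally show "norm (v - T s 0 (zeta s v)) \<le> norm v * (K * c s)"
        by (simp add: ac_simps)
    qed (simp_all add: zeta_add zeta_scale s blinfun.add_right blinfun.scaleR_right scaleR_diff_right)
    then show ?thesis
      by (simp add: P_def bounded_linear_Blinfun_apply)
  qed
  have P_stable: "P s v \<in> stable s" if "0 \<le> s" for s v
    using that zeta(2) by (simp add: P)
  have Ker_P: "Ker (P s) = T s 0 ` Z" if s: "0 \<le> s" for s
  proof (intro equalityI subsetI)
    fix v assume "v \<in> Ker (P s)"
    then have "v = T s 0 (zeta s v)"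
      by (simp add: Ker_def P s)
    then show "v \<in> T s 0 ` Z"
      using zeta(1)[OF s] by blast
  qed (auto simp: Ker_def P s zeta_Z)
  \<comment> \<open>On the kernels \<open>zeta\<close> recovers the initial value in
    \<open>Z\<close>, so different vectors stay different.\<close>
  have inj: "inj_on (T t s) (Ker (P s))" if st: "0 \<le> s" "s \<le> t" for s t
  proof (rule inj_onI)
    fix u v assume "u \<in> Ker (P s)" "v \<in> Ker (P s)" and eq: "T t s u = T t s v"
    then obtain y z where yz: "y \<in> Z" "u = T s 0 y" "z \<in> Z" "v = T s 0 z"
      using st by (auto simp: Ker_P)
    then have T_eq: "T t 0 y = T t 0 z"
      using eq st by (simp add: T_comp)
    have "y = zeta t (T t 0 y)"
      using zeta_Z[of t y] yz(1) st by simp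
    also have "\<dots> = z"
      unfolding T_eq using zeta_Z[of t z] yz(3) st by simp
    finally show "u = v"
      by (simp only: yz(2,4))
  qed
  have bij: "bij_betw (T t s) (Ker (P s)) (Ker (P t))" if st: "0 \<le> s" "s \<le> t" for s t
  proof -
    \<comment> \<open>Both kernels are images of the same \<open>Z\<close>, which reduces
      surjectivity to the evolution law.\<close>
    have "T t s ` T s 0 ` Z = T t 0 ` Z"
      using st by (auto simp: T_comp image_iff)
    then show ?thesis
      using inj[OF st] st by (simp add: bij_betw_def Ker_P)
  qed
  \<comment> \<open>The preimage is known explicitly: it is the point at time \<open>t\<close> on
    the orbit of \<open>zeta s v\<close>.\<close>
  have backward: "backward T P t s ((id_blinfun - P s) v) = T t 0 (zeta s v)" if ts: "0 \<le> t" "t \<le> s" for s t v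
  proof -
    have "(id_blinfun - P s) v = T s t (T t 0 (zeta s v))"
      using ts by (simp add: blinfun.diff_left P T_comp)
    moreover have "T t 0 (zeta s v) \<in> Ker (P t)"
      using ts zeta(1)[of s v] by (auto simp: Ker_P)
    ultimately show ?thesis
      unfolding backward_def using inj[OF ts] by (simp add: inv_into_f_f)
  qed
  show ?thesis
    unfolding rho_dichotomy_def
  proof (intro exI[of _ P] conjI allI impI)
    show "P t o\<^sub>L P t = P t" if "0 \<le> t" for t
    proof (rule blinfun_eqI)
      fix v
      show "(P t o\<^sub>L P t) v = P t v"
        using P[OF that, of "P t v"] zeta_stable[OF that P_stable[OF that]] by simp
    qed
    show "T t s o\<^sub>L P s = P t o\<^sub>L T t s" if "0 \<le> s" "s \<le> t" for s t
    proof (rule blinfun_eqI)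
      fix v
      show "(T t s o\<^sub>L P s) v = (P t o\<^sub>L T t s) v"
        using that by (simp add: P zeta_T blinfun.diff_right T_comp)
    qed
    show "bij_betw (T t s) (Ker (P s)) (Ker (P t))" if "0 \<le> s" "s \<le> t" for s t
      using bij that .
    show "\<exists>\<mu>>0. \<exists>D>0. \<forall>x.
        (\<forall>s\<ge>0. \<forall>t\<ge>s. N t (T t s (P s x)) \<le> D * exp (- \<mu> * (\<rho> t - \<rho> s)) * N s x) \<and>
        (\<forall>t\<ge>0. \<forall>s\<ge>t. N t (backward T P t s ((id_blinfun - P s) x))
                      \<le> D * exp (- \<mu> * (\<rho> s - \<rho> t)) * N s x)"
    \<comment> \<open>\<open>D\<close> bounds the evolution on the two subspaces, and
      \<open>K\<close> bounds the two parts of a vector by the vector itself.\<close>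
    proof (rule exI[of _ \<mu>], rule conjI[OF \<mu>], rule exI[of _ "D * K"], rule conjI[OF mult_pos_pos[OF D K(1)]],
        intro allI conjI impI)
      fix s t :: real and v
      assume st: "0 \<le> s" "s \<le> t"
      have "N t (T t s (P s v)) \<le> D * exp (- \<mu> * (\<rho> t - \<rho> s)) * N s (P s v)"
        using st by (intro stab P_stable) auto
      also have "\<dots> \<le> D * exp (- \<mu> * (\<rho> t - \<rho> s)) * (K * N s v)"
        using st D zeta_le(2)[of s v] by (intro mult_left_mono) (simp_all add: P)
      finally show "N t (T t s (P s v)) \<le> D * K * exp (- \<mu> * (\<rho> t - \<rho> s)) * N s v"
        by (simp add: ac_simps)
    next
      fix s t :: real and v
      assume ts: "0 \<le> t" "t \<le> s"
      have "N t (T t 0 (zeta s v)) \<le> D * exp (- \<mu> * (\<rho> s - \<rho> t)) * N s (T s 0 (zeta s v))"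
        using ts by (intro unst zeta(1)) auto
      also have "\<dots> \<le> D * exp (- \<mu> * (\<rho> s - \<rho> t)) * (K * N s v)"
        using ts D zeta_le(1)[of s v] by (intro mult_left_mono) simp_all
      finally show "N t (backward T P t s ((id_blinfun - P s) v)) \<le> D * K * exp (- \<mu> * (\<rho> s - \<rho> t)) * N s v"
        using ts by (simp add: backward ac_simps)
    qed
  qed
qed

end

theorem theorem1:
  fixes T :: "real \<Rightarrow> real \<Rightarrow> 'a::banach \<Rightarrow>\<^sub>L 'a"
    and \<rho> \<rho>' :: "real \<Rightarrow> real"
    and N :: "real \<Rightarrow> 'a \<Rightarrow> real"
  assumes T: "evolution_family T"
    and rho_nonneg: "\<forall>t\<ge>0. 0 \<le> \<rho> t"
    and rho_mono: "strict_mono_on {0..} \<rho>"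
    and rho_deriv: "\<forall>t\<ge>0. (\<rho> has_real_derivative \<rho>' t) (at t within {0..})"
    and rho_C1: "continuous_on {0..} \<rho>'"
    and rho_0: "\<rho> 0 = 0"
    and rho_lim: "filterlim \<rho> at_top at_top"
    and N_norm: "\<forall>t\<ge>0. is_norm (N t)"
    and N_cont: "\<forall>x. continuous_on {0..} (\<lambda>t. N t x)"
    and N_bounds: "\<exists>C>0. \<exists>\<epsilon>\<ge>0. \<forall>x. \<forall>t\<ge>0.
      norm x \<le> N t x \<and> N t x \<le> C * exp (\<epsilon> * \<rho> t) * norm x"
    and admissible: "\<exists>Z. closed Z \<and> subspace Z \<and>
      (\<forall>y\<in>Y1 N. \<exists>!x. x \<in> YinfZ N Z \<and>
        (\<forall>s\<ge>0. \<forall>t\<ge>s. x t = T t s (x s)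
           + strong_integral (lebesgue_on {s..t}) (\<lambda>\<tau>. T t \<tau> (y \<tau>)))) \<and>
      (\<forall>y\<in>Yinf' N. \<exists>!x. x \<in> YinfZ N Z \<and>
        (\<forall>s\<ge>0. \<forall>t\<ge>s. x t = T t s (x s)
           + strong_integral (lebesgue_on {s..t}) (\<lambda>\<tau>. \<rho>' \<tau> *\<^sub>R T t \<tau> (y \<tau>))))"
  shows "rho_dichotomy \<rho> T N"
proof -
  obtain C \<epsilon> where C: "C > 0" "\<epsilon> \<ge> 0"
    and bounds: "\<And>x t. t \<ge> 0 \<Longrightarrow> norm x \<le> N t x \<and> N t x \<le> C * exp (\<epsilon> * \<rho> t) * norm x"
    using N_bounds by blast
  have rho_le: "\<rho> s \<le> \<rho> t" if "0 \<le> s" "s \<le> t" for s t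
    using rho_mono that by (auto simp: strict_mono_on_def le_less)
  interpret evolution_norms T N "\<lambda>t. C * exp (\<epsilon> * \<rho> t)"
  proof
    show "C * exp (\<epsilon> * \<rho> s) \<le> C * exp (\<epsilon> * \<rho> t)" if "0 \<le> s" "s \<le> t" for s t
      using C rho_le[OF that] by (simp add: mult_left_mono)
    show "0 \<le> C * exp (\<epsilon> * \<rho> t)" for t
      using C by simp
    show "evolution_family T"
      by (rule T)
    show "is_norm (N t)" if "t \<ge> 0" for t
      using N_norm that by simp
    show "continuous_on {0..} (\<lambda>t. N t x)" for x
      using N_cont by simp
    show "norm x \<le> N t x" "N t x \<le> C * exp (\<epsilon> * \<rho> t) * norm x" if "t \<ge> 0" for t x
      using bounds[OF that, of x] by blast+
  qed
  have "\<exists>Z. closed Z \<and> subspace Z \<and>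
      (\<forall>y\<in>Y1 N. \<exists>!x. x \<in> YinfZ N Z \<and> mild (forcing (\<lambda>_. 1) y) x) \<and>
      (\<forall>y\<in>Yinf' N. \<exists>!x. x \<in> YinfZ N Z \<and> mild (forcing \<rho>' y) x)"
    \<comment> \<open>The constant weight 1 in \<open>forcing\<close> disappears by
      \<open>scaleR_one\<close>; after that both statements are literally the same.\<close>
    using admissible unfolding mild_def forcing_def scaleR_one .
  then obtain Z where Z: "closed Z \<and> subspace Z \<and>
      (\<forall>y\<in>Y1 N. \<exists>!x. x \<in> YinfZ N Z \<and> mild (forcing (\<lambda>_. 1) y) x) \<and>
      (\<forall>y\<in>Yinf' N. \<exists>!x. x \<in> YinfZ N Z \<and> mild (forcing \<rho>' y) x)" ..
  interpret admissible_evolution T N "\<lambda>t. C * exp (\<epsilon> * \<rho> t)" \<rho> \<rho>' Z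
  proof
    show "(\<rho> has_real_derivative \<rho>' t) (at t within {0..})" if "t \<ge> 0" for t
      using rho_deriv that by simp
    show "\<exists>!x. x \<in> YinfZ N Z \<and> mild (forcing (\<lambda>_. 1) y) x" if "y \<in> Y1 N" for y
      using Z[THEN conjunct2, THEN conjunct2, THEN conjunct1] that by (rule bspec)
    show "\<exists>!x. x \<in> YinfZ N Z \<and> mild (forcing \<rho>' y) x" if "y \<in> Yinf' N" for y
      using Z[THEN conjunct2, THEN conjunct2, THEN conjunct2] that by (rule bspec)
  qed (simp_all add: rho_mono rho_C1 Z)
  show ?thesis
    by (rule admissible_imp_rho_dichotomy)
qed

end
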